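(* Let $A=\operatorname{Re}m_\infty(i)$, $B=-\operatorname{Im}m_\infty(i)$, $m=m_\infty(-0)$. Let $\mathcal S$ be a (finite) real number such that there is a Schrödinger L-system $\Theta_{\mu,h}$ ($\operatorname{Im}h>0$, $\mu\in\mathbb R\cup\{\infty\}$) with extremal accretive main operator $T_h$ and c-entropy $\mathcal S$. Then among all Schrödinger L-systems with c-entropy $\mathcal S$ and extremal accretive main operator the minimum coefficient of dissipation is $$\mathcal D_{min}=-\operatorname{Im}m_\infty(i)\coth\mathcal S-\sqrt{B^2\operatorname{csch}^2\mathcal S-(A-m)^2},$$ and the L-systems attaining it are those determined by the parameters $$h=-m_\infty(-0)+i\mathcal D_{min}\quad\text{and arbitrary}\quad\mu\in\mathbb R\cup\{\infty\}.$$
   Context: Setting. Let $\ell\in\mathbb R$, let $q$ be a (fixed) real locally summable function on $[\ell,+\infty)$, $l(y)=-y''+q(x)y$, $\mathcal H=L_2(\ell,+\infty)$. Let $D^*$ be the set of $y\in\mathcal H$ that are locally absolutely continuous together with $y'$ and satisfy $l(y)\in\mathcal H$. The minimal symmetric operator $\dot A y=l(y)$ with boundary conditions $y(\ell)=y'(\ell)=0$ is assumed to have deficiency indices $(1,1)$; $\operatorname{Dom}(\dot A^* )=D^*$, $\dot A^*y=l(y)$. For $h\in\mathbb C$ with $\operatorname{Im}h>0$, $T_h y=l(y)$ with domain $\{y\in D^*: y'(\ell)=hy(\ell)\}$. Weyl function. Let $\varphi_1,\varphi_2$ solve $l(\varphi_k)=\lambda\varphi_k$ with $\varphi_1(\ell,\lambda)=0,\varphi_1'(\ell,\lambda)=1$,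 $\varphi_2(\ell,\lambda)=-1,\varphi_2'(\ell,\lambda)=0$. The Weyl function $m_\infty(\lambda)$ is such that $\varphi_2(\cdot,\lambda)+m_\infty(\lambda)\varphi_1(\cdot,\lambda)\in L_2(\ell,+\infty)$. One has $\operatorname{Im}m_\infty(i)<0$. Standing assumptions: $\dot A$ is nonnegative, $(\dot Af,f)\ge0$ for $f\in\operatorname{Dom}(\dot A)$, and $m_\infty(-0):=\lim_{\lambda\to0,\lambda<0}m_\infty(\lambda)<\infty$. Schrödinger L-systems. $\mathcal H_+=D^*$ with $(y,z)_+=\int_\ell^\infty (y\bar z+l(y)\overline{l(z)})dx$, and $\mathcal H_+\subset\mathcal H\subset\mathcal H_-$ is the corresponding rigged triplet; $\delta(x-\ell),\delta'(x-\ell)\in\mathcal H_-$ act by $(y,\delta)=y(\ell)$, $(y,\delta')=-y'(\ell)$. For $\mu\in\mathbb R\cup\{\infty\}$ put $\mathbb A_{\mu,h}y=-y''+q y-\frac1{\mu-h}[y'(\ell)-hy(\ell)][\mu\delta(x-\ell)+\delta'(x-\ell)]$ and $g=\frac{(\operatorname{Im}h)^{1/2}}{|\mu-h|}[\mu\delta(x-\ell)+\delta'(x-\ell)]$ (limits as $\mu\to\infty$ if $\mu=\infty$), $Kc=cg$ for $c\in\mathbb C$; then $\operatorname{Im}\mathbb A_{\mu,h}=KK^*$. The array $\Theta_{\mu,h}=(\mathbb A_{\mu,h},K,1;\ \mathcal H_+\subset\mathcal H\subset\mathcal H_-,\mathbb C)$ is the Schrödinger L-system with main operator $T_h$ and state-space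 operator $\mathbb A_{\mu,h}$. Its transfer function is $W_{\Theta_{\mu,h}}(z)=I-2iK^*(\mathbb A_{\mu,h}-zI)^{-1}K=\frac{\mu-h}{\mu-\bar h}\cdot\frac{m_\infty(z)+\bar h}{m_\infty(z)+h}$ (limit as $\mu\to\infty$ if $\mu=\infty$). The coefficient of dissipation of $\Theta_{\mu,h}$ (and of $T_h$) is $\mathcal D=\operatorname{Im}h$. The c-entropy of $\Theta_{\mu,h}$ is $\mathcal S=-\ln|W_{\Theta_{\mu,h}}(-i)|$; it equals $-\ln|\kappa|$ where $|\kappa|=\left|\frac{m_\infty(i)+h}{m_\infty(i)+\bar h}\right|<1$ is the modulus of von Neumann's parameter of $T_h$. Accretivity. A linear operator $T$ is accretive if $\operatorname{Re}(Tf,f)\ge0$ for all $f\in\operatorname{Dom}(T)$; it is $\alpha$-sectorial, $\alpha\in(0,\pi/2)$, if $(\cot\alpha)|\operatorname{Im}(Tf,f)|\le\operatorname{Re}(Tf,f)$ for all $f\in\operatorname{Dom}(T)$; an accretive operator is extremal (extremal accretive) if it is not $\alpha$-sectorial for any $\alpha\in(0,\pi/2)$. *)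

theory Defs
  imports "HOL-Analysis.Analysis"
begin

definition coth :: "real \<Rightarrow> real" where
  "coth x = cosh x / sinh x"

definition csch :: "real \<Rightarrow> real" where
  "csch x = 1 / sinh x"


section \<open>The differential expression on the half-line\<close>

text \<open>
  Functions on \<open>[l, \<infinity>)\<close> are total functions on the reals whose values to the left
  of \<open>l\<close> are never looked at.
\<close>

type_synonym cfun = "real \<Rightarrow> complex"

definition locally_summable :: "real \<Rightarrow> (real \<Rightarrow> real) \<Rightarrow> bool" where
  "locally_summable l q \<longleftrightarrow> (\<forall>b. q absolutely_integrable_on {l..b})"

text \<open>
  The usual epsilon-delta definition; \<open>\<D> division_of \<Union>\<D>\<close> says that \<open>\<D>\<close> is a finite
  family of nonempty compact intervals with pairwise disjoint interiors.
\<close>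

definition absolutely_continuous_on :: "real set \<Rightarrow> cfun \<Rightarrow> bool" where
  "absolutely_continuous_on S f \<longleftrightarrow>
     (\<forall>\<epsilon>>0. \<exists>\<delta>>0. \<forall>\<D>. \<D> division_of \<Union>\<D> \<and> \<Union>\<D> \<subseteq> S \<and> (\<Sum>k\<in>\<D>. Sup k - Inf k) < \<delta> \<longrightarrow>
        (\<Sum>k\<in>\<D>. norm (f (Sup k) - f (Inf k))) < \<epsilon>)"

definition locally_AC :: "real \<Rightarrow> cfun \<Rightarrow> bool" where
  "locally_AC l f \<longleftrightarrow> (\<forall>b. absolutely_continuous_on {l..b} f)"

text \<open>The derivative on \<open>[l, \<infinity>)\<close>, one-sided at \<open>l\<close>.\<close>

definition dv :: "real \<Rightarrow> cfun \<Rightarrow> cfun" where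
  "dv l y x = vector_derivative y (at x within {l..})"

definition AC2 :: "real \<Rightarrow> cfun \<Rightarrow> bool" where
  "AC2 l y \<longleftrightarrow> (\<forall>x\<ge>l. y differentiable (at x within {l..})) \<and> locally_AC l y \<and> locally_AC l (dv l y)"

text \<open>
  \<open>- y'' + q y\<close>. For \<open>AC2 l y\<close> the second derivative exists almost everywhere; the values
  on the exceptional null set play no role below.
\<close>

definition SL :: "real \<Rightarrow> (real \<Rightarrow> real) \<Rightarrow> cfun \<Rightarrow> cfun" where
  "SL l q y x = - dv l (dv l y) x + of_real (q x) * y x"

definition L2 :: "real \<Rightarrow> cfun set" where
  "L2 l = {f. f \<in> borel_measurable (lebesgue_on {l..}) \<and>
              integrable (lebesgue_on {l..}) (\<lambda>x. (cmod (f x))\<^sup>2)}"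

definition ip :: "real \<Rightarrow> cfun \<Rightarrow> cfun \<Rightarrow> complex" where
  "ip l f g = (LINT x|lebesgue_on {l..}. f x * cnj (g x))"

text \<open>The domain of the adjoint of the minimal operator; it is also the space \<open>H\<^sub>+\<close>.\<close>

definition Dstar :: "real \<Rightarrow> (real \<Rightarrow> real) \<Rightarrow> cfun set" where
  "Dstar l q = {y \<in> L2 l. AC2 l y \<and> SL l q y \<in> L2 l}"

text \<open>All operators below act as \<open>SL l q\<close> and differ only in their domains.\<close>

definition Dom_min :: "real \<Rightarrow> (real \<Rightarrow> real) \<Rightarrow> cfun set" where
  "Dom_min l q = {y \<in> Dstar l q. y l = 0 \<and> dv l y l = 0}"

definition Dom_T :: "real \<Rightarrow> (real \<Rightarrow> real) \<Rightarrow> complex \<Rightarrow> cfun set" where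
  "Dom_T l q h = {y \<in> Dstar l q. dv l y l = h * y l}"

definition nonnegative_op :: "real \<Rightarrow> cfun set \<Rightarrow> (cfun \<Rightarrow> cfun) \<Rightarrow> bool" where
  "nonnegative_op l Dm T \<longleftrightarrow> (\<forall>f\<in>Dm. ip l (T f) f \<in> \<real>\<^sub>\<ge>\<^sub>0)"


section \<open>Deficiency indices\<close>

definition eigenspace :: "real \<Rightarrow> (real \<Rightarrow> real) \<Rightarrow> complex \<Rightarrow> cfun set" where
  "eigenspace l q z = {y \<in> Dstar l q. AE x in lebesgue_on {l..}. SL l q y x = z * y x}"

text \<open>Complex dimension \<open>n\<close>, where functions that agree on \<open>[l, \<infinity>)\<close> are identified.\<close>

definition has_dim :: "real \<Rightarrow> cfun set \<Rightarrow> nat \<Rightarrow> bool" where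
  "has_dim l N n \<longleftrightarrow> (\<exists>e :: nat \<Rightarrow> cfun.
     (\<forall>i<n. e i \<in> N) \<and>
     (\<forall>c. (\<forall>x\<ge>l. (\<Sum>i<n. c i * e i x) = 0) \<longrightarrow> (\<forall>i<n. c i = 0)) \<and>
     (\<forall>y\<in>N. \<exists>c. \<forall>x\<ge>l. y x = (\<Sum>i<n. c i * e i x)))"

definition has_deficiency_indices :: "real \<Rightarrow> (real \<Rightarrow> real) \<Rightarrow> nat \<Rightarrow> nat \<Rightarrow> bool" where
  "has_deficiency_indices l q n n' \<longleftrightarrow>
     has_dim l (eigenspace l q \<i>) n \<and> has_dim l (eigenspace l q (- \<i>)) n'"


section \<open>The Weyl function\<close>

definition is_solution :: "real \<Rightarrow> (real \<Rightarrow> real) \<Rightarrow> complex \<Rightarrow> cfun \<Rightarrow> bool" where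
  "is_solution l q z y \<longleftrightarrow> AC2 l y \<and> (AE x in lebesgue_on {l..}. SL l q y x = z * y x)"

definition fundamental_solutions ::
  "real \<Rightarrow> (real \<Rightarrow> real) \<Rightarrow> (complex \<Rightarrow> cfun) \<Rightarrow> (complex \<Rightarrow> cfun) \<Rightarrow> bool" where
  "fundamental_solutions l q \<phi>1 \<phi>2 \<longleftrightarrow> (\<forall>z.
     is_solution l q z (\<phi>1 z) \<and> \<phi>1 z l = 0 \<and> dv l (\<phi>1 z) l = 1 \<and>
     is_solution l q z (\<phi>2 z) \<and> \<phi>2 z l = -1 \<and> dv l (\<phi>2 z) l = 0)"

text \<open>
  The spectral parameter ranges over the complement of \<open>[0, \<infinity>)\<close>, where the Weyl function
  of a nonnegative minimal operator with deficiency indices \<open>(1, 1)\<close> is defined.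
\<close>

definition weyl_function ::
  "real \<Rightarrow> (complex \<Rightarrow> cfun) \<Rightarrow> (complex \<Rightarrow> cfun) \<Rightarrow> (complex \<Rightarrow> complex) \<Rightarrow> bool" where
  "weyl_function l \<phi>1 \<phi>2 m \<longleftrightarrow>
     (\<forall>z. z \<notin> \<real>\<^sub>\<ge>\<^sub>0 \<longrightarrow> (\<lambda>x. \<phi>2 z x + m z * \<phi>1 z x) \<in> L2 l)"


section \<open>Accretive and sectorial operators\<close>

definition accretive :: "real \<Rightarrow> cfun set \<Rightarrow> (cfun \<Rightarrow> cfun) \<Rightarrow> bool" where
  "accretive l Dm T \<longleftrightarrow> (\<forall>f\<in>Dm. 0 \<le> Re (ip l (T f) f))"

definition sectorial :: "real \<Rightarrow> real \<Rightarrow> cfun set \<Rightarrow> (cfun \<Rightarrow> cfun) \<Rightarrow> bool" where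
  "sectorial \<alpha> l Dm T \<longleftrightarrow> (\<forall>f\<in>Dm. cot \<alpha> * \<bar>Im (ip l (T f) f)\<bar> \<le> Re (ip l (T f) f))"

definition extremal_accretive :: "real \<Rightarrow> cfun set \<Rightarrow> (cfun \<Rightarrow> cfun) \<Rightarrow> bool" where
  "extremal_accretive l Dm T \<longleftrightarrow>
     accretive l Dm T \<and> (\<forall>\<alpha>. 0 < \<alpha> \<and> \<alpha> < pi / 2 \<longrightarrow> \<not> sectorial \<alpha> l Dm T)"


section \<open>Schroedinger L-systems\<close>

text \<open>
  An element \<open>\<phi>\<close> of \<open>H\<^sub>-\<close> is represented by the antilinear functional \<open>v \<mapsto> (\<phi>, v)\<close> on
  \<open>H\<^sub>+ = Dstar l q\<close>, so that \<open>f \<in> H\<close> becomes \<open>ip l f\<close> and equality in \<open>H\<^sub>-\<close> is equality of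
  the values at all \<open>v \<in> Dstar l q\<close>. Since \<open>(y, \<delta>) = y(l)\<close> and \<open>(y, \<delta>') = - y'(l)\<close>, the
  functionals of \<open>\<delta>\<close> and \<open>\<delta>'\<close> are the complex conjugates of these.
\<close>

type_synonym functional = "cfun \<Rightarrow> complex"

definition delta :: "real \<Rightarrow> functional" where
  "delta l v = cnj (v l)"

definition delta' :: "real \<Rightarrow> functional" where
  "delta' l v = - cnj (dv l v l)"

record L_system =
  main_domain :: "cfun set"
  main_operator :: "cfun \<Rightarrow> cfun"
  state_operator :: "cfun \<Rightarrow> functional"
  channel_operator :: "complex \<Rightarrow> functional"

text \<open>The parameter \<open>\<mu> \<in> \<real> \<union> {\<infinity>}\<close>.\<close>

datatype ext_param = Fin real | Infty

text \<open>
  For \<open>\<mu> = \<infinity>\<close> the clauses are the limits as \<open>\<mu> \<rightarrow> +\<infinity>\<close>, that is \<open>\<mu> / (\<mu> - h) \<rightarrow> 1\<close> and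
  \<open>\<mu> / \<bar>\<mu> - h\<bar> \<rightarrow> 1\<close>. Letting \<open>\<mu> \<rightarrow> -\<infinity>\<close> would only change the sign of \<open>g\<close>, which affects
  neither \<open>K K\<^sup>*\<close> nor the transfer function.
\<close>

fun A_op :: "real \<Rightarrow> (real \<Rightarrow> real) \<Rightarrow> ext_param \<Rightarrow> complex \<Rightarrow> cfun \<Rightarrow> functional" where
  "A_op l q (Fin \<mu>) h y v =
     ip l (SL l q y) v
     - 1 / (of_real \<mu> - h) * (dv l y l - h * y l) * (of_real \<mu> * delta l v + delta' l v)"
| "A_op l q Infty h y v = ip l (SL l q y) v - (dv l y l - h * y l) * delta l v"

fun g_vec :: "real \<Rightarrow> ext_param \<Rightarrow> complex \<Rightarrow> functional" where
  "g_vec l (Fin \<mu>) h v =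
     of_real (sqrt (Im h) / cmod (of_real \<mu> - h)) * (of_real \<mu> * delta l v + delta' l v)"
| "g_vec l Infty h v = of_real (sqrt (Im h)) * delta l v"

definition Theta :: "real \<Rightarrow> (real \<Rightarrow> real) \<Rightarrow> ext_param \<Rightarrow> complex \<Rightarrow> L_system" where
  "Theta l q \<mu> h =
     \<lparr> main_domain = Dom_T l q h,
       main_operator = SL l q,
       state_operator = A_op l q \<mu> h,
       channel_operator = (\<lambda>c v. c * g_vec l \<mu> h v) \<rparr>"

text \<open>
  \<open>K\<^sup>* : H\<^sub>+ \<rightarrow> \<complex>\<close> is determined by \<open>(K c, y) = c \<cdot> cnj (K\<^sup>* y)\<close>; take \<open>c = 1\<close>.
\<close>

definition channel_adjoint :: "L_system \<Rightarrow> cfun \<Rightarrow> complex" where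
  "channel_adjoint \<Theta> y = cnj (channel_operator \<Theta> 1 y)"

text \<open>
  \<open>W(z) = 1 - 2 \<i> K\<^sup>* (\<A> - z)\<^sup>-\<^sup>1 K 1\<close>, where \<open>y = (\<A> - z)\<^sup>-\<^sup>1 K 1\<close> is the solution in \<open>H\<^sub>+\<close> of
  \<open>\<A> y - z y = K 1\<close>, an equation in \<open>H\<^sub>-\<close>. It is meaningful for \<open>z\<close> in the resolvent set
  of the main operator.
\<close>

definition transfer_function :: "real \<Rightarrow> (real \<Rightarrow> real) \<Rightarrow> L_system \<Rightarrow> complex \<Rightarrow> complex" where
  "transfer_function l q \<Theta> z =
     (THE w. \<exists>y\<in>Dstar l q.
        (\<forall>v\<in>Dstar l q. state_operator \<Theta> y v - z * ip l y v = channel_operator \<Theta> 1 v) \<and>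
        w = 1 - 2 * \<i> * channel_adjoint \<Theta> y)"

definition c_entropy :: "real \<Rightarrow> (real \<Rightarrow> real) \<Rightarrow> L_system \<Rightarrow> ereal" where
  "c_entropy l q \<Theta> =
     (let w = transfer_function l q \<Theta> (- \<i>)
      in if w = 0 then \<infinity> else ereal (- ln (cmod w)))"

definition dissipation_coefficient :: "complex \<Rightarrow> real" where
  "dissipation_coefficient h = Im h"

text \<open>
  The parameters of all Schroedinger L-systems with extremal accretive main operator and
  c-entropy \<open>S\<close>.
\<close>

definition extremal_L_systems ::
  "real \<Rightarrow> (real \<Rightarrow> real) \<Rightarrow> real \<Rightarrow> (ext_param \<times> complex) set" where
  "extremal_L_systems l q S =
     {(\<mu>, h). 0 < Im h \<and>
        extremal_accretive l (main_domain (Theta l q \<mu> h)) (main_operator (Theta l q \<mu> h)) \<and>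
        c_entropy l q (Theta l q \<mu> h) = ereal S}"

end

theory Submission
  imports Defs
begin

text \<open>
  Write \<open>M = cnj (m_inf \<i>) = A + \<i> B\<close>. Two conditions select the parameters \<open>h\<close>. The operator \<open>T\<^sub>h\<close> is
  extremal accretive exactly on the line \<open>Re h = - m\<close> (\<open>extremal_accretive_iff\<close>), and the c-entropy
  is \<open>S\<close> exactly if \<open>\<bar>M + cnj h\<bar> = exp (- S) \<bar>M + h\<bar>\<close>, whatever \<open>\<mu>\<close> is (\<open>c_entropy_eq_iff\<close>). On the
  line, the second condition is a quadratic equation for the dissipation \<open>D = Im h\<close>, namely
  \<open>(D - B coth S)\<^sup>2 = B\<^sup>2 csch\<^sup>2 S - (A - m)\<^sup>2\<close> (\<open>dissipation_quadratic\<close>). Its roots are real as soon as one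
  system exists, and both are positive because their sum and their product are. So the smaller root
  is the minimum, and it is attained precisely at \<open>h = - m + \<i> Dmin\<close> with arbitrary \<open>\<mu>\<close>.

  Both conditions rest on Green's formula on the maximal domain, without a contribution from infinity
  (\<open>Green_formula\<close>). Its source is the nonnegativity of the minimal operator: the form is real, hence
  Hermitian, and every element of the maximal domain differs from one with vanishing initial values
  by an element with compact support, for which the formula is an integration by parts.
  The latter needs that an absolutely continuous function is differentiable almost everywhere
  (\<open>AC_differentiable_ae\<close>, from the Vitali covering theorem) and is the integral of its derivative
  (\<open>AC_fundamental_theorem\<close>, by a direct choice of a gauge).

  For the first condition, consider \<open>Q(f) = Re (l(f), f) - Re (f'(l) cnj f(l))\<close> on the maximal domain. If
  \<open>f(l) = 0\<close>, then \<open>Q(f) \<ge> 0\<close>, because \<open>f'(l)\<close> can be removed at no cost by elements concentrated near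
  \<open>l\<close> (\<open>Dirichlet_nonneg\<close>). Splitting off the Weyl solution at a point \<open>t < 0\<close> gives
  \<open>Q(f) \<ge> t \<parallel>f\<parallel>\<^sup>2 + m_inf t \<bar>f(l)\<bar>\<^sup>2\<close>, and \<open>t \<rightarrow> 0\<close> gives \<open>Q(f) \<ge> m \<bar>f(l)\<bar>\<^sup>2\<close> (\<open>form_bound\<close>). The Weyl
  solutions, corrected near \<open>l\<close> so as to satisfy the boundary condition, show that the constant \<open>m\<close> is
  optimal (\<open>form_bound_sharp\<close>). On the domain of \<open>T\<^sub>h\<close> one has \<open>Re (T\<^sub>h f, f) = Q(f) + Re h \<bar>f(l)\<bar>\<^sup>2\<close>
  and \<open>Im (T\<^sub>h f, f) = Im h \<bar>f(l)\<bar>\<^sup>2\<close>, which settles accretivity and sectoriality.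

  For the second condition, the equation that defines the transfer function at \<open>- \<i>\<close> is solved by a
  multiple of the Weyl solution at that point, and testing it against the Weyl solution at \<open>\<i>\<close> shows that every
  solution gives the same value (\<open>transfer_function_at_minus_i\<close>).
\<close>

section \<open>Negligible sets of irregular slopes\<close>

text \<open>
  The Vitali covering theorem for the line, in the form needed for difference quotients: the point
  \<open>x\<close> may be an endpoint of the interval \<open>{u..v}\<close> instead of its centre, so that any difference
  quotient at \<open>x\<close> yields an admissible interval.
\<close>

lemma Vitali_interval_subcover:
  fixes S U :: "real set" and P :: "real \<Rightarrow> real \<Rightarrow> bool"
  assumes U: "open U" "S \<subseteq> U"
    and fine: "\<And>x d. x \<in> S \<Longrightarrow> 0 < d \<Longrightarrow> \<exists>u v. u < v \<and> x \<in> {u..v} \<and> v - u < d \<and> P u v"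
  obtains \<C> where "countable \<C>" "pairwise disjnt \<C>"
    "\<And>k. k \<in> \<C> \<Longrightarrow> \<exists>u v. u < v \<and> k = {u..v} \<and> {u..v} \<subseteq> U \<and> P u v"
    "negligible (S - \<Union>\<C>)"
proof -
  define K where "K = {(u, v). u < v \<and> {u..v} \<subseteq> U \<and> P u v}"
  define a where "a = (\<lambda>(u, v). (u + v) / 2 :: real)"
  define r where "r = (\<lambda>(u, v). (v - u) / 2 :: real)"
  have cb: "cball (a (u, v)) (r (u, v)) = {u..v}" for u v
    by (simp add: a_def r_def cball_eq_atLeastAtMost field_simps)
  have r: "0 < r i" if "i \<in> K" for i
    using that by (auto simp: K_def r_def)
  have S: "\<exists>i. i \<in> K \<and> x \<in> cball (a i) (r i) \<and> r i < d" if x: "x \<in> S" and d: "0 < d" for x d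
  proof -
    obtain e where e: "e > 0" "ball x e \<subseteq> U"
      using U x by (meson open_contains_ball subsetD)
    obtain u v where uv: "u < v" "x \<in> {u..v}" "v - u < min d e" "P u v"
      using fine[OF x, of "min d e"] d e by auto
    have "{u..v} \<subseteq> ball x e"
      using uv by (auto simp: dist_real_def)
    with uv e have "(u, v) \<in> K" by (auto simp: K_def)
    moreover have "r (u, v) < d" using uv by (simp add: r_def)
    ultimately show ?thesis using cb[of u v] uv(2) by metis
  qed
  obtain C where C: "countable C" "C \<subseteq> K"
     "pairwise (\<lambda>i j. disjnt (cball (a i) (r i)) (cball (a j) (r j))) C"
     "negligible(S - (\<Union>i \<in> C. cball (a i) (r i)))"
    by (rule Vitali_covering_theorem_cballs[of K r S a, OF r S])
  show thesis
  proof
    show "countable ((\<lambda>i. cball (a i) (r i)) ` C)" using C by auto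
    show "pairwise disjnt ((\<lambda>i. cball (a i) (r i)) ` C)"
      by (rule pairwise_imageI) (use C(3) in \<open>auto simp: pairwise_def\<close>)
    show "\<exists>u v. u < v \<and> k = {u..v} \<and> {u..v} \<subseteq> U \<and> P u v"
      if k: "k \<in> (\<lambda>i. cball (a i) (r i)) ` C" for k
    proof -
      obtain i where i: "i \<in> C" "k = cball (a i) (r i)" using k by blast
      obtain u v where "i = (u, v)" by (cases i)
      then show ?thesis using i C(2) cb[of u v] unfolding K_def by blast
    qed
    show "negligible (S - \<Union> ((\<lambda>i. cball (a i) (r i)) ` C))" using C by simp
  qed
qed

lemma disjoint_intervals_division:
  fixes F :: "real set set"
  assumes "finite F" "pairwise disjnt F" "\<And>k. k \<in> F \<Longrightarrow> \<exists>u v. u \<le> v \<and> k = {u..v}"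
  shows "F division_of \<Union>F"
proof (rule division_ofI)
  show "interior K1 \<inter> interior K2 = {}" if "K1 \<in> F" "K2 \<in> F" "K1 \<noteq> K2" for K1 K2
  proof -
    have "K1 \<inter> K2 = {}" using assms(2) that by (auto simp: pairwise_def disjnt_def)
    then show ?thesis using interior_subset by blast
  qed
  show "K \<noteq> {}" "\<exists>a b. K = cbox a b" if "K \<in> F" for K
    using assms(3)[OF that] by auto
qed (use assms in auto)

lemma division_length_le_measure:
  fixes F :: "real set set"
  assumes "F division_of \<Union>F" "\<Union>F \<subseteq> U" "U \<in> lmeasurable"
  shows "(\<Sum>k\<in>F. Sup k - Inf k) \<le> measure lebesgue U"
proof -
  note D = division_ofD[OF assms(1)]
  have iv: "\<exists>u v. u \<le> v \<and> k = {u..v}" if "k \<in> F" for k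
    using D(3,4)[OF that] by fastforce
  have neg: "negligible (j \<inter> k)" if jk: "j \<in> F" "k \<in> F" "j \<noteq> k" for j k
  proof -
    obtain u v u' v' where e: "j = {u..v}" "k = {u'..v'}" using iv jk by meson
    have "interior (j \<inter> k) = {}" using D(5)[OF jk] by simp
    moreover have "convex (j \<inter> k)" by (simp add: e convex_Int)
    ultimately show ?thesis using negligible_convex_interior by blast
  qed
  have meas: "k \<in> lmeasurable" if "k \<in> F" for k
    using iv[OF that] by auto
  have "(\<Sum>k\<in>F. Sup k - Inf k) = (\<Sum>k\<in>F. measure lebesgue k)"
  proof (intro sum.cong refl)
    fix k assume "k \<in> F"
    then obtain u v where "u \<le> v" "k = {u..v}" using iv by blast
    then show "Sup k - Inf k = measure lebesgue k" by simp
  qed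
  also have "\<dots> = measure lebesgue (\<Union>F)"
    by (rule measure_negligible_finite_Union[symmetric])
       (use D(1) meas neg in \<open>auto simp: pairwise_def\<close>)
  also have "\<dots> \<le> measure lebesgue U"
    using assms meas D(1) by (intro measure_mono_fmeasurable) (auto intro: fmeasurableD)
  finally show ?thesis .
qed

text \<open>
  Two divisions of the same interval give the same total increment. This replaces a formula for the
  increment of a function over the difference of two finite unions of intervals.
\<close>

lemma division_telescope:
  fixes g :: "real \<Rightarrow> 'a::real_normed_vector"
  assumes "a \<le> b" "q division_of {a..b}"
  shows "(\<Sum>k\<in>q. g (Sup k) - g (Inf k)) = g b - g a"
proof -
  note D = division_ofD[OF assms(2)]
  have iv: "\<exists>u v. u \<le> v \<and> k = {u..v}" if "k \<in> q" for k
    using D(3,4)[OF that] by fastforce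
  have In: "Inf k \<in> k" if "k \<in> q" for k
    using iv[OF that] by auto
  let ?p = "(\<lambda>k. (Inf k, k)) ` q"
  have "?p tagged_division_of {a..b}"
  proof (rule tagged_division_ofI)
    show "\<Union> {K. \<exists>x. (x, K) \<in> ?p} = {a..b}"
    proof -
      have "{K. \<exists>x. (x, K) \<in> ?p} = q" by auto
      then show ?thesis using D(6) by simp
    qed
    show "finite ?p" using D(1) by simp
    show "\<exists>a b. K = cbox a b" if "(x, K) \<in> ?p" for x K
      using that D(4) by blast
    show "x \<in> K" "K \<subseteq> {a..b}" if "(x, K) \<in> ?p" for x K
      using that In D(2) by blast+
    show "interior K1 \<inter> interior K2 = {}"
      if "(x1, K1) \<in> ?p" "(x2, K2) \<in> ?p" "(x1, K1) \<noteq> (x2, K2)" for x1 K1 x2 K2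
      using that D(5) by blast
  qed
  from additive_tagged_division_1[OF assms(1) this, of g]
  have "sum (\<lambda>(x,K). g(Sup K) - g(Inf K)) ?p = g b - g a" .
  moreover have "sum (\<lambda>(x,K). g(Sup K) - g(Inf K)) ?p = (\<Sum>k\<in>q. g (Sup k) - g (Inf k))"
    by (subst sum.reindex) (auto simp: inj_on_def)
  ultimately show ?thesis by simp
qed

lemma AC_real_modulus:
  fixes g :: "real \<Rightarrow> real"
  assumes "absolutely_continuous_on S (\<lambda>x. of_real (g x))" "\<epsilon> > 0"
  obtains \<delta> where "\<delta> > 0"
    "\<And>\<D>. \<D> division_of \<Union>\<D> \<Longrightarrow> \<Union>\<D> \<subseteq> S \<Longrightarrow> (\<Sum>k\<in>\<D>. Sup k - Inf k) < \<delta> \<Longrightarrow>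
       (\<Sum>k\<in>\<D>. \<bar>g (Sup k) - g (Inf k)\<bar>) < \<epsilon>"
proof -
  have "norm (complex_of_real x - of_real y) = \<bar>x - y\<bar>" for x y
    by (metis norm_of_real of_real_diff)
  with assms show thesis
    unfolding absolutely_continuous_on_def using that by (metis (no_types, lifting) sum.cong)
qed

text \<open>
  On an interval shorter than the \<open>\<delta>\<close> that belongs to \<open>\<epsilon> = 1\<close>, disjoint intervals of slope at
  least \<open>1/e\<close> have total increment below \<open>1\<close> and therefore total length at most \<open>e\<close>. They cover
  the set up to a null set, and \<open>e\<close> is arbitrary.
\<close>

lemma negligible_infinite_slope:
  fixes g :: "real \<Rightarrow> real"
  assumes AC: "absolutely_continuous_on {a..b} (\<lambda>x. of_real (g x))"
    and S: "S \<subseteq> {a<..<b}"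
    and fine: "\<And>x d N. x \<in> S \<Longrightarrow> 0 < d \<Longrightarrow>
       \<exists>u v. u < v \<and> x \<in> {u..v} \<and> v - u < d \<and> N * (v - u) \<le> g v - g u"
  shows "negligible S"
proof (rule locally_negligible_alt[THEN iffD2], rule ballI)
  fix x assume x: "x \<in> S"
  obtain \<delta> where \<delta>: "\<delta> > 0"
    and ac: "\<And>\<D>. \<D> division_of \<Union>\<D> \<Longrightarrow> \<Union>\<D> \<subseteq> {a..b} \<Longrightarrow> (\<Sum>k\<in>\<D>. Sup k - Inf k) < \<delta> \<Longrightarrow>
       (\<Sum>k\<in>\<D>. \<bar>g (Sup k) - g (Inf k)\<bar>) < 1"
    by (rule AC_real_modulus[OF AC zero_less_one]) blast
  define U where "U = {max a (x - \<delta>/4)<..<min b (x + \<delta>/4)}"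
  have Uab: "U \<subseteq> {a..b}" by (auto simp: U_def)
  have xU: "x \<in> U" using x S \<delta> by (auto simp: U_def)
  have "negligible (S \<inter> U)"
    unfolding negligible_outer_le
  proof (intro allI impI)
    fix e :: real assume e: "e > 0"
    obtain \<C> where \<C>: "countable \<C>" "pairwise disjnt \<C>"
      "\<And>k. k \<in> \<C> \<Longrightarrow> \<exists>u v. u < v \<and> k = {u..v} \<and> {u..v} \<subseteq> U \<and> (1/e) * (v - u) \<le> g v - g u"
      "negligible (S \<inter> U - \<Union>\<C>)"
    proof (rule Vitali_interval_subcover[of U "S \<inter> U" "\<lambda>u v. (1/e) * (v - u) \<le> g v - g u"])
      show "open U" by (simp add: U_def)
      show "\<exists>u v. u < v \<and> y \<in> {u..v} \<and> v - u < d \<and> (1/e) * (v - u) \<le> g v - g u"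
        if "y \<in> S \<inter> U" "0 < d" for y d
        using fine[of y d "1/e"] that by blast
    qed blast+
    have lm: "k \<in> lmeasurable" if "k \<in> \<C>" for k
      using \<C>(3)[OF that] lmeasurable_interval by metis
    have bound: "measure lebesgue (\<Union>F) \<le> e" if F: "F \<subseteq> \<C>" "finite F" for F
    proof -
      have iv: "\<exists>u v. u < v \<and> k = {u..v} \<and> {u..v} \<subseteq> U \<and> (1/e) * (v - u) \<le> g v - g u" if "k \<in> F" for k
        using \<C>(3) that F by blast
      have div: "F division_of \<Union>F"
      proof (rule disjoint_intervals_division)
        show "pairwise disjnt F" using \<C>(2) F(1) by (rule pairwise_subset)
        show "\<exists>u v. u \<le> v \<and> k = {u..v}" if "k \<in> F" for k
          using iv[OF that] less_imp_le by blast
      qed (rule F)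
      have sub: "\<Union>F \<subseteq> U" using iv by blast
      have "(\<Sum>k\<in>F. Sup k - Inf k) \<le> measure lebesgue U"
        by (rule division_length_le_measure[OF div sub]) (simp add: U_def)
      also have "measure lebesgue U \<le> \<delta>/2" using \<delta> xU by (auto simp: U_def min_def max_def)
      also have "\<dots> < \<delta>" using \<delta> by simp
      finally have less1: "(\<Sum>k\<in>F. \<bar>g (Sup k) - g (Inf k)\<bar>) < 1"
        using sub Uab by (intro ac[OF div]) auto
      have "measure lebesgue (\<Union>F) \<le> (\<Sum>k\<in>F. measure lebesgue k)"
        using F lm by (intro measure_Union_le) (auto intro: fmeasurableD)
      also have "\<dots> \<le> (\<Sum>k\<in>F. e * \<bar>g (Sup k) - g (Inf k)\<bar>)"
      proof (rule sum_mono)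
        fix k assume "k \<in> F"
        then obtain u v where uv: "u < v" "k = {u..v}" "(1/e) * (v - u) \<le> g v - g u" using iv by blast
        then have "v - u \<le> e * (g v - g u)" using e by (simp add: field_simps)
        also have "\<dots> \<le> e * \<bar>g v - g u\<bar>" using e by simp
        finally show "measure lebesgue k \<le> e * \<bar>g (Sup k) - g (Inf k)\<bar>" using uv by simp
      qed
      also have "\<dots> = e * (\<Sum>k\<in>F. \<bar>g (Sup k) - g (Inf k)\<bar>)" by (simp add: sum_distrib_left)
      also have "\<dots> \<le> e * 1" using less1 e by (intro mult_left_mono) auto
      finally show ?thesis by simp
    qed
    have mU: "\<Union>\<C> \<in> lmeasurable" "measure lebesgue (\<Union>\<C>) \<le> e"
      by (rule fmeasurable_Union_bound[OF \<C>(1) lm bound], assumption+,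
          rule measure_Union_bound[OF \<C>(1) lm bound], assumption+)
    let ?T = "\<Union>\<C> \<union> (S \<inter> U - \<Union>\<C>)"
    have nm: "(S \<inter> U - \<Union>\<C>) \<in> lmeasurable" "measure lebesgue (S \<inter> U - \<Union>\<C>) = 0"
      using \<C>(4) negligible_iff_measure by blast+
    have "measure lebesgue ?T \<le> e"
      using measure_Un_le[of "\<Union>\<C>" lebesgue "S \<inter> U - \<Union>\<C>"] mU nm by (auto dest: fmeasurableD)
    moreover have "?T \<in> lmeasurable" using mU nm by (intro fmeasurable.Un) auto
    moreover have "S \<inter> U \<subseteq> ?T" by blast
    ultimately show "\<exists>T. S \<inter> U \<subseteq> T \<and> T \<in> lmeasurable \<and> measure lebesgue T \<le> e" by metis
  qed
  moreover have "openin (top_of_set S) (S \<inter> U)" by (simp add: U_def openin_open_Int)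
  ultimately show "\<exists>U. openin (top_of_set S) U \<and> x \<in> U \<and> negligible U" using x xU by blast
qed

lemma partial_division_Icc_extend:
  fixes p :: "real set set"
  assumes "p division_of \<Union>p" "\<Union>p \<subseteq> {a..b}"
  obtains q where "p \<subseteq> q" "q division_of {a..b}"
  using partial_division_extend_interval[of p a b] assms by (metis box_real(2))

text \<open>
  Let \<open>\<alpha>\<close> be the outer measure of \<open>S\<close>. Inside an open set of measure close to \<open>\<alpha>\<close>, the set is
  covered by disjoint intervals \<open>I\<close> of slope at most \<open>p\<close>, and again by disjoint intervals \<open>J\<close> of
  slope at least \<open>q\<close>, each contained in some \<open>I\<close>. Both families have total length close to \<open>\<alpha>\<close>,
  so the part of the \<open>I\<close> outside the \<open>J\<close> is short and, by absolute continuity, contributes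
  little to the increment. Hence \<open>q \<alpha>\<close> is almost at most \<open>p \<alpha>\<close>, which forces \<open>\<alpha> = 0\<close>. Absolute
  continuity plays here the part that monotonicity plays for Lebesgue's theorem.
\<close>

lemma negligible_oscillating_slope:
  fixes g :: "real \<Rightarrow> real"
  assumes AC: "absolutely_continuous_on {a..b} (\<lambda>x. of_real (g x))"
    and S: "S \<subseteq> {a<..<b}" and ab: "a < b" and pq: "p < q"
    and below: "\<And>x d. x \<in> S \<Longrightarrow> 0 < d \<Longrightarrow>
       \<exists>u v. u < v \<and> x \<in> {u..v} \<and> v - u < d \<and> g v - g u \<le> p * (v - u)"
    and above: "\<And>x d. x \<in> S \<Longrightarrow> 0 < d \<Longrightarrow>
       \<exists>u v. u < v \<and> x \<in> {u..v} \<and> v - u < d \<and> q * (v - u) \<le> g v - g u"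
  shows "negligible S"
proof -
  define \<M> where "\<M> = {measure lebesgue T | T. T \<in> lmeasurable \<and> S \<subseteq> T}"
  define \<alpha> where "\<alpha> = Inf \<M>"
  have ne: "\<M> \<noteq> {}"
    using S unfolding \<M>_def by (auto intro!: exI[of _ "{a<..<b}"])
  have bdd: "bdd_below \<M>" unfolding \<M>_def by (auto intro!: bdd_belowI[of _ 0])
  have \<alpha>0: "\<alpha> \<ge> 0" unfolding \<alpha>_def using ne by (intro cInf_greatest) (auto simp: \<M>_def)
  have \<alpha>_le: "\<alpha> \<le> measure lebesgue T" if T: "T \<in> lmeasurable" "negligible (S - T)" for T
  proof -
    have n: "S - T \<in> lmeasurable" "measure lebesgue (S - T) = 0"
      using T(2) negligible_iff_measure by blast+
    have "T \<union> (S - T) \<in> lmeasurable" using T(1) n by (intro fmeasurable.Un)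
    then have "measure lebesgue (T \<union> (S - T)) \<in> \<M>"
      unfolding \<M>_def by blast
    then have "\<alpha> \<le> measure lebesgue (T \<union> (S - T))"
      unfolding \<alpha>_def by (intro cInf_lower bdd)
    also have "\<dots> \<le> measure lebesgue T"
      using measure_Un_le[of T lebesgue "S - T"] T n by (simp add: fmeasurableD)
    finally show ?thesis .
  qed
  have key: "(q - p) * \<alpha> \<le> e * (1 + \<bar>p\<bar> + \<bar>q\<bar>)" if e: "0 < e" for e
  proof -
    obtain \<delta> where \<delta>: "\<delta> > 0"
      and ac: "\<And>\<D>. \<D> division_of \<Union>\<D> \<Longrightarrow> \<Union>\<D> \<subseteq> {a..b} \<Longrightarrow> (\<Sum>k\<in>\<D>. Sup k - Inf k) < \<delta> \<Longrightarrow>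
         (\<Sum>k\<in>\<D>. \<bar>g (Sup k) - g (Inf k)\<bar>) < e"
      by (rule AC_real_modulus[OF AC e]) blast
    \<comment> \<open>The leftover \<open>R'\<close> below has length less than \<open>2 \<eta>\<close>, which must be less than \<open>\<delta>\<close>.\<close>
    define \<eta> where "\<eta> = min e (\<delta> / 3)"
    have \<eta>: "0 < \<eta>" "\<eta> \<le> e" "2 * \<eta> < \<delta>" using e \<delta> by (auto simp: \<eta>_def)
    obtain T where T: "T \<in> lmeasurable" "S \<subseteq> T" "measure lebesgue T < \<alpha> + \<eta> / 2"
    proof -
      have "\<exists>t\<in>\<M>. t < \<alpha> + \<eta> / 2"
        using cInf_less_iff[OF ne bdd, of "\<alpha> + \<eta> / 2"] \<eta> by (simp add: \<alpha>_def)
      then show thesis using that unfolding \<M>_def by blast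
    qed
    obtain O' where O': "open O'" "T \<subseteq> O'" "O' - T \<in> lmeasurable" "emeasure lebesgue (O' - T) < ennreal (\<eta> / 2)"
      using sets_lebesgue_outer_open[of T "\<eta> / 2"] T \<eta> by (metis fmeasurableD half_gt_zero)
    define U where "U = O' \<inter> {a<..<b}"
    have U: "open U" "S \<subseteq> U" "U \<subseteq> {a..b}" using O' T S by (auto simp: U_def)
    have Um: "U \<in> lmeasurable" unfolding U_def
      using O'(1) by (subst Int_commute, intro fmeasurable_Int_fmeasurable) auto
    have mU: "measure lebesgue U < \<alpha> + \<eta>"
    proof -
      have mO: "measure lebesgue (O' - T) < \<eta> / 2"
        using O'(3,4) \<eta> by (simp add: emeasure_eq_measure2 ennreal_less_iff)
      have "measure lebesgue U \<le> measure lebesgue (T \<union> (O' - T))"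
        using fmeasurable.Un[OF T(1) O'(3)] Um O'(2)
        by (intro measure_mono_fmeasurable fmeasurableD) (auto simp: U_def)
      also have "\<dots> \<le> measure lebesgue T + measure lebesgue (O' - T)"
        using T(1) O'(3) by (intro measure_Un_le) (auto simp: fmeasurableD)
      finally show ?thesis using T(3) mO by simp
    qed
    obtain \<I> where \<I>: "countable \<I>" "pairwise disjnt \<I>"
      "\<And>k. k \<in> \<I> \<Longrightarrow> \<exists>u v. u < v \<and> k = {u..v} \<and> {u..v} \<subseteq> U \<and> g v - g u \<le> p * (v - u)"
      "negligible (S - \<Union>\<I>)"
    proof (rule Vitali_interval_subcover[of U S "\<lambda>u v. g v - g u \<le> p * (v - u)"])
    qed (use U below in blast)+
    \<comment> \<open>Passing to interiors loses only countably many endpoints, and leaves room around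
      each remaining point for small intervals inside a member of \<open>\<I>\<close>.\<close>
    define V where "V = (\<Union>k\<in>\<I>. interior k)"
    have V: "open V" "V \<subseteq> U"
      using \<I>(3) interior_subset unfolding V_def by blast+
    have SV: "negligible (S - V)"
    proof (rule negligible_subset[OF negligible_Un[OF \<I>(4)]])
      show "negligible (\<Union>k\<in>\<I>. k - interior k)"
      proof (intro negligible_countable_Union countable_image \<I>(1))
        fix X assume "X \<in> (\<lambda>k. k - interior k) ` \<I>"
        then obtain u v where "X = {u..v} - interior {u..v}" using \<I>(3) by blast
        then have "X \<subseteq> {u, v}" by auto
        then show "negligible X" by (meson finite.emptyI finite.insertI finite_subset negligible_finite)
      qed
    qed (auto simp: V_def)
    obtain \<J> where \<J>: "countable \<J>" "pairwise disjnt \<J>"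
      "\<And>k. k \<in> \<J> \<Longrightarrow> \<exists>u v. u < v \<and> k = {u..v} \<and> {u..v} \<subseteq> V \<and> ((\<exists>i\<in>\<I>. {u..v} \<subseteq> i) \<and> q * (v - u) \<le> g v - g u)"
      "negligible (S \<inter> V - \<Union>\<J>)"
    proof (rule Vitali_interval_subcover[of V "S \<inter> V" "\<lambda>u v. (\<exists>i\<in>\<I>. {u..v} \<subseteq> i) \<and> q * (v - u) \<le> g v - g u"])
      show "\<exists>u v. u < v \<and> x \<in> {u..v} \<and> v - u < d \<and> ((\<exists>i\<in>\<I>. {u..v} \<subseteq> i) \<and> q * (v - u) \<le> g v - g u)"
        if x: "x \<in> S \<inter> V" and d: "0 < d" for x d
      proof -
        obtain i where i: "i \<in> \<I>" "x \<in> interior i" using x by (auto simp: V_def)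
        obtain r where r: "r > 0" "ball x r \<subseteq> i" using i(2) unfolding mem_interior by blast
        obtain u v where uv: "u < v" "x \<in> {u..v}" "v - u < min d r" "q * (v - u) \<le> g v - g u"
          using above[of x "min d r"] x d r by auto
        have "{u..v} \<subseteq> ball x r" using uv by (auto simp: dist_real_def)
        then show ?thesis using uv r(2) i(1) by (metis min_less_iff_conj order_trans)
      qed
    qed (use V in blast)+
    have ivJ: "\<exists>u v. u \<le> v \<and> k = {u..v}" if "k \<in> \<J>" for k using \<J>(3)[OF that] less_imp_le by blast
    have ivI: "\<exists>u v. u \<le> v \<and> k = {u..v}" if "k \<in> \<I>" for k using \<I>(3)[OF that] less_imp_le by blast
    have subJ: "\<Union>\<J> \<subseteq> U" using \<J>(3) V(2) by blast
    have subI: "\<Union>\<I> \<subseteq> U" using \<I>(3) by blast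
    have divJ: "F division_of \<Union>F" if "F \<subseteq> \<J>" "finite F" for F
      using that ivJ pairwise_subset[OF \<J>(2)] by (intro disjoint_intervals_division) blast+
    have divI: "F division_of \<Union>F" if "F \<subseteq> \<I>" "finite F" for F
      using that ivI pairwise_subset[OF \<I>(2)] by (intro disjoint_intervals_division) blast+
    have lmJ: "k \<in> lmeasurable" if "k \<in> \<J>" for k using ivJ[OF that] lmeasurable_interval by metis
    have boundJ: "measure lebesgue (\<Union>F) \<le> \<alpha> + \<eta>" if "F \<subseteq> \<J>" "finite F" for F
    proof -
      have "measure lebesgue (\<Union>F) \<le> measure lebesgue U"
        using that lmJ subJ Um by (intro measure_mono_fmeasurable) (auto intro!: sets.finite_Union fmeasurableD)
      then show ?thesis using mU by simp
    qed
    have "\<Union>\<J> \<in> lmeasurable" by (rule fmeasurable_Union_bound[OF \<J>(1) lmJ boundJ])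
    moreover have "negligible (S - \<Union>\<J>)"
      by (rule negligible_subset[OF negligible_Un[OF SV \<J>(4)]]) blast
    ultimately have "\<alpha> \<le> measure lebesgue (\<Union>\<J>)" by (rule \<alpha>_le)
    then obtain J where J: "J \<subseteq> \<J>" "finite J" "\<alpha> - \<eta> < measure lebesgue (\<Union>J)"
      using measure_countable_Union_approachable[OF \<J>(1) \<eta>(1) lmJ boundJ]
      by (metis diff_right_mono order_le_less_trans)
    have "\<exists>i. i \<in> \<I> \<and> k \<subseteq> i" if "k \<in> J" for k using that J(1) \<J>(3) by blast
    then obtain f where f: "\<And>k. k \<in> J \<Longrightarrow> f k \<in> \<I> \<and> k \<subseteq> f k" by metis
    define I where "I = f ` J"
    have I: "I \<subseteq> \<I>" "finite I" "\<Union>J \<subseteq> \<Union>I" using f J by (auto simp: I_def)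
    \<comment> \<open>\<open>I\<close> is completed by \<open>R\<close> to a division of \<open>{a..b}\<close>, and \<open>J \<union> R\<close> by \<open>R'\<close> to a second
      one. Comparing the two totals, the increments over \<open>I\<close> equal those over \<open>J\<close> and \<open>R'\<close>.\<close>
    have "\<Union>I \<subseteq> {a..b}" using I(1) subI U(3) by blast
    then obtain Q where Q: "I \<subseteq> Q" "Q division_of {a..b}"
      by (rule partial_division_Icc_extend[OF divI[OF I(1,2)]])
    define R where "R = Q - I"
    note QD = division_ofD[OF Q(2)]
    have JR: "J \<union> R division_of \<Union>(J \<union> R)"
    proof (rule division_ofI)
      show "interior K1 \<inter> interior K2 = {}" if K: "K1 \<in> J \<union> R" "K2 \<in> J \<union> R" "K1 \<noteq> K2" for K1 K2
      proof -
        have mixed: "interior A \<inter> interior B = {}" if A: "A \<in> J" and B: "B \<in> R" for A B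
        proof -
          have "f A \<in> Q" "B \<in> Q" "f A \<noteq> B" using A B Q(1) by (auto simp: R_def I_def)
          then have "interior (f A) \<inter> interior B = {}" by (rule QD(5))
          moreover have "interior A \<subseteq> interior (f A)" using f[OF A] by (simp add: interior_mono)
          ultimately show ?thesis by blast
        qed
        show ?thesis
        proof (cases "K1 \<in> J"; cases "K2 \<in> J")
          assume "K1 \<in> J" "K2 \<in> J"
          then show ?thesis using division_ofD(5)[OF divJ[OF J(1,2)]] K(3) by blast
        next
          assume "K1 \<notin> J" "K2 \<notin> J"
          then have "K1 \<in> Q" "K2 \<in> Q" using K by (auto simp: R_def)
          then show ?thesis using QD(5) K(3) by blast
        qed (use mixed K in blast)+
      qed
      show "K \<noteq> {}" "\<exists>a b. K = cbox a b" if "K \<in> J \<union> R" for K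
        using that QD(3,4) ivJ J(1) by (fastforce simp: R_def)+
    qed (use J(2) QD(1) in \<open>auto simp: R_def\<close>)
    have JRsub: "\<Union>(J \<union> R) \<subseteq> {a..b}"
      using QD(2) J(1) subJ U(3) by (auto simp: R_def)
    obtain Q' where Q': "J \<union> R \<subseteq> Q'" "Q' division_of {a..b}"
      using partial_division_Icc_extend[OF JR JRsub] .
    define R' where "R' = Q' - (J \<union> R)"
    have disjJR: "J \<inter> R = {}"
    proof -
      have False if k: "k \<in> J" "k \<in> R" for k
      proof -
        have "f k \<in> Q" "k \<in> Q" "f k \<noteq> k" using k Q(1) by (auto simp: R_def I_def)
        then have "interior (f k) \<inter> interior k = {}" by (rule QD(5))
        moreover have "interior k \<subseteq> interior (f k)" using f[OF k(1)] by (simp add: interior_mono)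
        moreover obtain u v where "u < v" "k = {u..v}" using k(1) J(1) \<J>(3) by blast
        moreover from this have "interior k = {u<..<v}" "{u<..<v} \<noteq> {}" by auto
        ultimately show False by blast
      qed
      then show ?thesis by blast
    qed
    have finQ': "finite Q'" using Q'(2) by blast
    have split: "(\<Sum>k\<in>I. G (Sup k) - G (Inf k)) = (\<Sum>k\<in>J. G (Sup k) - G (Inf k)) + (\<Sum>k\<in>R'. G (Sup k) - G (Inf k))"
      for G :: "real \<Rightarrow> real"
    proof -
      let ?h = "\<lambda>k. G (Sup k) - G (Inf k)"
      have "sum ?h Q = sum ?h Q'"
        using division_telescope[OF less_imp_le[OF ab] Q(2), of G] division_telescope[OF less_imp_le[OF ab] Q'(2), of G]
        by simp
      moreover have "sum ?h Q = sum ?h R + sum ?h I"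
        using Q(1) QD(1) by (simp add: R_def sum.subset_diff)
      moreover have "sum ?h Q' = sum ?h R' + sum ?h (J \<union> R)"
        using Q'(1) finQ' by (simp add: R'_def sum.subset_diff)
      moreover have "sum ?h (J \<union> R) = sum ?h J + sum ?h R"
        using J(2) QD(1) disjJR by (intro sum.union_disjoint) (auto simp: R_def)
      ultimately show ?thesis by simp
    qed
    define lI where "lI = (\<Sum>k\<in>I. Sup k - Inf k)"
    define lJ where "lJ = (\<Sum>k\<in>J. Sup k - Inf k)"
    have lJ: "\<alpha> - \<eta> < lJ"
    proof -
      have "measure lebesgue (\<Union>J) \<le> (\<Sum>k\<in>J. measure lebesgue k)"
        using J lmJ by (intro measure_Union_le) (auto intro: fmeasurableD)
      also have "\<dots> = lJ" unfolding lJ_def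
      proof (rule sum.cong[OF refl])
        fix k assume "k \<in> J"
        then obtain u v where "u \<le> v" "k = {u..v}" using ivJ J(1) by blast
        then show "measure lebesgue k = Sup k - Inf k" by simp
      qed
      finally show ?thesis using J(3) by simp
    qed
    have lI: "lI < \<alpha> + \<eta>"
      using division_length_le_measure[OF divI[OF I(1,2)] _ Um] subI I(1) mU by (force simp: lI_def)
    have lJ': "lJ < \<alpha> + \<eta>"
      using division_length_le_measure[OF divJ[OF J(1,2)] _ Um] subJ J(1) mU by (force simp: lJ_def)
    have R'len: "(\<Sum>k\<in>R'. Sup k - Inf k) = lI - lJ"
      using split[of "\<lambda>x. x"] by (simp add: lI_def lJ_def)
    have R'div: "R' division_of \<Union>R'"
      unfolding R'_def by (rule division_of_subset[OF division_of_union_self[OF Q'(2)] Diff_subset])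
    have R'sub: "\<Union>R' \<subseteq> {a..b}" using division_ofD(2)[OF Q'(2)] by (auto simp: R'_def)
    have lI': "\<alpha> - \<eta> < lI"
    proof -
      have "0 \<le> (\<Sum>k\<in>R'. Sup k - Inf k)"
      proof (rule sum_nonneg)
        fix k assume "k \<in> R'"
        then obtain u v where "k = cbox u v" "k \<noteq> {}" using division_ofD(3,4)[OF R'div] by metis
        then show "0 \<le> Sup k - Inf k" by simp
      qed
      then show ?thesis using R'len lJ by simp
    qed
    have small: "(\<Sum>k\<in>R'. \<bar>g (Sup k) - g (Inf k)\<bar>) < e"
      using lJ lI \<eta> R'len by (intro ac R'div R'sub) simp
    have "(\<Sum>k\<in>I. g (Sup k) - g (Inf k)) \<le> (\<Sum>k\<in>I. p * (Sup k - Inf k))"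
    proof (rule sum_mono)
      fix k assume "k \<in> I"
      then obtain u v where "u < v" "k = {u..v}" "g v - g u \<le> p * (v - u)" using \<I>(3) I(1) by blast
      then show "g (Sup k) - g (Inf k) \<le> p * (Sup k - Inf k)" by simp
    qed
    then have 1: "(\<Sum>k\<in>I. g (Sup k) - g (Inf k)) \<le> p * lI" by (simp add: lI_def sum_distrib_left)
    have "(\<Sum>k\<in>J. q * (Sup k - Inf k)) \<le> (\<Sum>k\<in>J. g (Sup k) - g (Inf k))"
    proof (rule sum_mono)
      fix k assume "k \<in> J"
      then obtain u v where "u < v" "k = {u..v}" "q * (v - u) \<le> g v - g u" using \<J>(3) J(1) by blast
      then show "q * (Sup k - Inf k) \<le> g (Sup k) - g (Inf k)" by simp
    qed
    then have 2: "q * lJ \<le> (\<Sum>k\<in>J. g (Sup k) - g (Inf k))" by (simp add: lJ_def sum_distrib_left)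
    have 3: "- e \<le> (\<Sum>k\<in>R'. g (Sup k) - g (Inf k))"
      using small sum_abs[of "\<lambda>k. g (Sup k) - g (Inf k)" R'] by linarith
    have "q * lJ - e \<le> p * lI" using 1 2 3 split[of g] by linarith
    moreover have "q * \<alpha> - \<bar>q\<bar> * e \<le> q * lJ"
    proof -
      have "\<bar>q * (\<alpha> - lJ)\<bar> \<le> \<bar>q\<bar> * e"
        unfolding abs_mult using lJ lJ' \<eta> by (intro mult_left_mono) auto
      then show ?thesis by (simp add: right_diff_distrib)
    qed
    moreover have "p * lI \<le> p * \<alpha> + \<bar>p\<bar> * e"
    proof -
      have "\<bar>p * (lI - \<alpha>)\<bar> \<le> \<bar>p\<bar> * e"
        unfolding abs_mult using lI lI' \<eta> by (intro mult_left_mono) auto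
      then show ?thesis by (simp add: right_diff_distrib)
    qed
    ultimately show ?thesis by (simp add: algebra_simps)
  qed
  have "(q - p) * \<alpha> \<le> 0"
  proof (rule field_le_epsilon)
    fix e :: real assume e: "0 < e"
    have "0 < e / (1 + \<bar>p\<bar> + \<bar>q\<bar>)" using e by (simp add: add_pos_nonneg)
    from key[OF this] show "(q - p) * \<alpha> \<le> 0 + e"
      by (simp add: add_pos_nonneg less_imp_neq[symmetric])
  qed
  then have "\<alpha> \<le> 0" using pq by (simp add: mult_le_0_iff)
  show ?thesis
    unfolding negligible_outer
  proof (intro allI impI)
    fix e :: real assume "0 < e"
    then have "\<exists>t\<in>\<M>. t < e"
      using cInf_less_iff[OF ne bdd, of e] \<open>\<alpha> \<le> 0\<close> by (simp add: \<alpha>_def)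
    then show "\<exists>T. S \<subseteq> T \<and> T \<in> lmeasurable \<and> measure lebesgue T < e"
      unfolding \<M>_def by blast
  qed
qed

lemma frequently_slope_above:
  fixes g :: "real \<Rightarrow> real"
  assumes "\<exists>\<^sub>F y in at x. c < (g y - g x) / (y - x)" "0 < d"
  shows "\<exists>u v. u < v \<and> x \<in> {u..v} \<and> v - u < d \<and> c * (v - u) \<le> g v - g u"
proof -
  have "\<not> (\<forall>\<^sub>F y in at x. \<not> (c < (g y - g x) / (y - x)))"
    using assms(1) by (simp add: frequently_def)
  then obtain y where y: "y \<noteq> x" "dist y x < d" "c < (g y - g x) / (y - x)"
    using assms(2) unfolding eventually_at by (metis UNIV_I)
  show ?thesis
  proof (cases "x < y")
    case True
    then have "c * (y - x) < g y - g x" using y(3) by (simp add: pos_less_divide_eq)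
    then show ?thesis using True y(2) by (intro exI[of _ x] exI[of _ y]) (auto simp: dist_real_def)
  next
    case False
    then have "y < x" using y(1) by simp
    moreover from this have "c * (x - y) < g x - g y" using y(3) by (simp add: field_simps)
    ultimately show ?thesis using y(2) by (intro exI[of _ y] exI[of _ x]) (auto simp: dist_real_def)
  qed
qed

lemma frequently_slope_below:
  fixes g :: "real \<Rightarrow> real"
  assumes "\<exists>\<^sub>F y in at x. (g y - g x) / (y - x) < c" "0 < d"
  shows "\<exists>u v. u < v \<and> x \<in> {u..v} \<and> v - u < d \<and> g v - g u \<le> c * (v - u)"
proof -
  have "(- c < (- g y - - g x) / (y - x)) = ((g y - g x) / (y - x) < c)" for y
  proof -
    have "(- g y - - g x) / (y - x) = - ((g y - g x) / (y - x))" by (simp add: minus_divide_left)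
    then show ?thesis by linarith
  qed
  then have "\<exists>\<^sub>F y in at x. - c < (- g y - - g x) / (y - x)"
    using assms(1) by simp
  from frequently_slope_above[OF this assms(2)]
  obtain u v where "u < v" "x \<in> {u..v}" "v - u < d" "- c * (v - u) \<le> - g v - - g u" by blast
  then show ?thesis by (intro exI[of _ u] exI[of _ v]) simp
qed

section \<open>Algebra of absolutely continuous functions\<close>

text \<open>
  Sums, products, conjugates, real parts and Lipschitz functions are all absolutely continuous for
  the same reason: their increments are dominated by increments of absolutely continuous functions.
\<close>

lemma AC_dominated:
  assumes "absolutely_continuous_on S f" "absolutely_continuous_on S g"
    and dom: "\<And>u v. u \<in> S \<Longrightarrow> v \<in> S \<Longrightarrow> norm (h v - h u) \<le> C * (norm (f v - f u) + norm (g v - g u))"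
  shows "absolutely_continuous_on S h"
  unfolding absolutely_continuous_on_def
proof (intro allI impI)
  fix \<epsilon> :: real assume \<epsilon>: "0 < \<epsilon>"
  define c where "c = 2 * (\<bar>C\<bar> + 1)"
  have c: "c > 0" by (simp add: c_def add_nonneg_pos)
  have ec: "\<epsilon> / c > 0" using \<epsilon> c by simp
  obtain \<delta>1 where d1: "\<delta>1 > 0" "\<And>\<D>. \<D> division_of \<Union>\<D> \<and> \<Union>\<D> \<subseteq> S \<and> (\<Sum>k\<in>\<D>. Sup k - Inf k) < \<delta>1 \<Longrightarrow>
        (\<Sum>k\<in>\<D>. norm (f (Sup k) - f (Inf k))) < \<epsilon> / c"
    using assms(1) ec unfolding absolutely_continuous_on_def by meson
  obtain \<delta>2 where d2: "\<delta>2 > 0" "\<And>\<D>. \<D> division_of \<Union>\<D> \<and> \<Union>\<D> \<subseteq> S \<and> (\<Sum>k\<in>\<D>. Sup k - Inf k) < \<delta>2 \<Longrightarrow>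
        (\<Sum>k\<in>\<D>. norm (g (Sup k) - g (Inf k))) < \<epsilon> / c"
    using assms(2) ec unfolding absolutely_continuous_on_def by meson
  show "\<exists>\<delta>>0. \<forall>\<D>. \<D> division_of \<Union>\<D> \<and> \<Union>\<D> \<subseteq> S \<and> (\<Sum>k\<in>\<D>. Sup k - Inf k) < \<delta> \<longrightarrow>
        (\<Sum>k\<in>\<D>. norm (h (Sup k) - h (Inf k))) < \<epsilon>"
  proof (intro exI[of _ "min \<delta>1 \<delta>2"] conjI allI impI)
    fix \<D> assume D: "\<D> division_of \<Union>\<D> \<and> \<Union>\<D> \<subseteq> S \<and> (\<Sum>k\<in>\<D>. Sup k - Inf k) < min \<delta>1 \<delta>2"
    have "(\<Sum>k\<in>\<D>. norm (h (Sup k) - h (Inf k))) \<le>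
       (\<Sum>k\<in>\<D>. (\<bar>C\<bar> + 1) * (norm (f (Sup k) - f (Inf k)) + norm (g (Sup k) - g (Inf k))))"
    proof (rule sum_mono)
      fix k assume k: "k \<in> \<D>"
      then obtain u v where uv: "k = cbox u v" "k \<noteq> {}" using D division_ofD(3,4) by metis
      then have "k = {u..v}" "u \<le> v" by auto
      moreover have "k \<subseteq> S" using k D by blast
      ultimately have "Sup k \<in> S" "Inf k \<in> S" by auto
      then have "norm (h (Sup k) - h (Inf k)) \<le> C * (norm (f (Sup k) - f (Inf k)) + norm (g (Sup k) - g (Inf k)))"
        using dom by blast
      also have "\<dots> \<le> (\<bar>C\<bar> + 1) * (norm (f (Sup k) - f (Inf k)) + norm (g (Sup k) - g (Inf k)))"
        by (intro mult_right_mono) auto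
      finally show "norm (h (Sup k) - h (Inf k)) \<le> (\<bar>C\<bar> + 1) * (norm (f (Sup k) - f (Inf k)) + norm (g (Sup k) - g (Inf k)))" .
    qed
    also have "\<dots> = (\<bar>C\<bar> + 1) * ((\<Sum>k\<in>\<D>. norm (f (Sup k) - f (Inf k))) + (\<Sum>k\<in>\<D>. norm (g (Sup k) - g (Inf k))))"
      by (simp add: sum_distrib_left sum.distrib distrib_left)
    also have "\<dots> < (\<bar>C\<bar> + 1) * (\<epsilon> / c + \<epsilon> / c)"
      using d1(2)[of \<D>] d2(2)[of \<D>] D by (intro mult_strict_left_mono add_strict_mono) auto
    also have "\<dots> = c * (\<epsilon> / c)" by (simp only: c_def) algebra
    also have "\<dots> = \<epsilon>" using c by simp
    finally show "(\<Sum>k\<in>\<D>. norm (h (Sup k) - h (Inf k))) < \<epsilon>" .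
  qed (use d1 d2 in auto)
qed

lemma AC_of_real: "absolutely_continuous_on S of_real"
  unfolding absolutely_continuous_on_def
proof (intro allI impI)
  fix \<epsilon> :: real assume \<epsilon>: "0 < \<epsilon>"
  show "\<exists>\<delta>>0. \<forall>\<D>. \<D> division_of \<Union>\<D> \<and> \<Union>\<D> \<subseteq> S \<and> (\<Sum>k\<in>\<D>. Sup k - Inf k) < \<delta> \<longrightarrow>
        (\<Sum>k\<in>\<D>. norm (complex_of_real (Sup k) - of_real (Inf k))) < \<epsilon>"
  proof (intro exI[of _ \<epsilon>] conjI allI impI \<epsilon>)
    fix \<D> assume D: "\<D> division_of \<Union>\<D> \<and> \<Union>\<D> \<subseteq> S \<and> (\<Sum>k\<in>\<D>. Sup k - Inf k) < \<epsilon>"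
    have "(\<Sum>k\<in>\<D>. norm (complex_of_real (Sup k) - of_real (Inf k))) = (\<Sum>k\<in>\<D>. Sup k - Inf k)"
    proof (rule sum.cong[OF refl])
      fix k assume k: "k \<in> \<D>"
      then obtain u v where uv: "k = cbox u v" "k \<noteq> {}" using D division_ofD(3,4) by metis
      then have "k = {u..v}" "u \<le> v" by auto
      then show "norm (complex_of_real (Sup k) - of_real (Inf k)) = Sup k - Inf k"
        by (simp flip: of_real_diff)
    qed
    then show "(\<Sum>k\<in>\<D>. norm (complex_of_real (Sup k) - of_real (Inf k))) < \<epsilon>" using D by simp
  qed
qed

lemma AC_Lipschitz:
  assumes "\<And>u v. u \<in> S \<Longrightarrow> v \<in> S \<Longrightarrow> norm (h v - h u) \<le> C * \<bar>v - u\<bar>"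
  shows "absolutely_continuous_on S h"
proof (rule AC_dominated[OF AC_of_real AC_of_real, where C = "C / 2"])
  fix u v assume "u \<in> S" "v \<in> S"
  have "norm (complex_of_real v - of_real u) = \<bar>v - u\<bar>" by (metis norm_of_real of_real_diff)
  then show "norm (h v - h u) \<le> C / 2 * (norm (complex_of_real v - of_real u) + norm (complex_of_real v - of_real u))"
    using assms[OF \<open>u \<in> S\<close> \<open>v \<in> S\<close>] by simp
qed

lemma AC_imp_continuous_on:
  assumes "absolutely_continuous_on {a..b} f"
  shows "continuous_on {a..b} f"
  unfolding continuous_on_iff
proof (intro ballI allI impI)
  fix x \<epsilon> :: real assume x: "x \<in> {a..b}" and \<epsilon>: "0 < \<epsilon>"
  obtain \<delta> where d: "\<delta> > 0" "\<And>\<D>. \<D> division_of \<Union>\<D> \<and> \<Union>\<D> \<subseteq> {a..b} \<and> (\<Sum>k\<in>\<D>. Sup k - Inf k) < \<delta> \<Longrightarrow>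
        (\<Sum>k\<in>\<D>. norm (f (Sup k) - f (Inf k))) < \<epsilon>"
    using assms \<epsilon> unfolding absolutely_continuous_on_def by meson
  have *: "norm (f v - f u) < \<epsilon>" if "u \<le> v" "u \<in> {a..b}" "v \<in> {a..b}" "v - u < \<delta>" for u v
  proof -
    have "{{u..v}} division_of {u..v}"
      using division_of_self[of u v] that(1) by auto
    then show ?thesis using d(2)[of "{{u..v}}"] that by auto
  qed
  show "\<exists>d>0. \<forall>x'\<in>{a..b}. dist x' x < d \<longrightarrow> dist (f x') (f x) < \<epsilon>"
  proof (intro exI[of _ \<delta>] conjI ballI impI d(1))
    fix y assume y: "y \<in> {a..b}" "dist y x < \<delta>"
    show "dist (f y) (f x) < \<epsilon>"
    proof (cases "x \<le> y")
      case True
      then show ?thesis using *[of x y] x y by (auto simp: dist_norm dist_real_def)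
    next
      case False
      then show ?thesis using *[of y x] x y by (auto simp: dist_norm dist_real_def norm_minus_commute)
    qed
  qed
qed

lemma AC_add: "absolutely_continuous_on S f \<Longrightarrow> absolutely_continuous_on S g \<Longrightarrow>
    absolutely_continuous_on S (\<lambda>x. f x + g x)"
proof (rule AC_dominated[where C = 1])
  fix u v show "cmod (f v + g v - (f u + g u)) \<le> 1 * (cmod (f v - f u) + cmod (g v - g u))"
    using norm_triangle_ineq[of "f v - f u" "g v - g u"] by (simp add: algebra_simps)
qed

lemma AC_cnj: "absolutely_continuous_on S f \<Longrightarrow> absolutely_continuous_on S (\<lambda>x. cnj (f x))"
  by (rule AC_dominated[of S f f _ 1]) (auto simp flip: complex_cnj_diff)

lemma AC_Re: "absolutely_continuous_on S f \<Longrightarrow> absolutely_continuous_on S (\<lambda>x. of_real (Re (f x)))"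
  by (rule AC_dominated[of S f f _ 1])
     (auto simp flip: of_real_diff minus_complex.sel intro: order_trans[OF abs_Re_le_cmod])

lemma AC_Im: "absolutely_continuous_on S f \<Longrightarrow> absolutely_continuous_on S (\<lambda>x. of_real (Im (f x)))"
  by (rule AC_dominated[of S f f _ 1])
     (auto simp flip: of_real_diff minus_complex.sel intro: order_trans[OF abs_Im_le_cmod])

lemma AC_mult:
  assumes f: "absolutely_continuous_on {a..b} f" and g: "absolutely_continuous_on {a..b} g"
  shows "absolutely_continuous_on {a..b} (\<lambda>x. f x * g x)"
proof -
  have "bounded (f ` {a..b})" "bounded (g ` {a..b})"
    by (intro compact_imp_bounded compact_continuous_image AC_imp_continuous_on f g; simp)+
  then obtain F G where FG: "\<And>x. x \<in> {a..b} \<Longrightarrow> norm (f x) \<le> F" "\<And>x. x \<in> {a..b} \<Longrightarrow> norm (g x) \<le> G"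
    unfolding bounded_iff by blast
  show ?thesis
  proof (rule AC_dominated[OF f g, where C = "max F G"])
    fix u v assume uv: "u \<in> {a..b}" "v \<in> {a..b}"
    have "f v * g v - f u * g u = f v * (g v - g u) + (f v - f u) * g u" by (simp add: algebra_simps)
    then have "norm (f v * g v - f u * g u) \<le> norm (f v) * norm (g v - g u) + norm (f v - f u) * norm (g u)"
      by (metis norm_mult norm_triangle_ineq)
    also have "\<dots> \<le> max F G * norm (g v - g u) + norm (f v - f u) * max F G"
      using FG uv by (intro add_mono mult_right_mono mult_left_mono) (auto simp: le_max_iff_disj)
    finally show "norm (f v * g v - f u * g u) \<le> max F G * (norm (f v - f u) + norm (g v - g u))"
      by (simp add: algebra_simps)
  qed
qed

lemma AC_const: "absolutely_continuous_on S (\<lambda>_. c)"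
  by (rule AC_Lipschitz[where C = 0]) simp

section \<open>Lebesgue's differentiation theorem and the fundamental theorem of calculus\<close>

text \<open>
  If the lower and the upper limit of the difference quotient at \<open>x\<close> differ, two rationals separate
  them and \<open>x\<close> lies in one of countably many sets of oscillating slope; if they are equal and
  infinite, \<open>x\<close> lies in a set of infinite slope. All these sets are negligible.
\<close>

lemma AC_real_differentiable_ae:
  fixes g :: "real \<Rightarrow> real"
  assumes AC: "absolutely_continuous_on {a..b} (\<lambda>x. of_real (g x))"
  shows "negligible {x \<in> {a<..<b}. \<not> g differentiable (at x)}"
proof (cases "a < b")
  case ab: True
  define s where "s = (\<lambda>x y. (g y - g x) / (y - x))"
  define P where "P = {x \<in> {a<..<b}. \<forall>N. \<exists>\<^sub>F y in at x. N < s x y}"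
  define M where "M = {x \<in> {a<..<b}. \<forall>N. \<exists>\<^sub>F y in at x. s x y < N}"
  define E where "E = (\<lambda>(p, q). {x \<in> {a<..<b}. (\<exists>\<^sub>F y in at x. s x y < p) \<and> (\<exists>\<^sub>F y in at x. q < s x y)})"
  have "negligible P"
    by (rule negligible_infinite_slope[OF AC])
       (use frequently_slope_above in \<open>auto simp: P_def s_def\<close>)
  moreover have "negligible M"
  proof (rule negligible_infinite_slope[of a b "\<lambda>x. - g x"])
    show "absolutely_continuous_on {a..b} (\<lambda>x. of_real (- g x))"
      by (rule AC_dominated[OF AC AC, of _ 1]) (auto simp: norm_minus_commute)
    show "\<exists>u v. u < v \<and> x \<in> {u..v} \<and> v - u < d \<and> N * (v - u) \<le> - g v - - g u"
      if "x \<in> M" "0 < d" for x d N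
    proof -
      have "\<exists>\<^sub>F y in at x. (g y - g x) / (y - x) < - N" using that by (auto simp: M_def s_def)
      from frequently_slope_below[OF this that(2)]
      obtain u v where "u < v" "x \<in> {u..v}" "v - u < d" "g v - g u \<le> - N * (v - u)" by blast
      then show ?thesis by (intro exI[of _ u] exI[of _ v]) auto
    qed
  qed (auto simp: M_def)
  moreover have "negligible (\<Union>(E ` {(p, q). p \<in> \<rat> \<and> q \<in> \<rat> \<and> p < q}))"
  proof (intro negligible_countable_Union countable_image)
    show "countable {(p, q). p \<in> \<rat> \<and> q \<in> \<rat> \<and> p < (q::real)}"
      by (rule countable_subset[OF _ countable_SIGMA[OF countable_rat countable_rat]]) auto
    fix X assume "X \<in> E ` {(p, q). p \<in> \<rat> \<and> q \<in> \<rat> \<and> p < q}"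
    then obtain p q where pq: "p < q" "X = E (p, q)" by auto
    show "negligible X" unfolding pq(2)
      by (rule negligible_oscillating_slope[OF AC _ ab pq(1)])
         (use frequently_slope_above frequently_slope_below in \<open>auto simp: E_def s_def\<close>)
  qed
  ultimately have "negligible (P \<union> M \<union> \<Union>(E ` {(p, q). p \<in> \<rat> \<and> q \<in> \<rat> \<and> p < q}))" by simp
  then show ?thesis
  proof (rule negligible_subset; intro subsetI; rule_tac ccontr)
    fix x assume x: "x \<in> {x \<in> {a<..<b}. \<not> g differentiable at x}"
      and nx: "x \<notin> P \<union> M \<union> \<Union>(E ` {(p, q). p \<in> \<rat> \<and> q \<in> \<rat> \<and> p < q})"
    define lo where "lo = Liminf (at x) (\<lambda>y. ereal (s x y))"
    define hi where "hi = Limsup (at x) (\<lambda>y. ereal (s x y))"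
    have fl: "\<exists>\<^sub>F y in at x. s x y < c" if "lo < ereal c" for c
    proof (rule ccontr)
      assume "\<not> (\<exists>\<^sub>F y in at x. s x y < c)"
      then have "\<forall>\<^sub>F y in at x. ereal c \<le> ereal (s x y)" by (simp add: frequently_def not_less)
      then have "ereal c \<le> lo" unfolding lo_def by (rule Liminf_bounded)
      with that show False by simp
    qed
    have fh: "\<exists>\<^sub>F y in at x. c < s x y" if "ereal c < hi" for c
    proof (rule ccontr)
      assume "\<not> (\<exists>\<^sub>F y in at x. c < s x y)"
      then have "\<forall>\<^sub>F y in at x. ereal (s x y) \<le> ereal c" by (simp add: frequently_def not_less)
      then have "hi \<le> ereal c" unfolding hi_def by (rule Limsup_bounded)
      with that show False by simp
    qed
    have "lo \<le> hi" unfolding lo_def hi_def by (rule Liminf_le_Limsup) simp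
    moreover have "\<not> lo < hi"
    proof
      assume "lo < hi"
      then obtain c1 where "lo < ereal c1" "ereal c1 < hi" using ereal_dense2 by blast
      moreover from this(2) obtain c2 where c2: "ereal c1 < ereal c2" "ereal c2 < hi" using ereal_dense2 by blast
      moreover from c2 obtain c3 where c3: "ereal c2 < ereal c3" "ereal c3 < hi" using ereal_dense2 by blast
      moreover from c2 obtain p where p: "p \<in> \<rat>" "c1 < p" "p < c2" using Rats_dense_in_real by auto
      moreover from c3 obtain q where q: "q \<in> \<rat>" "c2 < q" "q < c3" using Rats_dense_in_real by auto
      ultimately have "lo < ereal p" "ereal q < hi"
        by (meson ereal_less(2) less_ereal.simps(1) order_less_trans)+
      then have "x \<in> E (p, q)" using fl fh x by (auto simp: E_def)
      then show False using nx p q by fastforce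
    qed
    ultimately have eq: "lo = hi" by simp
    have "hi \<noteq> \<infinity>" using fh nx x by (auto simp: P_def)
    moreover have "lo \<noteq> - \<infinity>" using fl nx x by (auto simp: M_def)
    ultimately obtain r where r: "hi = ereal r" using eq by (cases hi) auto
    have "((\<lambda>y. ereal (s x y)) \<longlongrightarrow> ereal r) (at x)"
      using eq r by (subst tendsto_iff_Liminf_eq_Limsup) (auto simp: lo_def hi_def)
    then have "((\<lambda>y. s x y) \<longlongrightarrow> r) (at x)" by simp
    then have "(g has_field_derivative r) (at x)"
      unfolding has_field_derivative_iff s_def .
    then have "g differentiable at x"
      using real_differentiable_def by blast
    with x show False by simp
  qed
qed auto

lemma AC_differentiable_ae:
  assumes AC: "absolutely_continuous_on {a..b} f"
  shows "negligible {x \<in> {a<..<b}. \<not> f differentiable (at x)}"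
proof (rule negligible_subset[OF negligible_Un[OF AC_real_differentiable_ae[OF AC_Re[OF AC]] AC_real_differentiable_ae[OF AC_Im[OF AC]]]])
  have "f differentiable at x" if "(\<lambda>x. Re (f x)) differentiable at x" "(\<lambda>x. Im (f x)) differentiable at x" for x
  proof -
    have "(\<lambda>y. Re (f y) *\<^sub>R 1 + Im (f y) *\<^sub>R \<i>) differentiable at x"
      using that by (intro differentiable_add differentiable_scaleR) auto
    moreover have "(\<lambda>y. Re (f y) *\<^sub>R 1 + Im (f y) *\<^sub>R \<i>) = f"
      by (auto simp: complex_eq_iff)
    ultimately show ?thesis by simp
  qed
  then show "{x \<in> {a<..<b}. \<not> f differentiable at x}
    \<subseteq> {x \<in> {a<..<b}. \<not> (\<lambda>x. Re (f x)) differentiable at x} \<union> {x \<in> {a<..<b}. \<not> (\<lambda>x. Im (f x)) differentiable at x}"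
    by blast
qed

text \<open>
  For a tagged division that is fine for a suitable gauge, tags outside the null set \<open>N\<close> contribute
  little to the error by differentiability. Tags in \<open>N\<close> belong to intervals inside an open set of
  small measure, over which the increment of \<open>f\<close> is small by absolute continuity.
\<close>

lemma AC_fundamental_theorem:
  assumes ab: "a \<le> b" and AC: "absolutely_continuous_on {a..b} f"
    and N: "negligible N"
    and f': "\<And>x. x \<in> {a..b} - N \<Longrightarrow> (f has_vector_derivative f' x) (at x within {a..b})"
  shows "(f' has_integral (f b - f a)) {a..b}"
proof (rule has_integral_spike[OF N])
  define f'' where "f'' = (\<lambda>x. if x \<in> N then 0 else f' x)"
  show "f' x = f'' x" if "x \<in> {a..b} - N" for x using that by (simp add: f''_def)
  show "(f'' has_integral (f b - f a)) {a..b}"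
    unfolding has_integral_real
  proof (intro allI impI)
    fix e :: real assume e: "0 < e"
    obtain \<delta> where \<delta>: "\<delta> > 0"
      and ac: "\<And>\<D>. \<D> division_of \<Union>\<D> \<and> \<Union>\<D> \<subseteq> {a..b} \<and> (\<Sum>k\<in>\<D>. Sup k - Inf k) < \<delta> \<Longrightarrow>
         (\<Sum>k\<in>\<D>. norm (f (Sup k) - f (Inf k))) < e / 2"
      using AC e unfolding absolutely_continuous_on_def by (meson half_gt_zero)
    obtain T where T: "open T" "N \<subseteq> T" "T \<in> lmeasurable" "measure lebesgue T < \<delta>"
    proof -
      have Nl: "N \<in> sets lebesgue" "N \<in> lmeasurable" "measure lebesgue N = 0"
        using N negligible_iff_measure by (auto simp: fmeasurableD)
      obtain T where T: "open T" "N \<subseteq> T" "T - N \<in> lmeasurable" "emeasure lebesgue (T - N) < ennreal \<delta>"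
        using sets_lebesgue_outer_open[OF Nl(1) \<delta>] by blast
      have m: "measure lebesgue (T - N) < \<delta>" using T(3,4) \<delta> by (simp add: emeasure_eq_measure2 ennreal_less_iff)
      have eq: "N \<union> (T - N) = T" using T(2) by blast
      have "T \<in> lmeasurable" using fmeasurable.Un[OF Nl(2) T(3)] eq by simp
      moreover have "measure lebesgue T < \<delta>"
        using measure_Un_le[of N lebesgue "T - N"] Nl T(3) m eq by (simp add: fmeasurableD)
      ultimately show thesis using that T by blast
    qed
    \<comment> \<open>Each kind of tag may contribute \<open>e / 2\<close>; adding \<open>1\<close> keeps the denominator positive for \<open>a = b\<close>.\<close>
    define e' where "e' = e / (2 * (b - a + 1))"
    have e': "e' > 0" using e ab by (simp add: e'_def)
    have "\<exists>d>0. \<forall>y\<in>{a..b}. norm (y - x) < d \<longrightarrow> norm (f y - f x - (y - x) *\<^sub>R f' x) \<le> e' * norm (y - x)"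
      if "x \<in> {a..b} - N" for x
      using f'[OF that] e' unfolding has_vector_derivative_def has_derivative_within_alt by blast
    then obtain d where d: "\<And>x. x \<in> {a..b} - N \<Longrightarrow> d x > 0"
      "\<And>x y. x \<in> {a..b} - N \<Longrightarrow> y \<in> {a..b} \<Longrightarrow> norm (y - x) < d x \<Longrightarrow>
         norm (f y - f x - (y - x) *\<^sub>R f' x) \<le> e' * norm (y - x)"
      by metis
    define \<gamma> where "\<gamma> = (\<lambda>x. if x \<in> N then T else if x \<in> {a..b} then ball x (d x) else UNIV)"
    have gauge: "gauge \<gamma>" unfolding gauge_def \<gamma>_def using T(1,2) d(1) by auto
    have main: "norm ((\<Sum>(x, k)\<in>p. measure lborel k *\<^sub>R f'' x) - (f b - f a)) < e"
      if p: "p tagged_division_of {a..b}" and fine: "\<gamma> fine p" for p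
    proof -
      note pD = tagged_division_ofD[OF p]
      define h where "h = (\<lambda>k::real set. if k = {} then 0 else f (Sup k) - f (Inf k))"
      have hk: "h k = f (Sup k) - f (Inf k)" if "(x, k) \<in> p" for x k
        using pD(2)[OF that] by (auto simp: h_def)
      have iv: "\<exists>u v. u \<le> v \<and> k = {u..v} \<and> x \<in> {u..v} \<and> {u..v} \<subseteq> {a..b}" if xk: "(x, k) \<in> p" for x k
      proof -
        obtain u v where "k = cbox u v" using pD(4)[OF xk] by blast
        then show ?thesis using pD(2,3)[OF xk] by (intro exI[of _ u] exI[of _ v]) auto
      qed
      define pN where "pN = {(x, k) \<in> p. x \<in> N}"
      have pN: "pN \<subseteq> p" by (auto simp: pN_def)
      have finp: "finite p" using p by blast
      have "(\<Sum>(x, k)\<in>p. measure lborel k *\<^sub>R f'' x) - (f b - f a) = (\<Sum>(x, k)\<in>p. measure lborel k *\<^sub>R f'' x - h k)"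
      proof -
        have "f b - f a = (\<Sum>(x, k)\<in>p. h k)"
          unfolding additive_tagged_division_1[OF ab p, of f, symmetric]
          by (rule sum.cong) (auto simp: hk)
        then show ?thesis by (simp add: sum_subtractf split_def)
      qed
      also have "norm \<dots> \<le> (\<Sum>(x, k)\<in>p. norm (measure lborel k *\<^sub>R f'' x - h k))"
        by (rule order_trans[OF norm_sum]) (simp add: split_def)
      also have "\<dots> = (\<Sum>(x, k)\<in>p - pN. norm (measure lborel k *\<^sub>R f'' x - h k)) + (\<Sum>(x, k)\<in>pN. norm (measure lborel k *\<^sub>R f'' x - h k))"
        by (rule sum.subset_diff[OF pN finp])
      also have "(\<Sum>(x, k)\<in>p - pN. norm (measure lborel k *\<^sub>R f'' x - h k)) \<le> (\<Sum>(x, k)\<in>p - pN. e' * measure lborel k)"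
      proof (rule sum_mono, clarify)
        fix x k assume xk: "(x, k) \<in> p" "(x, k) \<notin> pN"
        then have xN: "x \<notin> N" by (auto simp: pN_def)
        obtain u v where uv: "u \<le> v" "k = {u..v}" "x \<in> {u..v}" "{u..v} \<subseteq> {a..b}" using iv[OF xk(1)] by blast
        have xab: "x \<in> {a..b} - N" using uv xN by blast
        have "\<gamma> x = ball x (d x)" using xN xab by (simp add: \<gamma>_def)
        then have "k \<subseteq> ball x (d x)" using fineD[OF fine xk(1)] by simp
        moreover have "u \<in> k" "v \<in> k" using uv(1,2) by auto
        ultimately have "u \<in> ball x (d x)" "v \<in> ball x (d x)" by blast+
        then have nuv: "norm (u - x) < d x" "norm (v - x) < d x" by (auto simp: dist_real_def abs_minus_commute)
        have hv: "h k = f v - f u" using hk[OF xk(1)] uv(1,2) by simp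
        have "measure lborel k *\<^sub>R f'' x - h k
          = (f u - f x - (u - x) *\<^sub>R f' x) - (f v - f x - (v - x) *\<^sub>R f' x)"
          using uv(1,2) xN hv by (simp add: f''_def algebra_simps)
        also have "norm \<dots> \<le> e' * norm (u - x) + e' * norm (v - x)"
        proof (rule order_trans[OF norm_triangle_ineq4 add_mono])
          show "norm (f u - f x - (u - x) *\<^sub>R f' x) \<le> e' * norm (u - x)"
            using uv by (intro d(2)[OF xab _ nuv(1)]) auto
          show "norm (f v - f x - (v - x) *\<^sub>R f' x) \<le> e' * norm (v - x)"
            using uv by (intro d(2)[OF xab _ nuv(2)]) auto
        qed
        also have "\<dots> = e' * measure lborel k" using uv by (simp add: algebra_simps)
        finally show "norm (measure lborel k *\<^sub>R f'' x - h k) \<le> e' * measure lborel k" .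
      qed
      also have "\<dots> \<le> (\<Sum>(x, k)\<in>p. e' * measure lborel k)"
        using finp e' by (intro sum_mono2) auto
      also have "\<dots> = e' * (b - a)"
      proof -
        have "(\<Sum>(x, k)\<in>p. measure lborel k) = b - a"
          using additive_content_tagged_division[of p a b] p ab by simp
        then show ?thesis by (simp add: sum_distrib_left[symmetric] split_def)
      qed
      also have "\<dots> \<le> e / 2"
      proof -
        have "e' * (b - a) \<le> e' * (b - a + 1)" using e' by simp
        also have "\<dots> = e / 2" using ab by (simp add: e'_def field_simps)
        finally show ?thesis .
      qed
      also have "(\<Sum>(x, k)\<in>pN. norm (measure lborel k *\<^sub>R f'' x - h k)) = (\<Sum>(x, k)\<in>pN. norm (h k))"
        by (rule sum.cong) (auto simp: pN_def f''_def)
      also have "\<dots> = (\<Sum>k\<in>snd ` pN. norm (h k))"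
      proof (rule sum.over_tagged_division_lemma[OF tagged_partial_division_of_Union_self])
        show "pN tagged_partial_division_of {a..b}"
          using p pN by (metis tagged_division_of_def tagged_partial_division_subset)
        fix u v :: real assume "box u v = {}"
        then show "norm (h (cbox u v)) = 0"
          by (cases "u = v") (auto simp: h_def not_le)
      qed
      also have "\<dots> = (\<Sum>k\<in>snd ` pN. norm (f (Sup k) - f (Inf k)))"
        using hk pN by (intro sum.cong) auto
      also have "\<dots> < e / 2"
      proof (rule ac, intro conjI)
        have tp: "pN tagged_partial_division_of {a..b}"
          using p pN by (metis tagged_division_of_def tagged_partial_division_subset)
        show div: "snd ` pN division_of \<Union> (snd ` pN)"
          by (rule partial_division_of_tagged_division[OF tp])
        show "\<Union> (snd ` pN) \<subseteq> {a..b}" using pN pD(3) by fastforce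
        have "\<Union> (snd ` pN) \<subseteq> T"
        proof (intro Union_least)
          fix k assume "k \<in> snd ` pN"
          then obtain x where x: "(x, k) \<in> p" "x \<in> N" by (auto simp: pN_def)
          then show "k \<subseteq> T" using fineD[OF fine x(1)] by (simp add: \<gamma>_def)
        qed
        from division_length_le_measure[OF div this T(3)] T(4)
        show "(\<Sum>k\<in>snd ` pN. Sup k - Inf k) < \<delta>" by simp
      qed
      finally show ?thesis by simp
    qed
    show "\<exists>\<gamma>. gauge \<gamma> \<and> (\<forall>\<D>. \<D> tagged_division_of {a..b} \<and> \<gamma> fine \<D> \<longrightarrow>
        norm ((\<Sum>(x, k)\<in>\<D>. measure lborel k *\<^sub>R f'' x) - (f b - f a)) < e)"
      by (intro exI[of _ \<gamma>] conjI allI impI gauge) (elim conjE, rule main)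
  qed
qed

section \<open>Null sets and Lebesgue measurability\<close>

lemma AE_lebesgue_on_iff_negligible:
  fixes S :: "'a::euclidean_space set"
  assumes "S \<in> sets lebesgue"
  shows "(AE x in lebesgue_on S. P x) \<longleftrightarrow> negligible {x \<in> S. \<not> P x}"
  using assms
  by (simp add: AE_restrict_space_iff completion.AE_iff_null_sets negligible_iff_null_sets)

lemma measurable_lebesgue_on_AE_cong:
  fixes f g :: "'a::euclidean_space \<Rightarrow> 'b::euclidean_space"
  assumes "S \<in> sets lebesgue" "f \<in> borel_measurable (lebesgue_on S)"
    and "AE x in lebesgue_on S. g x = f x"
  shows "g \<in> borel_measurable (lebesgue_on S)"
proof -
  define N where "N = {x \<in> S. g x \<noteq> f x}"
  have N: "negligible N"
    using assms(3) by (simp add: AE_lebesgue_on_iff_negligible[OF assms(1)] N_def)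
  have "f measurable_on S"
    using assms(1,2) measurable_on_iff_borel_measurable by blast
  then have "g measurable_on S"
    by (rule measurable_on_spike[OF _ N]) (auto simp: N_def)
  then show ?thesis using assms(1) measurable_on_iff_borel_measurable by blast
qed

section \<open>Derivatives on the half-line\<close>

text \<open>
  Derivatives relative to the half-line are unique also at its endpoint.
\<close>

lemma at_within_Ici_neq_bot: "x \<ge> l \<Longrightarrow> at x within {l..} \<noteq> (bot :: real filter)"
proof
  assume x: "x \<ge> l" and "at x within {l..} = bot"
  then have "at_right x = bot"
    by (metis at_le atLeast_subset_iff bot.extremum_uniqueI greaterThan_subset_iff Ioi_le_Ico order_trans)
  then show False by simp
qed

lemma dv_eqI:
  assumes "x \<ge> l" "(f has_vector_derivative D) (at x within {l..})"
  shows "dv l f x = D"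
  unfolding dv_def by (rule vector_derivative_within[OF at_within_Ici_neq_bot[OF assms(1)] assms(2)])

lemma dv_cong:
  assumes "x \<ge> l" "\<And>x. x \<ge> l \<Longrightarrow> f x = g x"
  shows "dv l f x = dv l g x"
proof -
  have "(f has_vector_derivative D) (at x within {l..}) = (g has_vector_derivative D) (at x within {l..})" for D
    using has_vector_derivative_transform[of x "{l..}" f g] has_vector_derivative_transform[of x "{l..}" g f] assms
    by auto
  then show ?thesis unfolding dv_def vector_derivative_def by simp
qed

lemma locally_AC_cong:
  assumes "locally_AC l f" "\<And>x. x \<ge> l \<Longrightarrow> f x = g x"
  shows "locally_AC l g"
  unfolding locally_AC_def
proof
  fix b
  have "absolutely_continuous_on {l..b} f" using assms(1) by (simp add: locally_AC_def)
  from AC_dominated[OF this this, of g 1] assms(2) show "absolutely_continuous_on {l..b} g"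
    by simp
qed

lemma locally_AC_derivative:
  assumes "locally_AC l f"
  shows "AE x in lebesgue_on {l..}. (f has_vector_derivative dv l f x) (at x within {l..})"
proof -
  define E where "E = (\<lambda>n::nat. {x \<in> {l<..<l + real n}. \<not> f differentiable (at x)})"
  have "negligible (\<Union>(range E))"
  proof (intro negligible_countable_Union)
    fix X assume "X \<in> range E"
    then obtain n where n: "X = E n" by blast
    have "absolutely_continuous_on {l..l + real n} f" using assms by (simp add: locally_AC_def)
    from AC_differentiable_ae[OF this] show "negligible X" by (simp add: n E_def)
  qed simp
  then have "negligible ({l} \<union> \<Union>(range E))" by simp
  moreover have "{x \<in> {l..}. \<not> (f has_vector_derivative dv l f x) (at x within {l..})} \<subseteq> {l} \<union> \<Union>(range E)"
  proof
    fix x assume x: "x \<in> {x \<in> {l..}. \<not> (f has_vector_derivative dv l f x) (at x within {l..})}"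
    show "x \<in> {l} \<union> \<Union>(range E)"
    proof (rule ccontr)
      assume n: "x \<notin> {l} \<union> \<Union>(range E)"
      obtain n where "x - l < real n" using reals_Archimedean2 by blast
      then have "x \<in> {l<..<l + real n}" using x n by auto
      then have "f differentiable (at x)" using n by (auto simp: E_def)
      then have "f differentiable (at x within {l..})" by (rule differentiable_at_withinI)
      then have "(f has_vector_derivative dv l f x) (at x within {l..})"
        unfolding dv_def by (simp add: vector_derivative_works[symmetric])
      with x show False by simp
    qed
  qed
  ultimately have "negligible {x \<in> {l..}. \<not> (f has_vector_derivative dv l f x) (at x within {l..})}"
    by (rule negligible_subset)
  then show ?thesis by (simp add: AE_lebesgue_on_iff_negligible)
qed

lemma AC2_has_dv:
  assumes "AC2 l y" "x \<ge> l"
  shows "(y has_vector_derivative dv l y x) (at x within {l..})"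
  using assms unfolding AC2_def dv_def by (simp add: vector_derivative_works[symmetric])

lemma AC2_has_dv_dv:
  assumes "AC2 l y"
  shows "AE x in lebesgue_on {l..}. (dv l y has_vector_derivative dv l (dv l y) x) (at x within {l..})"
  using assms locally_AC_derivative unfolding AC2_def by blast

lemma AC2_continuous_on:
  assumes "AC2 l y"
  shows "continuous_on {l..} y" "continuous_on {l..} (dv l y)"
proof -
  show "continuous_on {l..} y"
    using assms unfolding AC2_def
    by (meson atLeast_iff continuous_on_eq_continuous_within differentiable_imp_continuous_within)
  have c: "continuous_on {l..b} (dv l y)" for b
    using assms AC_imp_continuous_on unfolding AC2_def locally_AC_def by blast
  show "continuous_on {l..} (dv l y)"
    unfolding continuous_on_eq_continuous_within
  proof
    fix x assume "x \<in> {l..}"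
    then have "continuous (at x within {l..x + 1}) (dv l y)"
      using c[of "x + 1"] by (simp add: continuous_on_eq_continuous_within)
    moreover have "at x within {l..x + 1} = at x within {l..}"
      by (rule at_within_nhd[of x "{x - 1<..<x + 1}"]) auto
    ultimately show "continuous (at x within {l..}) (dv l y)" by simp
  qed
qed

lemma AE_ge_lebesgue_on: "AE x in lebesgue_on {l..}. (l::real) \<le> x"
  by (simp add: AE_lebesgue_on_iff_negligible)

text \<open>
  The expression \<open>SL l q y\<close> differentiates the function \<open>dv l y\<close>, of which a formula is usually
  known only on the half-line. Differentiating that formula instead gives the same result.
\<close>

lemma AC2_explicit:
  assumes y: "\<forall>x\<ge>l. (y has_vector_derivative y1 x) (at x within {l..})"
    and ac: "locally_AC l y" "locally_AC l y1"
    and y2: "AE x in lebesgue_on {l..}. (y1 has_vector_derivative y2 x) (at x within {l..})"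
  shows "AC2 l y" "\<And>x. x \<ge> l \<Longrightarrow> dv l y x = y1 x"
    "AE x in lebesgue_on {l..}. SL l q y x = - y2 x + of_real (q x) * y x"
proof -
  show d: "dv l y x = y1 x" if "x \<ge> l" for x using dv_eqI[OF that] y that by blast
  show "AC2 l y" unfolding AC2_def
  proof (intro conjI allI impI ac(1))
    show "y differentiable at x within {l..}" if "l \<le> x" for x
      using y that differentiableI_vector by blast
    show "locally_AC l (dv l y)" by (rule locally_AC_cong[OF ac(2)]) (simp add: d)
  qed
  show "AE x in lebesgue_on {l..}. SL l q y x = - y2 x + of_real (q x) * y x"
    using y2 AE_ge_lebesgue_on
  proof eventually_elim
    case (elim x)
    then have "dv l (dv l y) x = dv l y1 x" by (intro dv_cong d)
    also have "\<dots> = y2 x" using elim by (intro dv_eqI)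
    finally show ?case by (simp add: SL_def)
  qed
qed

lemma AC2_combine:
  assumes f: "AC2 l f" and g: "AC2 l g"
  shows "AC2 l (\<lambda>x. f x + c * g x)"
    "\<And>x. x \<ge> l \<Longrightarrow> dv l (\<lambda>x. f x + c * g x) x = dv l f x + c * dv l g x"
    "AE x in lebesgue_on {l..}. SL l q (\<lambda>x. f x + c * g x) x = SL l q f x + c * SL l q g x"
proof -
  let ?y = "\<lambda>x. f x + c * g x" and ?y1 = "\<lambda>x. dv l f x + c * dv l g x"
    and ?y2 = "\<lambda>x. dv l (dv l f) x + c * dv l (dv l g) x"
  have 1: "\<forall>x\<ge>l. (?y has_vector_derivative ?y1 x) (at x within {l..})"
    using AC2_has_dv[OF f] AC2_has_dv[OF g]
    by (intro allI impI has_vector_derivative_add has_vector_derivative_mult_right) auto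
  have 2: "locally_AC l ?y" "locally_AC l ?y1"
    using f g unfolding AC2_def locally_AC_def by (auto intro!: AC_add AC_mult AC_const)
  have 3: "AE x in lebesgue_on {l..}. (?y1 has_vector_derivative ?y2 x) (at x within {l..})"
    using AC2_has_dv_dv[OF f] AC2_has_dv_dv[OF g]
  proof eventually_elim
    case (elim x)
    then show ?case by (intro has_vector_derivative_add has_vector_derivative_mult_right)
  qed
  note R = AC2_explicit[OF 1 2 3]
  show "AC2 l ?y" by (rule R(1))
  show "dv l ?y x = ?y1 x" if "x \<ge> l" for x by (rule R(2)[OF that])
  show "AE x in lebesgue_on {l..}. SL l q ?y x = SL l q f x + c * SL l q g x"
    using R(3)[of q] by eventually_elim (simp add: SL_def algebra_simps)
qed

lemma AC_of_C1:
  fixes \<eta> \<eta>1 :: "real \<Rightarrow> real"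
  assumes "\<And>x. (\<eta> has_real_derivative \<eta>1 x) (at x)" "continuous_on UNIV \<eta>1"
  shows "absolutely_continuous_on {a..b} (\<lambda>x. of_real (\<eta> x))"
proof -
  have "bounded (\<eta>1 ` {a..b})"
    using assms(2) by (intro compact_imp_bounded compact_continuous_image) (auto intro: continuous_on_subset)
  then obtain B where B: "\<And>x. x \<in> {a..b} \<Longrightarrow> norm (\<eta>1 x) \<le> B" unfolding bounded_iff by blast
  show ?thesis
  proof (rule AC_Lipschitz[where C = B])
    fix u v assume uv: "u \<in> {a..b}" "v \<in> {a..b}"
    have "norm (\<eta> v - \<eta> u) \<le> B * norm (v - u)"
      by (rule field_differentiable_bound[of "{a..b}" \<eta> \<eta>1])
         (use uv B assms(1) in \<open>auto intro: has_field_derivative_at_within\<close>)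
    then show "norm (complex_of_real (\<eta> v) - of_real (\<eta> u)) \<le> B * \<bar>v - u\<bar>"
      by (simp flip: of_real_diff)
  qed
qed

text \<open>
  For \<open>y = \<phi> \<eta>\<close> the potential enters only through \<open>SL l q \<phi>\<close>. If \<open>\<phi>\<close> solves the homogeneous equation,
  \<open>SL l q y\<close> agrees almost everywhere with a continuous function although \<open>q\<close> is merely locally summable. This is how
  elements of the maximal domain with prescribed initial values are found; smooth functions
  with compact support need not belong to it.
\<close>

lemma AC2_mult_C2:
  fixes \<eta> \<eta>1 \<eta>2 :: "real \<Rightarrow> real"
  assumes \<phi>: "AC2 l \<phi>"
    and \<eta>: "\<And>x. (\<eta> has_real_derivative \<eta>1 x) (at x)" "\<And>x. (\<eta>1 has_real_derivative \<eta>2 x) (at x)"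
      "continuous_on UNIV \<eta>2"
  defines "y \<equiv> \<lambda>x. \<phi> x * of_real (\<eta> x)"
  shows "AC2 l y" "\<And>x. x \<ge> l \<Longrightarrow> dv l y x = dv l \<phi> x * of_real (\<eta> x) + \<phi> x * of_real (\<eta>1 x)"
    "AE x in lebesgue_on {l..}. SL l q y x =
        SL l q \<phi> x * of_real (\<eta> x) - 2 * dv l \<phi> x * of_real (\<eta>1 x) - \<phi> x * of_real (\<eta>2 x)"
proof -
  let ?y1 = "\<lambda>x. dv l \<phi> x * of_real (\<eta> x) + \<phi> x * of_real (\<eta>1 x)"
  let ?y2 = "\<lambda>x. dv l (dv l \<phi>) x * of_real (\<eta> x) + 2 * dv l \<phi> x * of_real (\<eta>1 x) + \<phi> x * of_real (\<eta>2 x)"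
  have c1: "continuous_on UNIV \<eta>1" using \<eta>(2) DERIV_continuous_on by blast
  have v: "((\<lambda>x. complex_of_real (\<eta> x)) has_vector_derivative of_real (\<eta>1 x)) (at x within {l..})"
    "((\<lambda>x. complex_of_real (\<eta>1 x)) has_vector_derivative of_real (\<eta>2 x)) (at x within {l..})" for x
    by (rule has_vector_derivative_of_real, rule has_field_derivative_at_within, rule \<eta>)+
  have 1: "\<forall>x\<ge>l. (y has_vector_derivative ?y1 x) (at x within {l..})"
    using has_vector_derivative_mult[OF AC2_has_dv[OF \<phi>] v(1)] unfolding y_def
    by (simp add: add.commute)
  have 2: "locally_AC l y" "locally_AC l ?y1"
    using \<phi> AC_of_C1[OF \<eta>(1) c1] AC_of_C1[OF \<eta>(2,3)] unfolding AC2_def locally_AC_def y_def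
    by (auto intro!: AC_add AC_mult)
  have 3: "AE x in lebesgue_on {l..}. (?y1 has_vector_derivative ?y2 x) (at x within {l..})"
    using AC2_has_dv_dv[OF \<phi>] AE_ge_lebesgue_on
  proof eventually_elim
    case (elim x)
    have "(?y1 has_vector_derivative
      (dv l \<phi> x * of_real (\<eta>1 x) + dv l (dv l \<phi>) x * of_real (\<eta> x)) +
      (\<phi> x * of_real (\<eta>2 x) + dv l \<phi> x * of_real (\<eta>1 x))) (at x within {l..})"
      by (intro has_vector_derivative_add has_vector_derivative_mult v elim(1) AC2_has_dv[OF \<phi> elim(2)])
    then show ?case by (simp add: algebra_simps)
  qed
  note R = AC2_explicit[OF 1 2 3]
  show "AC2 l y" by (rule R(1))
  show "dv l y x = ?y1 x" if "x \<ge> l" for x by (rule R(2)[OF that])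
  show "AE x in lebesgue_on {l..}. SL l q y x =
        SL l q \<phi> x * of_real (\<eta> x) - 2 * dv l \<phi> x * of_real (\<eta>1 x) - \<phi> x * of_real (\<eta>2 x)"
    using R(3)[of q] by eventually_elim (simp add: SL_def y_def algebra_simps)
qed

section \<open>Square integrable functions\<close>

lemma L2_D:
  assumes "f \<in> L2 l"
  shows "f \<in> borel_measurable (lebesgue_on {l..})" "integrable (lebesgue_on {l..}) (\<lambda>x. (cmod (f x))\<^sup>2)"
  using assms by (auto simp: L2_def)

lemma L2_prod_integrable:
  assumes f: "f \<in> L2 l" and g: "g \<in> L2 l"
  shows "integrable (lebesgue_on {l..}) (\<lambda>x. f x * cnj (g x))"
proof (rule Bochner_Integration.integrable_bound)
  show "integrable (lebesgue_on {l..}) (\<lambda>x. (cmod (f x))\<^sup>2 + (cmod (g x))\<^sup>2)"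
    using L2_D[OF f] L2_D[OF g] by simp
  have "cnj \<in> borel_measurable borel" by (intro borel_measurable_continuous_onI continuous_intros)
  then have "(\<lambda>x. cnj (g x)) \<in> borel_measurable (lebesgue_on {l..})"
    using L2_D(1)[OF g] by (rule measurable_compose_rev)
  then show "(\<lambda>x. f x * cnj (g x)) \<in> borel_measurable (lebesgue_on {l..})"
    using L2_D(1)[OF f] by simp
  have "cmod (f x * cnj (g x)) \<le> (cmod (f x))\<^sup>2 + (cmod (g x))\<^sup>2" for x
  proof -
    have "0 \<le> cmod (f x) * cmod (g x)" by simp
    then show ?thesis
      using sum_squares_bound[of "cmod (f x)" "cmod (g x)"] unfolding norm_mult complex_mod_cnj by linarith
  qed
  then show "AE x in lebesgue_on {l..}. norm (f x * cnj (g x)) \<le> norm ((cmod (f x))\<^sup>2 + (cmod (g x))\<^sup>2)"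
    by (intro always_eventually allI) (metis abs_of_nonneg add_nonneg_nonneg real_norm_def zero_le_power2)
qed

lemma L2_combine:
  assumes f: "f \<in> L2 l" and g: "g \<in> L2 l"
  shows "(\<lambda>x. f x + c * g x) \<in> L2 l"
  unfolding L2_def
proof (intro CollectI conjI)
  show m: "(\<lambda>x. f x + c * g x) \<in> borel_measurable (lebesgue_on {l..})"
    using L2_D(1)[OF f] L2_D(1)[OF g] by simp
  show "integrable (lebesgue_on {l..}) (\<lambda>x. (cmod (f x + c * g x))\<^sup>2)"
  proof (rule Bochner_Integration.integrable_bound)
    show "integrable (lebesgue_on {l..}) (\<lambda>x. 2 * (cmod (f x))\<^sup>2 + 2 * (cmod c)\<^sup>2 * (cmod (g x))\<^sup>2)"
      using L2_D[OF f] L2_D[OF g] by simp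
    show "(\<lambda>x. (cmod (f x + c * g x))\<^sup>2) \<in> borel_measurable (lebesgue_on {l..})"
      using m by simp
    have "(cmod (f x + c * g x))\<^sup>2 \<le> 2 * (cmod (f x))\<^sup>2 + 2 * (cmod c)\<^sup>2 * (cmod (g x))\<^sup>2" for x
    proof -
      have "(cmod (f x + c * g x))\<^sup>2 \<le> (cmod (f x) + cmod c * cmod (g x))\<^sup>2"
        by (intro power_mono) (auto intro: order_trans[OF norm_triangle_ineq] simp: norm_mult)
      also have "\<dots> \<le> 2 * (cmod (f x))\<^sup>2 + 2 * (cmod c * cmod (g x))\<^sup>2"
        using sum_squares_bound[of "cmod (f x)" "cmod c * cmod (g x)"] by (simp add: power2_sum)
      finally show ?thesis by (simp add: power_mult_distrib)
    qed
    then show "AE x in lebesgue_on {l..}. norm ((cmod (f x + c * g x))\<^sup>2) \<le> norm (2 * (cmod (f x))\<^sup>2 + 2 * (cmod c)\<^sup>2 * (cmod (g x))\<^sup>2)"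
      by (intro always_eventually allI) (simp add: abs_of_nonneg)
  qed
qed

lemma L2_AE_cong:
  assumes f: "f \<in> L2 l" and eq: "AE x in lebesgue_on {l..}. g x = f x"
  shows "g \<in> L2 l"
  unfolding L2_def
proof (intro CollectI conjI)
  show m: "g \<in> borel_measurable (lebesgue_on {l..})"
    using measurable_lebesgue_on_AE_cong[OF _ L2_D(1)[OF f] eq] by simp
  show "integrable (lebesgue_on {l..}) (\<lambda>x. (cmod (g x))\<^sup>2)"
  proof (rule Bochner_Integration.integrable_cong_AE_imp[OF L2_D(2)[OF f]])
    show "(\<lambda>x. (cmod (g x))\<^sup>2) \<in> borel_measurable (lebesgue_on {l..})" using m by simp
    show "AE x in lebesgue_on {l..}. (cmod (f x))\<^sup>2 = (cmod (g x))\<^sup>2"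
      using eq by eventually_elim simp
  qed
qed

lemma integrable_indicator_Icc:
  "integrable (lebesgue_on {l..}) (indicator {l..b} :: real \<Rightarrow> real)"
proof (rule integrable_real_indicator)
  show "{l..b} \<in> sets (lebesgue_on {l..})"
    by (auto simp: sets_restrict_space_iff)
  have "emeasure (lebesgue_on {l..}) {l..b} = emeasure lebesgue {l..b}"
    by (rule emeasure_restrict_space) auto
  then show "emeasure (lebesgue_on {l..}) {l..b} < \<infinity>"
    by (simp add: emeasure_lborel_Icc_eq)
qed

lemma L2_bounded_support:
  assumes m: "f \<in> borel_measurable (lebesgue_on {l..})"
    and b: "\<And>x. x \<in> {l..b} \<Longrightarrow> cmod (f x) \<le> C" "\<And>x. x > b \<Longrightarrow> f x = 0"
  shows "f \<in> L2 l"
  unfolding L2_def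
proof (intro CollectI conjI m)
  show "integrable (lebesgue_on {l..}) (\<lambda>x. (cmod (f x))\<^sup>2)"
  proof (rule Bochner_Integration.integrable_bound)
    show "integrable (lebesgue_on {l..}) (\<lambda>x. C\<^sup>2 * indicator {l..b} x)"
      using integrable_indicator_Icc[of l b] by simp
    show "(\<lambda>x. (cmod (f x))\<^sup>2) \<in> borel_measurable (lebesgue_on {l..})" using m by simp
    show "AE x in lebesgue_on {l..}. norm ((cmod (f x))\<^sup>2) \<le> norm (C\<^sup>2 * indicator {l..b} x :: real)"
      using AE_ge_lebesgue_on
    proof eventually_elim
      case (elim x)
      show ?case
      proof (cases "x \<le> b")
        case True
        then have "cmod (f x) \<le> C" using b(1) elim by simp
        then show ?thesis using True elim by (simp add: power_mono)
      qed (use b(2) in simp)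
    qed
  qed
qed

lemma ip_cong:
  assumes "AE x in lebesgue_on {l..}. f x = f' x" "AE x in lebesgue_on {l..}. g x = g' x"
    "f \<in> L2 l" "f' \<in> L2 l" "g \<in> L2 l" "g' \<in> L2 l"
  shows "ip l f g = ip l f' g'"
  unfolding ip_def
proof (rule integral_cong_AE)
  show "AE x in lebesgue_on {l..}. f x * cnj (g x) = f' x * cnj (g' x)"
    using assms(1,2) by eventually_elim simp
qed (rule borel_measurable_integrable[OF L2_prod_integrable], (rule assms)+)+

lemma ip_combine_left:
  assumes "f \<in> L2 l" "g \<in> L2 l" "v \<in> L2 l"
  shows "ip l (\<lambda>x. f x + c * g x) v = ip l f v + c * ip l g v"
proof -
  have "ip l (\<lambda>x. f x + c * g x) v = (LINT x|lebesgue_on {l..}. f x * cnj (v x) + c * (g x * cnj (v x)))"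
    unfolding ip_def by (rule Bochner_Integration.integral_cong) (auto simp: algebra_simps)
  also have "\<dots> = ip l f v + c * ip l g v"
    unfolding ip_def using L2_prod_integrable[OF assms(1,3)] L2_prod_integrable[OF assms(2,3)] by simp
  finally show ?thesis .
qed

lemma ip_cnj: "ip l g f = cnj (ip l f g)"
proof -
  have "cnj (ip l f g) = (LINT x|lebesgue_on {l..}. cnj (f x * cnj (g x)))"
    unfolding ip_def by (simp only: Bochner_Integration.integral_cnj)
  then show ?thesis by (simp add: ip_def mult.commute)
qed

lemma ip_combine_right:
  assumes "f \<in> L2 l" "g \<in> L2 l" "v \<in> L2 l"
  shows "ip l v (\<lambda>x. f x + c * g x) = ip l v f + cnj c * ip l v g"
  using ip_combine_left[OF assms, of c] ip_cnj[of l v] by simp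

lemma ip_self:
  "ip l f f = of_real (LINT x|lebesgue_on {l..}. (cmod (f x))\<^sup>2)"
  unfolding ip_def complex_norm_square[symmetric] by (rule integral_complex_of_real)

lemma ip_self_nonneg: "Re (ip l f f) \<ge> 0" "Im (ip l f f) = 0"
  unfolding ip_self by auto

section \<open>Cut-off functions\<close>

text \<open>
  Iterated, this makes cubes of positive parts twice continuously differentiable, so that they can
  serve as cut-off functions for a second order equation.
\<close>

lemma DERIV_max_0_power:
  "((\<lambda>x. max 0 x ^ (k + 2)) has_real_derivative real (k + 2) * max 0 x ^ (k + 1)) (at (x::real))"
proof -
  consider "x > 0" | "x < 0" | "x = 0" by linarith
  then show ?thesis
  proof cases
    case 1
    have "((\<lambda>x. x ^ (k + 2)) has_real_derivative real (k + 2) * x ^ (k + 1)) (at x)"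
      using DERIV_pow[of "k + 2" x] by simp
    then have "((\<lambda>x. max 0 x ^ (k + 2)) has_real_derivative real (k + 2) * x ^ (k + 1)) (at x)"
      by (rule has_field_derivative_transform_within_open[where S = "{0<..}"]) (use 1 in auto)
    then show ?thesis using 1 by simp
  next
    case 2
    have "((\<lambda>x. 0) has_real_derivative 0) (at x)" by simp
    then have "((\<lambda>x. max 0 x ^ (k + 2)) has_real_derivative 0) (at x)"
      by (rule has_field_derivative_transform_within_open[where S = "{..<0}"]) (use 2 in auto)
    then show ?thesis using 2 by simp
  next
    case 3
    have "((\<lambda>y::real. max 0 y ^ (k + 2) / y) \<longlongrightarrow> 0) (at 0)"
    proof (rule Lim_null_comparison)
      have "norm (max 0 y ^ (k + 2) / y) \<le> \<bar>y\<bar> ^ (k + 1)" for y :: real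
      proof (cases "y \<le> 0")
        case True
        then have "norm (max 0 y ^ (k + 2) / y) = 0" by simp
        then show ?thesis by (simp only: zero_le_power_abs)
      qed simp
      then show "\<forall>\<^sub>F y in at 0. norm (max 0 y ^ (k + 2) / y) \<le> \<bar>y :: real\<bar> ^ (k + 1)"
        by (intro always_eventually allI)
      have "((\<lambda>y::real. \<bar>y\<bar> ^ (k + 1)) \<longlongrightarrow> \<bar>0\<bar> ^ (k + 1)) (at 0)"
        by (intro tendsto_intros)
      then show "((\<lambda>y::real. \<bar>y\<bar> ^ (k + 1)) \<longlongrightarrow> 0) (at 0)" by simp
    qed
    then show ?thesis using 3 by (simp add: has_field_derivative_iff)
  qed
qed

text \<open>
  The bump \<open>max 0 (1 - t\<^sup>2)\<^sup>3\<close> with \<open>t = n (x - l)\<close>. It is even in \<open>t\<close>, hence flat at \<open>l\<close>, and the powers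
  of \<open>n\<close> in the bounds are those of a bump of width \<open>1 / n\<close>.
\<close>

lemma cutoff_exists:
  fixes l n :: real
  assumes n: "n > 0"
  shows "\<exists>\<eta> \<eta>1 \<eta>2. (\<forall>x. (\<eta> has_real_derivative \<eta>1 x) (at x)) \<and> (\<forall>x. (\<eta>1 has_real_derivative \<eta>2 x) (at x)) \<and>
    continuous_on UNIV \<eta>2 \<and> \<eta> l = 1 \<and> \<eta>1 l = 0 \<and>
    (\<forall>x > l + 1 / n. \<eta> x = 0 \<and> \<eta>1 x = 0 \<and> \<eta>2 x = 0) \<and>
    (\<forall>x. \<bar>\<eta> x\<bar> \<le> 1 \<and> \<bar>\<eta>1 x\<bar> \<le> 6 * n \<and> \<bar>\<eta>2 x\<bar> \<le> 30 * n\<^sup>2)"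
proof -
  define t where "t = (\<lambda>x. n * (x - l))"
  define w where "w = (\<lambda>x. max 0 (1 - (t x)\<^sup>2))"
  define \<eta> where "\<eta> = (\<lambda>x. w x ^ 3)"
  define \<eta>1 where "\<eta>1 = (\<lambda>x. - 6 * n * (t x * w x ^ 2))"
  define \<eta>2 where "\<eta>2 = (\<lambda>x. 24 * n\<^sup>2 * ((t x)\<^sup>2 * w x) - 6 * n\<^sup>2 * w x ^ 2)"
  have inner: "((\<lambda>x. 1 - (t x)\<^sup>2) has_real_derivative - 2 * n * t x) (at x)" for x
    unfolding t_def by (auto intro!: derivative_eq_intros simp: algebra_simps power2_eq_square)
  have w3: "((\<lambda>x. w x ^ 3) has_real_derivative 3 * w x ^ 2 * (- 2 * n * t x)) (at x)" for x
    using DERIV_chain2[OF DERIV_max_0_power[of 1] inner] by (simp add: w_def numeral_3_eq_3 numeral_2_eq_2)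
  have w2: "((\<lambda>x. w x ^ 2) has_real_derivative 2 * w x * (- 2 * n * t x)) (at x)" for x
    using DERIV_chain2[OF DERIV_max_0_power[of 0] inner] by (simp add: w_def numeral_2_eq_2)
  have t: "(t has_real_derivative n) (at x)" for x
    unfolding t_def by (auto intro!: derivative_eq_intros)
  have d1: "(\<eta> has_real_derivative \<eta>1 x) (at x)" for x
    using w3[of x] by (simp add: \<eta>_def \<eta>1_def algebra_simps)
  have d2: "(\<eta>1 has_real_derivative \<eta>2 x) (at x)" for x
    unfolding \<eta>1_def \<eta>2_def
    by (rule DERIV_cong[OF DERIV_cmult[OF DERIV_mult[OF t w2]]]) (simp add: algebra_simps power2_eq_square)
  have c2: "continuous_on UNIV \<eta>2"
    unfolding \<eta>2_def w_def t_def by (intro continuous_intros)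
  have w01: "0 \<le> w x" "w x \<le> 1" for x by (auto simp: w_def)
  have tw: "\<bar>t x\<bar> \<le> 1 \<or> w x = 0" for x
    using abs_square_le_1[of "t x"] by (auto simp: w_def max_def)
  have supp: "w x = 0" if "x > l + 1 / n" for x
  proof -
    have "1 < t x" using that n by (simp add: t_def field_simps)
    then have "1 < (t x)\<^sup>2" by (simp add: power2_eq_square less_1_mult)
    then show ?thesis by (simp add: w_def)
  qed
  have bound: "\<bar>\<eta> x\<bar> \<le> 1 \<and> \<bar>\<eta>1 x\<bar> \<le> 6 * n \<and> \<bar>\<eta>2 x\<bar> \<le> 30 * n\<^sup>2" for x
  proof (cases "w x = 0")
    case True
    then show ?thesis using n by (simp add: \<eta>_def \<eta>1_def \<eta>2_def)
  next
    case False
    then have T: "\<bar>t x\<bar> \<le> 1" using tw by blast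
    have ww: "0 \<le> w x ^ 2" "w x ^ 2 \<le> 1" "0 \<le> w x ^ 3" "w x ^ 3 \<le> 1"
      using w01 by (auto intro: power_le_one)
    have tw2: "\<bar>t x * w x ^ 2\<bar> \<le> 1"
      unfolding abs_mult using T ww by (intro mult_le_one) auto
    have T2: "(t x)\<^sup>2 \<le> 1" using T abs_square_le_1 by blast
    have ttw: "0 \<le> (t x)\<^sup>2 * w x" "(t x)\<^sup>2 * w x \<le> 1" using T2 w01 by (auto intro: mult_le_one)
    have "\<bar>\<eta>1 x\<bar> = 6 * n * \<bar>t x * w x ^ 2\<bar>" using n by (simp add: \<eta>1_def abs_mult)
    also have "\<dots> \<le> 6 * n * 1" using tw2 n by (intro mult_left_mono) auto
    finally have b1: "\<bar>\<eta>1 x\<bar> \<le> 6 * n" by simp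
    have "\<bar>\<eta>2 x\<bar> \<le> \<bar>24 * n\<^sup>2 * ((t x)\<^sup>2 * w x)\<bar> + \<bar>6 * n\<^sup>2 * w x ^ 2\<bar>"
      unfolding \<eta>2_def by (rule abs_triangle_ineq4)
    also have "\<dots> = 24 * n\<^sup>2 * ((t x)\<^sup>2 * w x) + 6 * n\<^sup>2 * w x ^ 2" using ttw ww by simp
    also have "\<dots> \<le> 24 * n\<^sup>2 * 1 + 6 * n\<^sup>2 * 1"
      using ttw ww by (intro add_mono mult_left_mono) auto
    finally have b2: "\<bar>\<eta>2 x\<bar> \<le> 30 * n\<^sup>2" by simp
    show ?thesis using b1 b2 ww by (simp add: \<eta>_def)
  qed
  show ?thesis
    by (intro exI[of _ \<eta>] exI[of _ \<eta>1] exI[of _ \<eta>2] conjI allI impI d1 d2 c2)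
       (use bound supp in \<open>auto simp: \<eta>_def \<eta>1_def \<eta>2_def, auto simp: w_def t_def\<close>)
qed

section \<open>The maximal domain\<close>

lemma DstarD:
  assumes "y \<in> Dstar l q"
  shows "y \<in> L2 l" "AC2 l y" "SL l q y \<in> L2 l"
  using assms by (auto simp: Dstar_def)

lemma Dstar_combine:
  assumes f: "f \<in> Dstar l q" and g: "g \<in> Dstar l q"
  shows "(\<lambda>x. f x + c * g x) \<in> Dstar l q"
  unfolding Dstar_def
proof (intro CollectI conjI)
  note R = AC2_combine[OF DstarD(2)[OF f] DstarD(2)[OF g], where c = c]
  show "(\<lambda>x. f x + c * g x) \<in> L2 l" using f g by (intro L2_combine DstarD)
  show "AC2 l (\<lambda>x. f x + c * g x)" by (rule R(1))
  show "SL l q (\<lambda>x. f x + c * g x) \<in> L2 l"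
    by (rule L2_AE_cong[OF L2_combine R(3)]) (use f g DstarD in blast)+
qed

lemma dv_combine:
  assumes f: "f \<in> Dstar l q" and g: "g \<in> Dstar l q"
  shows "dv l (\<lambda>x. f x + c * g x) l = dv l f l + c * dv l g l"
  using AC2_combine(2)[OF DstarD(2)[OF f] DstarD(2)[OF g]] by simp

lemma ip_SL_combine_left:
  assumes f: "f \<in> Dstar l q" and g: "g \<in> Dstar l q" and v: "v \<in> L2 l"
  shows "ip l (SL l q (\<lambda>x. f x + c * g x)) v = ip l (SL l q f) v + c * ip l (SL l q g) v"
proof -
  note S = DstarD(3)[OF f] DstarD(3)[OF g]
  have "ip l (SL l q (\<lambda>x. f x + c * g x)) v = ip l (\<lambda>x. SL l q f x + c * SL l q g x) v"
    by (rule ip_cong[OF AC2_combine(3)])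
       (use f g v S in \<open>simp_all add: DstarD L2_combine DstarD(3)[OF Dstar_combine]\<close>)
  also have "\<dots> = ip l (SL l q f) v + c * ip l (SL l q g) v"
    by (rule ip_combine_left[OF S v])
  finally show ?thesis .
qed

lemma form_expand:
  assumes f: "f \<in> Dstar l q" and g: "g \<in> Dstar l q"
  shows "ip l (SL l q (\<lambda>x. f x + c * g x)) (\<lambda>x. f x + c * g x)
    = ip l (SL l q f) f + cnj c * ip l (SL l q f) g + c * ip l (SL l q g) f + c * cnj c * ip l (SL l q g) g"
  using f g by (simp add: ip_SL_combine_left ip_combine_right Dstar_combine DstarD algebra_simps)

text \<open>
  Both \<open>u\<close> and \<open>SL l q u\<close> agree almost everywhere with continuous functions of bounded support,
  hence are square integrable.
\<close>

lemma cutoff_solution_in_Dstar: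
  assumes sol: "is_solution l q 0 \<phi>"
    and \<eta>: "\<And>x. (\<eta> has_real_derivative \<eta>1 x) (at x)" "\<And>x. (\<eta>1 has_real_derivative \<eta>2 x) (at x)"
      "continuous_on UNIV \<eta>2" "\<And>x. x > b \<Longrightarrow> \<eta> x = 0 \<and> \<eta>1 x = 0 \<and> \<eta>2 x = 0"
  defines "u \<equiv> \<lambda>x. \<phi> x * of_real (\<eta> x)"
  shows "u \<in> Dstar l q" "dv l u l = dv l \<phi> l * of_real (\<eta> l) + \<phi> l * of_real (\<eta>1 l)"
    "AE x in lebesgue_on {l..}. SL l q u x = - 2 * dv l \<phi> x * of_real (\<eta>1 x) - \<phi> x * of_real (\<eta>2 x)"
proof -
  have \<phi>: "AC2 l \<phi>" and e: "AE x in lebesgue_on {l..}. SL l q \<phi> x = 0"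
    using sol by (auto simp: is_solution_def)
  note R = AC2_mult_C2[OF \<phi> \<eta>(1-3)]
  show "dv l u l = dv l \<phi> l * of_real (\<eta> l) + \<phi> l * of_real (\<eta>1 l)"
    using R(2)[of l] by (simp add: u_def)
  let ?F = "\<lambda>x. - 2 * dv l \<phi> x * of_real (\<eta>1 x) - \<phi> x * of_real (\<eta>2 x)"
  show SLu: "AE x in lebesgue_on {l..}. SL l q u x = ?F x"
    using R(3)[of q] e unfolding u_def by eventually_elim simp
  have L2c: "F \<in> L2 l" if c: "continuous_on {l..} F" and z: "\<And>x. x > b \<Longrightarrow> F x = 0" for F
  proof -
    have "bounded (F ` {l..b})"
      using c by (intro compact_imp_bounded compact_continuous_image) (auto intro: continuous_on_subset)
    then obtain C where C: "\<And>x. x \<in> {l..b} \<Longrightarrow> norm (F x) \<le> C" unfolding bounded_iff by blast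
    show ?thesis
      by (rule L2_bounded_support[OF continuous_imp_measurable_on_sets_lebesgue[OF c] C z]) auto
  qed
  have c1: "continuous_on {l..} \<eta>1" using \<eta>(2) DERIV_continuous_on has_field_derivative_at_within by blast
  have c2: "continuous_on {l..} \<eta>2" using \<eta>(3) continuous_on_subset by blast
  have "?F \<in> L2 l"
    by (rule L2c) (use \<eta>(4) c1 c2 AC2_continuous_on[OF \<phi>] in \<open>auto intro!: continuous_intros\<close>)
  then have "SL l q u \<in> L2 l" using SLu by (rule L2_AE_cong)
  moreover have "AC2 l u" using R(1) by (simp add: u_def)
  moreover have "u \<in> L2 l"
    by (rule L2c[OF AC2_continuous_on(1)[OF \<open>AC2 l u\<close>]]) (use \<eta>(4) in \<open>simp add: u_def\<close>)
  ultimately show "u \<in> Dstar l q" by (simp add: Dstar_def)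
qed

section \<open>Green's formula\<close>

lemma dv_zero_beyond:
  assumes "x \<ge> l" "x > b" "\<And>x. x > b \<Longrightarrow> u x = 0"
  shows "dv l u x = 0"
proof (rule dv_eqI[OF assms(1)])
  have "((\<lambda>_. 0) has_vector_derivative 0) (at x within {l..})" by simp
  then show "(u has_vector_derivative 0) (at x within {l..})"
    by (rule has_vector_derivative_transform_within[where d = "x - b"])
       (use assms in \<open>auto simp: dist_real_def\<close>)
qed

definition Green :: "real \<Rightarrow> (real \<Rightarrow> real) \<Rightarrow> cfun \<Rightarrow> cfun \<Rightarrow> bool" where
  "Green l q f g \<longleftrightarrow>
     ip l (SL l q f) g - ip l f (SL l q g) = dv l f l * cnj (g l) - f l * cnj (dv l g l)"

text \<open>
  The Wronskian-type expression \<open>W\<close> is absolutely continuous, its derivative is the difference of the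
  two integrands, and it vanishes to the right of the support of \<open>u\<close>. The formula is the
  fundamental theorem of calculus for \<open>W\<close>.
\<close>

lemma Green_compact_support:
  assumes f: "f \<in> Dstar l q" and u: "u \<in> Dstar l q" and supp: "\<And>x. x > b \<Longrightarrow> u x = 0"
  shows "Green l q f u"
proof -
  define c where "c = max l b + 1"
  have c: "c \<ge> l" "c > b" by (auto simp: c_def)
  note fD = DstarD[OF f] and uD = DstarD[OF u]
  define W where "W = (\<lambda>x. f x * cnj (dv l u x) + (- 1) * (dv l f x * cnj (u x)))"
  define F where "F = (\<lambda>x. SL l q f x * cnj (u x) - f x * cnj (SL l q u x))"
  have AC: "absolutely_continuous_on {l..c} W"
    using fD(2) uD(2) unfolding AC2_def locally_AC_def W_def
    by (intro AC_add AC_mult AC_const AC_cnj) auto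
  have "AE x in lebesgue_on {l..}. (W has_vector_derivative F x) (at x within {l..})"
    using AC2_has_dv_dv[OF fD(2)] AC2_has_dv_dv[OF uD(2)] AE_ge_lebesgue_on
  proof eventually_elim
    case (elim x)
    have "(W has_vector_derivative
        (f x * cnj (dv l (dv l u) x) + dv l f x * cnj (dv l u x)) +
        (- 1) * (dv l f x * cnj (dv l u x) + dv l (dv l f) x * cnj (u x))) (at x within {l..})"
      unfolding W_def
      by (intro has_vector_derivative_add has_vector_derivative_mult_right has_vector_derivative_mult
          has_vector_derivative_cnj elim(1,2) AC2_has_dv[OF fD(2) elim(3)] AC2_has_dv[OF uD(2) elim(3)])
    moreover have "(f x * cnj (dv l (dv l u) x) + dv l f x * cnj (dv l u x)) +
        (- 1) * (dv l f x * cnj (dv l u x) + dv l (dv l f) x * cnj (u x)) = F x"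
      by (simp add: F_def SL_def algebra_simps)
    ultimately show ?case by simp
  qed
  then have N: "negligible {x \<in> {l..}. \<not> (W has_vector_derivative F x) (at x within {l..})}"
    by (simp add: AE_lebesgue_on_iff_negligible)
  have "(F has_integral (W c - W l)) {l..c}"
  proof (rule AC_fundamental_theorem[OF c(1) AC N])
    fix x assume "x \<in> {l..c} - {x \<in> {l..}. \<not> (W has_vector_derivative F x) (at x within {l..})}"
    then have "(W has_vector_derivative F x) (at x within {l..})" by auto
    then show "(W has_vector_derivative F x) (at x within {l..c})"
      by (rule has_vector_derivative_within_subset) auto
  qed
  moreover have "W c = 0"
    using supp[OF c(2)] dv_zero_beyond[OF c supp] by (simp add: W_def)
  ultimately have "(F has_integral - W l) {l..c}" by simp
  then have "((\<lambda>x. if x \<in> {l..c} then F x else 0) has_integral - W l) {l..}"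
    by (subst has_integral_restrict) auto
  moreover have "(if x \<in> {l..c} then F x else 0) = F x" if "x \<in> {l..}" for x
  proof (cases "x \<le> c")
    case False
    then have x: "x > b" "x \<ge> l" using c by auto
    have "dv l (dv l u) x = 0"
      by (rule dv_zero_beyond[where b = "max l b"])
         (use x supp False c_def in \<open>auto intro: dv_zero_beyond\<close>)
    then show ?thesis using False supp[OF x(1)] by (simp add: F_def SL_def)
  qed (use that in auto)
  ultimately have hi: "(F has_integral - W l) {l..}"
    by (rule has_integral_eq[rotated]) blast
  have i1: "integrable (lebesgue_on {l..}) (\<lambda>x. SL l q f x * cnj (u x))"
    "integrable (lebesgue_on {l..}) (\<lambda>x. f x * cnj (SL l q u x))"
    by (intro L2_prod_integrable fD uD)+
  then have "integrable (lebesgue_on {l..}) F" unfolding F_def by simp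
  then have "integral\<^sup>L (lebesgue_on {l..}) F = - W l"
    using lebesgue_integral_eq_integral[of "{l..}" F] integral_unique[OF hi] by simp
  moreover have "integral\<^sup>L (lebesgue_on {l..}) F = ip l (SL l q f) u - ip l f (SL l q u)"
    using i1 unfolding F_def ip_def by simp
  ultimately show ?thesis by (simp add: Green_def W_def)
qed

lemma Green_commute: "Green l q f g \<longleftrightarrow> Green l q g f"
proof -
  have "(ip l (SL l q f) g - ip l f (SL l q g) = dv l f l * cnj (g l) - f l * cnj (dv l g l)) \<longleftrightarrow>
     (cnj (ip l (SL l q f) g - ip l f (SL l q g)) = cnj (dv l f l * cnj (g l) - f l * cnj (dv l g l)))"
    by (simp only: complex_cnj_cancel_iff)
  also have "\<dots> \<longleftrightarrow> ip l g (SL l q f) - ip l (SL l q g) f = cnj (dv l f l) * g l - cnj (f l) * dv l g l"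
    by (simp add: ip_cnj[symmetric])
  also have "\<dots> \<longleftrightarrow> Green l q g f"
    unfolding Green_def by (auto simp: algebra_simps)
  finally show ?thesis by (simp add: Green_def)
qed

lemma Green_combine:
  assumes "f \<in> Dstar l q" "u \<in> Dstar l q" "g \<in> Dstar l q" "Green l q u g"
  shows "Green l q (\<lambda>x. f x + c * u x) g \<longleftrightarrow> Green l q f g"
proof -
  have "ip l (SL l q (\<lambda>x. f x + c * u x)) g - ip l (\<lambda>x. f x + c * u x) (SL l q g)
     = (ip l (SL l q f) g - ip l f (SL l q g)) + c * (ip l (SL l q u) g - ip l u (SL l q g))"
    using assms by (simp add: ip_SL_combine_left ip_combine_left DstarD algebra_simps)
  moreover have "dv l (\<lambda>x. f x + c * u x) l * cnj (g l) - (f l + c * u l) * cnj (dv l g l)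
     = (dv l f l * cnj (g l) - f l * cnj (dv l g l)) + c * (dv l u l * cnj (g l) - u l * cnj (dv l g l))"
    using assms by (simp add: dv_combine algebra_simps)
  ultimately show ?thesis using assms(4) by (simp add: Green_def)
qed

text \<open>
  A nonnegative form is real on the diagonal, and polarization with \<open>c = 1\<close> and \<open>c = \<i>\<close> makes it
  Hermitian. For elements of \<open>Dom_min l q\<close> the boundary terms at \<open>l\<close> vanish, so this is Green's
  formula, and it says that nothing comes from infinity either.
\<close>

lemma Dom_min_symmetric:
  assumes nn: "nonnegative_op l (Dom_min l q) (SL l q)"
    and f: "f \<in> Dom_min l q" and g: "g \<in> Dom_min l q"
  shows "Green l q f g"
proof -
  have D: "f \<in> Dstar l q" "g \<in> Dstar l q" using f g by (auto simp: Dom_min_def)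
  let ?H = "\<lambda>f g. ip l (SL l q f) g"
  have real: "Im (?H v v) = 0" if "v \<in> Dom_min l q" for v
    using nn that unfolding nonnegative_op_def by (metis complex_nonneg_Reals_iff)
  have comb: "(\<lambda>x. f x + c * g x) \<in> Dom_min l q" for c
    using f g D by (auto simp: Dom_min_def Dstar_combine dv_combine)
  have "Im (?H f f + cnj c * ?H f g + c * ?H g f + c * cnj c * ?H g g) = 0" for c
    using real[OF comb[of c]] form_expand[OF D, of c] by simp
  from this[of 1] this[of \<i>] have "Im (?H f g) + Im (?H g f) = 0" "Re (?H g f) - Re (?H f g) = 0"
    using real[OF f] real[OF g] by auto
  then have "?H f g = cnj (?H g f)" by (auto simp: complex_eq_iff)
  then have "?H f g = ip l f (SL l q g)" by (simp add: ip_cnj[of l f])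
  then show ?thesis using f g by (simp add: Green_def Dom_min_def)
qed

text \<open>
  Subtracting compactly supported elements \<open>u1\<close> and \<open>u2\<close> with independent initial values moves any
  element of the maximal domain into \<open>Dom_min l q\<close>. The compactly supported terms satisfy Green's
  formula by partial integration and the remainders by the symmetry of the minimal operator.
\<close>

lemma Green_formula:
  assumes nn: "nonnegative_op l (Dom_min l q) (SL l q)"
    and fs: "fundamental_solutions l q \<phi>1 \<phi>2"
    and f: "f \<in> Dstar l q" and g: "g \<in> Dstar l q"
  shows "Green l q f g"
proof -
  obtain \<eta> \<eta>1 \<eta>2 where \<eta>: "\<And>x. (\<eta> has_real_derivative \<eta>1 x) (at x)" "\<And>x. (\<eta>1 has_real_derivative \<eta>2 x) (at x)"
    "continuous_on UNIV \<eta>2" "\<eta> l = 1" "\<eta>1 l = 0" "\<And>x. x > l + 1 \<Longrightarrow> \<eta> x = 0 \<and> \<eta>1 x = 0 \<and> \<eta>2 x = 0"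
    using cutoff_exists[of 1 l] by auto
  define u1 where "u1 = (\<lambda>x. \<phi>1 0 x * of_real (\<eta> x))"
  define u2 where "u2 = (\<lambda>x. \<phi>2 0 x * of_real (\<eta> x))"
  have sol: "is_solution l q 0 (\<phi>1 0)" "is_solution l q 0 (\<phi>2 0)"
    "\<phi>1 0 l = 0" "dv l (\<phi>1 0) l = 1" "\<phi>2 0 l = -1" "dv l (\<phi>2 0) l = 0"
    using fs by (auto simp: fundamental_solutions_def)
  note c1 = cutoff_solution_in_Dstar[OF sol(1) \<eta>(1-3,6), folded u1_def]
  note c2 = cutoff_solution_in_Dstar[OF sol(2) \<eta>(1-3,6), folded u2_def]
  have u: "u1 \<in> Dstar l q" "u2 \<in> Dstar l q" "u1 l = 0" "dv l u1 l = 1" "u2 l = -1" "dv l u2 l = 0"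
    using c1(1,2) c2(1,2) sol \<eta> by (auto simp: u1_def u2_def)
  have supp: "u1 x = 0" "u2 x = 0" if "x > l + 1" for x using \<eta>(6)[OF that] by (auto simp: u1_def u2_def)
  have G: "Green l q u1 g" "Green l q u2 g" if "g \<in> Dstar l q" for g
    using Green_compact_support[OF that u(1) supp(1)] Green_compact_support[OF that u(2) supp(2)]
    by (simp_all add: Green_commute[of l q g])
  define red where "red = (\<lambda>f. (\<lambda>x. (f x + (- dv l f l) * u1 x) + f l * u2 x))"
  have redD: "red f \<in> Dom_min l q" if "f \<in> Dstar l q" for f
  proof -
    have 1: "(\<lambda>x. f x + (- dv l f l) * u1 x) \<in> Dstar l q" by (rule Dstar_combine[OF that u(1)])
    have "dv l (\<lambda>x. (f x + (- dv l f l) * u1 x) + f l * u2 x) l = 0"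
      by (subst dv_combine[OF 1 u(2)], subst dv_combine[OF that u(1)]) (simp add: u)
    then show ?thesis unfolding red_def Dom_min_def using Dstar_combine[OF 1 u(2)] by (simp add: u)
  qed
  have red: "Green l q (red f) g \<longleftrightarrow> Green l q f g" if fg: "f \<in> Dstar l q" "g \<in> Dstar l q" for f g
  proof -
    have 1: "(\<lambda>x. f x + (- dv l f l) * u1 x) \<in> Dstar l q" by (rule Dstar_combine[OF fg(1) u(1)])
    show ?thesis unfolding red_def
      using Green_combine[OF 1 u(2) fg(2) G(2)[OF fg(2)], of "f l"]
        Green_combine[OF fg(1) u(1) fg(2) G(1)[OF fg(2)], of "- dv l f l"]
      by simp
  qed
  have "red g \<in> Dstar l q" using redD[OF g] by (simp add: Dom_min_def)
  then show ?thesis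
    using Dom_min_symmetric[OF nn redD[OF f] redD[OF g]] red[OF f] red[OF g f]
    by (metis Green_commute)
qed

section \<open>Weyl solutions\<close>

locale nonnegative_half_line =
  fixes l :: real and q :: "real \<Rightarrow> real" and \<phi>1 \<phi>2 :: "complex \<Rightarrow> cfun" and m_inf :: "complex \<Rightarrow> complex"
  assumes nonneg: "nonnegative_op l (Dom_min l q) (SL l q)"
    and fundamental: "fundamental_solutions l q \<phi>1 \<phi>2"
    and weyl: "weyl_function l \<phi>1 \<phi>2 m_inf"
begin

text \<open>
  The Weyl solution: the square integrable solution with initial values \<open>\<psi>(l) = -1\<close> and
  \<open>\<psi>'(l) = m_inf z\<close>. Through these values the Weyl function enters Green's formula.
\<close>

definition \<psi> :: "complex \<Rightarrow> cfun" where
  "\<psi> z = (\<lambda>x. \<phi>2 z x + m_inf z * \<phi>1 z x)"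

lemma green:
  assumes "f \<in> Dstar l q" "g \<in> Dstar l q"
  shows "ip l (SL l q f) g = ip l f (SL l q g) + dv l f l * cnj (g l) - f l * cnj (dv l g l)"
  using Green_formula[OF nonneg fundamental assms] unfolding Green_def by (simp add: algebra_simps)

lemma weyl_solution:
  assumes z: "z \<notin> \<real>\<^sub>\<ge>\<^sub>0"
  shows "\<psi> z \<in> Dstar l q" "\<psi> z l = -1" "dv l (\<psi> z) l = m_inf z"
    "AE x in lebesgue_on {l..}. SL l q (\<psi> z) x = z * \<psi> z x"
proof -
  have s: "is_solution l q z (\<phi>1 z)" "is_solution l q z (\<phi>2 z)"
    "\<phi>1 z l = 0" "dv l (\<phi>1 z) l = 1" "\<phi>2 z l = -1" "dv l (\<phi>2 z) l = 0"
    using fundamental by (auto simp: fundamental_solutions_def)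
  note R = AC2_combine[where l = l and f = "\<phi>2 z" and g = "\<phi>1 z" and c = "m_inf z", folded \<psi>_def]
  have ac: "AC2 l (\<phi>2 z)" "AC2 l (\<phi>1 z)" using s by (auto simp: is_solution_def)
  have e: "AE x in lebesgue_on {l..}. SL l q (\<phi>1 z) x = z * \<phi>1 z x"
    "AE x in lebesgue_on {l..}. SL l q (\<phi>2 z) x = z * \<phi>2 z x" using s by (auto simp: is_solution_def)
  show e': "AE x in lebesgue_on {l..}. SL l q (\<psi> z) x = z * \<psi> z x"
    using e R(3)[OF ac, of q] by eventually_elim (simp add: \<psi>_def algebra_simps)
  have L2: "\<psi> z \<in> L2 l" using weyl z by (simp add: weyl_function_def \<psi>_def)
  have "(\<lambda>x. 0 + z * \<psi> z x) \<in> L2 l"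
    by (rule L2_combine[OF _ L2]) (simp add: L2_def)
  then have "(\<lambda>x. z * \<psi> z x) \<in> L2 l" by simp
  then have "SL l q (\<psi> z) \<in> L2 l" using e' by (rule L2_AE_cong)
  then show "\<psi> z \<in> Dstar l q" using L2 R(1)[OF ac] by (simp add: Dstar_def)
  show "\<psi> z l = -1" using s by (simp add: \<psi>_def)
  show "dv l (\<psi> z) l = m_inf z" using R(2)[OF ac, of l] s by simp
qed

lemma ip_SL_weyl_solution:
  assumes z: "z \<notin> \<real>\<^sub>\<ge>\<^sub>0" and v: "v \<in> L2 l"
  shows "ip l (SL l q (\<psi> z)) v = z * ip l (\<psi> z) v"
    "ip l v (SL l q (\<psi> z)) = cnj z * ip l v (\<psi> z)"
proof -
  note D = DstarD[OF weyl_solution(1)[OF z]]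
  have z0: "(\<lambda>x. 0) \<in> L2 l" by (simp add: L2_def)
  have c: "(\<lambda>x. 0 + z * \<psi> z x) \<in> L2 l" by (rule L2_combine[OF z0 D(1)])
  have "ip l (SL l q (\<psi> z)) v = ip l (\<lambda>x. 0 + z * \<psi> z x) v"
    by (rule ip_cong) (use weyl_solution(4)[OF z] D c v in auto)
  also have "\<dots> = z * ip l (\<psi> z) v"
    using ip_combine_left[OF z0 D(1) v, of z] by (simp add: ip_def)
  finally show 1: "ip l (SL l q (\<psi> z)) v = z * ip l (\<psi> z) v" .
  have "ip l v (SL l q (\<psi> z)) = cnj (ip l (SL l q (\<psi> z)) v)" by (rule ip_cnj)
  also have "\<dots> = cnj z * ip l v (\<psi> z)" unfolding 1 by (simp add: ip_cnj[symmetric])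
  finally show "ip l v (SL l q (\<psi> z)) = cnj z * ip l v (\<psi> z)" .
qed

text \<open>
  Green's formula for \<open>\<psi> (cnj z)\<close> and \<open>\<psi> z\<close>: the two inner products cancel, and the boundary term
  that remains is the difference of both sides.
\<close>

lemma weyl_function_cnj:
  assumes z: "z \<notin> \<real>\<^sub>\<ge>\<^sub>0" "cnj z \<notin> \<real>\<^sub>\<ge>\<^sub>0"
  shows "m_inf (cnj z) = cnj (m_inf z)"
  using green[OF weyl_solution(1)[OF z(2)] weyl_solution(1)[OF z(1)]] z
  by (simp add: ip_SL_weyl_solution weyl_solution DstarD(1)[OF weyl_solution(1)])

lemma norm_weyl_solution_pos:
  assumes z: "z \<notin> \<real>\<^sub>\<ge>\<^sub>0"
  shows "0 < Re (ip l (\<psi> z) (\<psi> z))"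
proof (rule ccontr)
  note D = DstarD[OF weyl_solution(1)[OF z]]
  assume "\<not> 0 < Re (ip l (\<psi> z) (\<psi> z))"
  then have "(LINT x|lebesgue_on {l..}. (cmod (\<psi> z x))\<^sup>2) = 0"
    using ip_self_nonneg(1)[of l "\<psi> z"] unfolding ip_self Re_complex_of_real by linarith
  then have "AE x in lebesgue_on {l..}. (cmod (\<psi> z x))\<^sup>2 = 0"
    using integral_nonneg_eq_0_iff_AE[OF L2_D(2)[OF D(1)]] by simp
  then have N: "negligible {x \<in> {l..}. \<psi> z x \<noteq> 0}"
    by (simp add: AE_lebesgue_on_iff_negligible)
  have "continuous (at l within {l..}) (\<psi> z)"
    using AC2_continuous_on(1)[OF D(2)] by (simp add: continuous_on_eq_continuous_within)
  then have "\<exists>d>0. \<forall>x\<in>{l..}. dist x l < d \<longrightarrow> dist (\<psi> z x) (\<psi> z l) < 1"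
    unfolding continuous_within_eps_delta by (metis zero_less_one)
  then obtain d where d: "d > 0" "\<And>x. x \<in> {l..} \<Longrightarrow> dist x l < d \<Longrightarrow> dist (\<psi> z x) (\<psi> z l) < 1" by blast
  have "{l..l + d / 2} \<subseteq> {x \<in> {l..}. \<psi> z x \<noteq> 0}"
  proof
    fix x assume x: "x \<in> {l..l + d / 2}"
    then have "dist (\<psi> z x) (-1) < 1" using d(1) d(2)[of x] weyl_solution(2)[OF z] by (auto simp: dist_real_def)
    then show "x \<in> {x \<in> {l..}. \<psi> z x \<noteq> 0}" using x by (auto simp: dist_norm)
  qed
  then have "negligible {l..l + d / 2}" using N negligible_subset by blast
  then show False using d(1) negligible_interval(1)[of l "l + d / 2"] by simp
qed

text \<open>
  Green's formula for \<open>\<psi> \<i>\<close> with itself reads \<open>\<parallel>\<psi> \<i>\<parallel>\<^sup>2 = - Im (m_inf \<i>)\<close>.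
\<close>

lemma weyl_function_i:
  "Im (m_inf \<i>) < 0" "m_inf (- \<i>) = cnj (m_inf \<i>)"
proof -
  have i: "\<i> \<notin> \<real>\<^sub>\<ge>\<^sub>0" "- \<i> \<notin> \<real>\<^sub>\<ge>\<^sub>0" by (auto simp: complex_nonneg_Reals_iff)
  show "m_inf (- \<i>) = cnj (m_inf \<i>)" using weyl_function_cnj[OF i(1)] i(2) by simp
  have "ip l (SL l q (\<psi> \<i>)) (\<psi> \<i>) = ip l (\<psi> \<i>) (SL l q (\<psi> \<i>)) - m_inf \<i> + cnj (m_inf \<i>)"
    using green[OF weyl_solution(1)[OF i(1)] weyl_solution(1)[OF i(1)]] weyl_solution(2,3)[OF i(1)] by simp
  then have "\<i> * ip l (\<psi> \<i>) (\<psi> \<i>) = - \<i> * ip l (\<psi> \<i>) (\<psi> \<i>) - m_inf \<i> + cnj (m_inf \<i>)"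
    by (simp add: ip_SL_weyl_solution[OF i(1) DstarD(1)[OF weyl_solution(1)[OF i(1)]]])
  from arg_cong[OF this, of Im] have "Re (ip l (\<psi> \<i>) (\<psi> \<i>)) = - Im (m_inf \<i>)" by simp
  then show "Im (m_inf \<i>) < 0" using norm_weyl_solution_pos[OF i(1)] by simp
qed

section \<open>Shrinking cut-offs\<close>

lemma vanishing_bounds:
  assumes "AC2 l \<phi>" "\<phi> l = 0"
  obtains K where "K \<ge> 0" "\<And>x. x \<in> {l..l + 1} \<Longrightarrow> cmod (dv l \<phi> x) \<le> K"
    "\<And>x. x \<in> {l..l + 1} \<Longrightarrow> cmod (\<phi> x) \<le> K * (x - l)"
proof -
  have "continuous_on {l..l + 1} (dv l \<phi>)"
    using AC2_continuous_on(2)[OF assms(1)] by (rule continuous_on_subset) auto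
  then have "bounded (dv l \<phi> ` {l..l + 1})"
    by (intro compact_imp_bounded compact_continuous_image) auto
  then obtain K where K: "\<And>x. x \<in> {l..l + 1} \<Longrightarrow> cmod (dv l \<phi> x) \<le> K" unfolding bounded_iff by blast
  have K0: "K \<ge> 0" using K[of l] by (auto intro: order_trans[OF norm_ge_zero])
  have "cmod (\<phi> x) \<le> K * (x - l)" if x: "x \<in> {l..l + 1}" for x
  proof -
    have "norm (\<phi> x - \<phi> l) \<le> K * norm (x - l)"
    proof (rule differentiable_bound[of "{l..l + 1}" \<phi> "\<lambda>x h. h *\<^sub>R dv l \<phi> x"])
      fix t assume t: "t \<in> {l..l + 1}"
      then have "(\<phi> has_vector_derivative dv l \<phi> t) (at t within {l..})"
        by (intro AC2_has_dv[OF assms(1)]) auto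
      then have "(\<phi> has_vector_derivative dv l \<phi> t) (at t within {l..l + 1})"
        by (rule has_vector_derivative_within_subset) auto
      then show "(\<phi> has_derivative (\<lambda>h. h *\<^sub>R dv l \<phi> t)) (at t within {l..l + 1})"
        by (simp add: has_vector_derivative_def)
      show "onorm (\<lambda>h. h *\<^sub>R dv l \<phi> t) \<le> K"
      proof (rule onorm_le)
        fix h :: real
        have "\<bar>h\<bar> * cmod (dv l \<phi> t) \<le> \<bar>h\<bar> * K" by (intro mult_left_mono K t) auto
        then show "norm (h *\<^sub>R dv l \<phi> t) \<le> K * norm h" by (simp add: mult.commute)
      qed
    qed (use x in auto)
    then show ?thesis using x assms(2) by simp
  qed
  with K0 K show thesis using that by blast
qed

text \<open>
  The elements are \<open>\<phi>1 0\<close> times a bump of width \<open>1 / n\<close>. They change the initial derivative and keep the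
  initial value, but become invisible to the form: \<open>\<phi>1 0\<close> is of size \<open>1 / n\<close> on the bump, while
  \<open>SL l q (w n)\<close> is of size \<open>n\<close>, so the integrand of the form is bounded and its support shrinks to
  a point.
\<close>

lemma shrinking_elements:
  obtains w :: "nat \<Rightarrow> cfun" where "\<And>n. w n \<in> Dstar l q" "\<And>n. w n l = 0" "\<And>n. dv l (w n) l = 1"
    "\<And>F. F \<in> L2 l \<Longrightarrow> (\<lambda>n. ip l F (w n)) \<longlonglongrightarrow> 0"
    "(\<lambda>n. ip l (SL l q (w n)) (w n)) \<longlonglongrightarrow> 0"
proof -
  have sol: "is_solution l q 0 (\<phi>1 0)" "\<phi>1 0 l = 0" "dv l (\<phi>1 0) l = 1"
    using fundamental by (auto simp: fundamental_solutions_def)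
  then have ac: "AC2 l (\<phi>1 0)" by (simp add: is_solution_def)
  obtain K where K: "K \<ge> 0" "\<And>x. x \<in> {l..l + 1} \<Longrightarrow> cmod (dv l (\<phi>1 0) x) \<le> K"
    "\<And>x. x \<in> {l..l + 1} \<Longrightarrow> cmod (\<phi>1 0 x) \<le> K * (x - l)"
    using vanishing_bounds[OF ac sol(2)] by blast
  define N where "N = (\<lambda>n. real (Suc n))"
  have N: "N n > 0" "1 / N n \<le> 1" for n by (auto simp: N_def)
  have "\<forall>n. \<exists>\<eta> \<eta>1 \<eta>2. (\<forall>x. (\<eta> has_real_derivative \<eta>1 x) (at x)) \<and> (\<forall>x. (\<eta>1 has_real_derivative \<eta>2 x) (at x)) \<and>
    continuous_on UNIV \<eta>2 \<and> \<eta> l = 1 \<and> \<eta>1 l = 0 \<and>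
    (\<forall>x > l + 1 / N n. \<eta> x = 0 \<and> \<eta>1 x = 0 \<and> \<eta>2 x = 0) \<and>
    (\<forall>x. \<bar>\<eta> x\<bar> \<le> 1 \<and> \<bar>\<eta>1 x\<bar> \<le> 6 * N n \<and> \<bar>\<eta>2 x\<bar> \<le> 30 * (N n)\<^sup>2)"
    using cutoff_exists[OF N(1)] by blast
  then obtain \<eta> \<eta>1 \<eta>2 where \<eta>:
    "\<And>n x. (\<eta> n has_real_derivative \<eta>1 n x) (at x)" "\<And>n x. (\<eta>1 n has_real_derivative \<eta>2 n x) (at x)"
    "\<And>n. continuous_on UNIV (\<eta>2 n)" "\<And>n. \<eta> n l = 1" "\<And>n. \<eta>1 n l = 0"
    "\<And>n x. x > l + 1 / N n \<Longrightarrow> \<eta> n x = 0 \<and> \<eta>1 n x = 0 \<and> \<eta>2 n x = 0"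
    "\<And>n x. \<bar>\<eta> n x\<bar> \<le> 1 \<and> \<bar>\<eta>1 n x\<bar> \<le> 6 * N n \<and> \<bar>\<eta>2 n x\<bar> \<le> 30 * (N n)\<^sup>2"
    by metis
  define w where "w = (\<lambda>n x. \<phi>1 0 x * complex_of_real (\<eta> n x))"
  have wn: "w n = (\<lambda>x. \<phi>1 0 x * of_real (\<eta> n x))" for n by (simp add: w_def)
  have wD: "w n \<in> Dstar l q" for n
    unfolding wn by (rule cutoff_solution_in_Dstar(1)[OF sol(1) \<eta>(1-3,6)])
  have "dv l (w n) l = dv l (\<phi>1 0) l * of_real (\<eta> n l) + \<phi>1 0 l * of_real (\<eta>1 n l)" for n
    unfolding wn by (rule cutoff_solution_in_Dstar(2)[OF sol(1) \<eta>(1-3,6)])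
  then have wl: "w n l = 0" "dv l (w n) l = 1" for n
    by (simp_all add: sol \<eta> w_def)
  have wS: "AE x in lebesgue_on {l..}. SL l q (w n) x = - 2 * dv l (\<phi>1 0) x * of_real (\<eta>1 n x) - \<phi>1 0 x * of_real (\<eta>2 n x)" for n
    unfolding wn by (rule cutoff_solution_in_Dstar(3)[OF sol(1) \<eta>(1-3,6)])
  have supp: "w n x = 0" if "x > l + 1 / N n" for n x using \<eta>(6)[OF that] by (simp add: w_def)
  have wb: "cmod (w n x) \<le> K / N n" if x: "x \<ge> l" for n x
  proof (cases "x > l + 1 / N n")
    case True
    then show ?thesis using supp K(1) N(1)[of n] by simp
  next
    case False
    have "cmod (w n x) = cmod (\<phi>1 0 x) * \<bar>\<eta> n x\<bar>" by (simp add: w_def norm_mult)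
    also have "\<dots> \<le> (K * (x - l)) * 1"
      using K(1) x False N(2)[of n] \<eta>(7)[of n x] by (intro mult_mono K(3)) auto
    also have "\<dots> \<le> K * (1 / N n)" unfolding mult_1_right using False K(1) by (intro mult_left_mono) auto
    finally show ?thesis by simp
  qed
  have wK: "cmod (w n x) \<le> K * indicator {l..l + 1} x" if x: "x \<ge> l" for n x
  proof (cases "x > l + 1")
    case True
    then have "x > l + 1 / N n" using N(2)[of n] by linarith
    then show ?thesis using supp True by simp
  next
    case False
    have "K / N n \<le> K" using N K(1) by (simp add: field_simps N_def)
    then show ?thesis using wb[OF x, of n] False x by simp
  qed
  have ptw: "(\<lambda>n. w n x) \<longlonglongrightarrow> 0" if x: "x \<ge> l" for x
  proof (rule Lim_null_comparison)
    show "\<forall>\<^sub>F n in sequentially. norm (w n x) \<le> K / N n" using wb[OF x] by simp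
    have "(\<lambda>n. K * inverse (real (Suc n))) \<longlonglongrightarrow> K * 0"
      by (intro tendsto_mult_left LIMSEQ_inverse_real_of_nat)
    then show "(\<lambda>n. K / N n) \<longlonglongrightarrow> 0" by (simp add: N_def divide_inverse)
  qed
  have meas: "(\<lambda>x. F x * cnj (w n x)) \<in> borel_measurable (lebesgue_on {l..})" if "F \<in> L2 l" for F n
    using borel_measurable_integrable[OF L2_prod_integrable[OF that DstarD(1)[OF wD]]] .
  have lim1: "(\<lambda>n. ip l F (w n)) \<longlonglongrightarrow> 0" if F: "F \<in> L2 l" for F
  proof -
    have "(\<lambda>n. LINT x|lebesgue_on {l..}. F x * cnj (w n x)) \<longlonglongrightarrow> (LINT x|lebesgue_on {l..}. 0)"
    proof (rule integral_dominated_convergence)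
      show "integrable (lebesgue_on {l..}) (\<lambda>x. (cmod (F x))\<^sup>2 + K\<^sup>2 * indicator {l..l + 1} x)"
        using L2_D(2)[OF F] integrable_indicator_Icc[of l "l + 1"] by simp
      show "AE x in lebesgue_on {l..}. (\<lambda>n. F x * cnj (w n x)) \<longlonglongrightarrow> 0"
        using AE_ge_lebesgue_on
      proof eventually_elim
        case (elim x)
        have "(\<lambda>n. F x * cnj (w n x)) \<longlonglongrightarrow> F x * cnj 0"
          by (intro tendsto_intros ptw elim)
        then show ?case by simp
      qed
      show "AE x in lebesgue_on {l..}. norm (F x * cnj (w n x)) \<le> (cmod (F x))\<^sup>2 + K\<^sup>2 * indicator {l..l + 1} x" for n
        using AE_ge_lebesgue_on
      proof eventually_elim
        case (elim x)
        have "0 \<le> cmod (F x) * cmod (w n x)" by simp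
        then have "norm (F x * cnj (w n x)) \<le> (cmod (F x))\<^sup>2 + (cmod (w n x))\<^sup>2"
          using sum_squares_bound[of "cmod (F x)" "cmod (w n x)"] unfolding norm_mult complex_mod_cnj by linarith
        also have "(cmod (w n x))\<^sup>2 \<le> (K * indicator {l..l + 1} x)\<^sup>2"
          using wK[OF elim] by (intro power_mono) auto
        also have "(K * indicator {l..l + 1} x)\<^sup>2 = K\<^sup>2 * (indicator {l..l + 1} x :: real)"
          by (simp add: indicator_def)
        finally show ?case by simp
      qed
    qed (use meas[OF F] in auto)
    then show ?thesis by (simp add: ip_def)
  qed
  have lim2: "(\<lambda>n. ip l (SL l q (w n)) (w n)) \<longlonglongrightarrow> 0"
  proof -
    have "(\<lambda>n. LINT x|lebesgue_on {l..}. SL l q (w n) x * cnj (w n x)) \<longlonglongrightarrow> (LINT x|lebesgue_on {l..}. 0)"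
    proof (rule integral_dominated_convergence)
      \<comment> \<open>\<open>42 = 2 * 6 + 30\<close> collects the bounds for the first and second derivative of the bump.\<close>
      show "integrable (lebesgue_on {l..}) (\<lambda>x. 42 * K\<^sup>2 * indicator {l..l + 1} x)"
        using integrable_indicator_Icc[of l "l + 1"] by simp
      have "negligible {l}" by simp
      then have "AE x in lebesgue_on {l..}. x \<noteq> l"
        by (subst AE_lebesgue_on_iff_negligible) (auto intro: negligible_subset)
      then show "AE x in lebesgue_on {l..}. (\<lambda>n. SL l q (w n) x * cnj (w n x)) \<longlonglongrightarrow> 0"
        using AE_ge_lebesgue_on
      proof eventually_elim
        case (elim x)
        then have "0 < x - l" by simp
        then obtain n0 where n0: "inverse (real (Suc n0)) < x - l" using reals_Archimedean by blast
        have "SL l q (w n) x * cnj (w n x) = 0" if "n \<ge> n0" for n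
        proof -
          have "inverse (real (Suc n)) \<le> inverse (real (Suc n0))"
            using that by (intro le_imp_inverse_le) auto
          then have "1 / N n < x - l" using n0 unfolding N_def inverse_eq_divide by linarith
          then have "w n x = 0" using supp[of n x] by simp
          then show ?thesis by simp
        qed
        then show ?case
          by (intro tendsto_eventually) (auto simp: eventually_sequentially)
      qed
      show "AE x in lebesgue_on {l..}. norm (SL l q (w n) x * cnj (w n x)) \<le> 42 * K\<^sup>2 * indicator {l..l + 1} x" for n
        using AE_ge_lebesgue_on wS[of n]
      proof eventually_elim
        case (elim x)
        show ?case
        proof (cases "x > l + 1 / N n")
          case True
          then show ?thesis using supp by (simp add: indicator_def)
        next
          case False
          then have x1: "x \<in> {l..l + 1}" "x - l \<le> 1 / N n" using N(2)[of n] elim(1) by auto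
          have p: "cmod (\<phi>1 0 x) \<le> K / N n"
          proof -
            have "cmod (\<phi>1 0 x) \<le> K * (x - l)" by (rule K(3)[OF x1(1)])
            also have "\<dots> \<le> K * (1 / N n)" using x1(2) K(1) by (rule mult_left_mono)
            finally show ?thesis by simp
          qed
          have "cmod (SL l q (w n) x) \<le> cmod (2 * dv l (\<phi>1 0) x * of_real (\<eta>1 n x)) + cmod (\<phi>1 0 x * of_real (\<eta>2 n x))"
            unfolding elim(2) using norm_triangle_ineq4[of "- (2 * dv l (\<phi>1 0) x * of_real (\<eta>1 n x))" "\<phi>1 0 x * of_real (\<eta>2 n x)"]
            by simp
          also have "\<dots> = 2 * (cmod (dv l (\<phi>1 0) x) * \<bar>\<eta>1 n x\<bar>) + cmod (\<phi>1 0 x) * \<bar>\<eta>2 n x\<bar>"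
            by (simp add: norm_mult)
          also have "\<dots> \<le> 2 * (K * (6 * N n)) + (K / N n) * (30 * (N n)\<^sup>2)"
            using K(1) K(2)[OF x1(1)] p \<eta>(7)[of n x] N(1)[of n]
            by (intro add_mono mult_mono mult_left_mono) auto
          also have "\<dots> = 42 * K * N n" using N(1)[of n] by (simp add: field_simps power2_eq_square)
          finally have s: "cmod (SL l q (w n) x) \<le> 42 * K * N n" .
          have "norm (SL l q (w n) x * cnj (w n x)) \<le> (42 * K * N n) * (K / N n)"
            unfolding norm_mult complex_mod_cnj
            using s wb[OF elim(1), of n] K(1) N(1)[of n] by (intro mult_mono) auto
          also have "\<dots> = 42 * K\<^sup>2" using N(1)[of n] by (simp add: field_simps power2_eq_square)
          finally show ?thesis using x1(1) by simp
        qed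
      qed
    qed (use meas[OF DstarD(3)[OF wD]] in auto)
    then show ?thesis by (simp add: ip_def)
  qed
  show thesis using that[of w] wD wl lim1 lim2 by blast
qed

section \<open>The quadratic form\<close>

text \<open>
  The functions \<open>g - g'(l) w n\<close> belong to \<open>Dom_min l q\<close>, where the form is nonnegative, and their
  forms converge to the form of \<open>g\<close>.
\<close>

lemma Dirichlet_nonneg:
  assumes g: "g \<in> Dstar l q" "g l = 0"
  shows "0 \<le> Re (ip l (SL l q g) g)"
proof -
  obtain w where w: "\<And>n. w n \<in> Dstar l q" "\<And>n. w n l = 0" "\<And>n. dv l (w n) l = 1"
    "\<And>F. F \<in> L2 l \<Longrightarrow> (\<lambda>n. ip l F (w n)) \<longlonglongrightarrow> 0"
    "(\<lambda>n. ip l (SL l q (w n)) (w n)) \<longlonglongrightarrow> 0"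
    using shrinking_elements by blast
  define c where "c = - dv l g l"
  define s where "s = (\<lambda>n. ip l (SL l q g) g + cnj c * ip l (SL l q g) (w n) + c * cnj (ip l (SL l q g) (w n))
      + c * cnj c * ip l (SL l q (w n)) (w n))"
  have pos: "0 \<le> Re (s n)" for n
  proof -
    have D: "(\<lambda>x. g x + c * w n x) \<in> Dstar l q" by (rule Dstar_combine[OF g(1) w(1)])
    have "(\<lambda>x. g x + c * w n x) \<in> Dom_min l q"
      using D g(2) w(2,3) dv_combine[OF g(1) w(1), of c n] by (simp add: Dom_min_def c_def)
    then have "ip l (SL l q (\<lambda>x. g x + c * w n x)) (\<lambda>x. g x + c * w n x) \<in> \<real>\<^sub>\<ge>\<^sub>0"
      using nonneg by (simp add: nonnegative_op_def)
    then have "0 \<le> Re (ip l (SL l q (\<lambda>x. g x + c * w n x)) (\<lambda>x. g x + c * w n x))"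
      by (simp add: complex_nonneg_Reals_iff)
    moreover have "ip l (SL l q (w n)) g = cnj (ip l (SL l q g) (w n))"
      using green[OF w(1)[of n] g(1)] w(2) g(2) by (simp add: ip_cnj[of l "w n"])
    ultimately show ?thesis
      unfolding form_expand[OF g(1) w(1)] s_def by simp
  qed
  have "s \<longlonglongrightarrow> ip l (SL l q g) g + cnj c * 0 + c * cnj 0 + c * cnj c * 0"
    unfolding s_def by (intro tendsto_intros w(4)[OF DstarD(3)[OF g(1)]] w(5))
  then have "(\<lambda>n. Re (s n)) \<longlonglongrightarrow> Re (ip l (SL l q g) g)"
    by (simp add: tendsto_Re)
  then show ?thesis using pos by (intro LIMSEQ_le_const) auto
qed

lemma negative_not_nonneg_Real: "t < 0 \<Longrightarrow> complex_of_real t \<notin> \<real>\<^sub>\<ge>\<^sub>0"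
  by (simp add: complex_nonneg_Reals_iff)

text \<open>
  Write \<open>f = g - f(l) \<psi> t\<close> with \<open>g(l) = 0\<close>. With respect to the form shifted by \<open>t\<close>, the function \<open>g\<close>
  is orthogonal to \<open>\<psi> t\<close> up to boundary terms, so the shifted form of \<open>f\<close> is that of \<open>g\<close>, which is
  nonnegative, plus \<open>\<bar>f(l)\<bar>\<^sup>2 m_inf t\<close> and the boundary term of \<open>f\<close>. The Weyl function at \<open>t\<close> is the
  minimum of a quadratic functional.
\<close>

lemma form_bound_at:
  assumes f: "f \<in> Dstar l q" and t: "t < 0"
  shows "t * Re (ip l f f) + Re (dv l f l * cnj (f l)) + Re (m_inf (of_real t)) * (cmod (f l))\<^sup>2
      \<le> Re (ip l (SL l q f) f)"
proof -
  let ?z = "complex_of_real t"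
  note z = negative_not_nonneg_Real[OF t]
  note P = weyl_solution(1-3)[OF z]
  note PI = ip_SL_weyl_solution[OF z]
  define c where "c = f l"
  define g where "g = (\<lambda>x. f x + c * \<psi> ?z x)"
  have g: "g \<in> Dstar l q" "g l = 0"
    unfolding g_def using Dstar_combine[OF f P(1)] P(2) by (auto simp: c_def)
  note L = DstarD[OF f] DstarD[OF P(1)] DstarD[OF g(1)]
  have X: "ip l (SL l q f) (\<psi> ?z) = ?z * ip l f (\<psi> ?z) - dv l f l - c * cnj (m_inf ?z)"
    using green[OF f P(1)] PI(2)[OF L(1)] P(2,3) by (simp add: c_def)
  have 1: "ip l (SL l q g) g = ip l (SL l q f) f + cnj c * ip l (SL l q f) (\<psi> ?z)
     + c * (?z * ip l (\<psi> ?z) f) + c * cnj c * (?z * ip l (\<psi> ?z) (\<psi> ?z))"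
    unfolding g_def form_expand[OF f P(1)] PI(1)[OF L(1)] PI(1)[OF L(4)] ..
  have 2: "ip l g g = ip l f f + cnj c * ip l f (\<psi> ?z) + c * ip l (\<psi> ?z) f + c * cnj c * ip l (\<psi> ?z) (\<psi> ?z)"
    using L unfolding g_def by (simp add: ip_combine_left ip_combine_right algebra_simps)
  have "ip l (SL l q g) g - ?z * ip l g g
     = ip l (SL l q f) f - ?z * ip l f f - cnj c * dv l f l - c * cnj c * cnj (m_inf ?z)"
    unfolding 1 2 X by (simp add: algebra_simps)
  then have "Re (ip l (SL l q g) g - ?z * ip l g g)
     = Re (ip l (SL l q f) f - ?z * ip l f f - cnj c * dv l f l - c * cnj c * cnj (m_inf ?z))" by simp
  moreover have "Re (c * cnj c * cnj (m_inf ?z)) = Re (m_inf ?z) * (cmod c)\<^sup>2"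
    by (simp flip: complex_norm_square)
  ultimately have "Re (ip l (SL l q g) g) - t * Re (ip l g g) = Re (ip l (SL l q f) f) - t * Re (ip l f f)
     - Re (dv l f l * cnj c) - Re (m_inf ?z) * (cmod c)\<^sup>2"
    by (simp add: mult.commute)
  moreover have "t * Re (ip l g g) \<le> 0" using t ip_self_nonneg(1)[of l g] by (simp add: mult_nonpos_nonneg)
  ultimately show ?thesis using Dirichlet_nonneg[OF g] by (simp add: c_def)
qed

text \<open>
  The minimizer \<open>\<psi> t\<close> has in general the wrong initial derivative for the domain of \<open>T\<^sub>h\<close>. Adding \<open>c w n\<close> corrects the
  derivative, and in the limit changes the form only by the boundary term \<open>- c\<close>.
\<close>

lemma form_bound_sharp_at:
  assumes t: "t < 0"
    and K: "\<And>f. f \<in> Dom_T l q h \<Longrightarrow> f l = -1 \<Longrightarrow> K \<le> Re (ip l (SL l q f) f)"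
  shows "K \<le> Re h + Re (m_inf (of_real t))"
proof -
  let ?z = "complex_of_real t"
  note z = negative_not_nonneg_Real[OF t]
  note P = weyl_solution(1-3)[OF z]
  obtain w where w: "\<And>n. w n \<in> Dstar l q" "\<And>n. w n l = 0" "\<And>n. dv l (w n) l = 1"
    "\<And>F. F \<in> L2 l \<Longrightarrow> (\<lambda>n. ip l F (w n)) \<longlonglongrightarrow> 0"
    "(\<lambda>n. ip l (SL l q (w n)) (w n)) \<longlonglongrightarrow> 0"
    using shrinking_elements by blast
  define c where "c = - h - m_inf ?z"
  define a where "a = ip l (SL l q (\<psi> ?z)) (\<psi> ?z)"
  define b where "b = (\<lambda>n. ip l (SL l q (\<psi> ?z)) (w n))"
  define s where "s = (\<lambda>n. a + cnj c * b n + c * (cnj (b n) - 1) + c * cnj c * ip l (SL l q (w n)) (w n))"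
  have pos: "K \<le> Re (s n)" for n
  proof -
    let ?f = "\<lambda>x. \<psi> ?z x + c * w n x"
    have D: "?f \<in> Dstar l q" by (rule Dstar_combine[OF P(1) w(1)])
    have "?f \<in> Dom_T l q h"
      using D P(2,3) w(2,3) dv_combine[OF P(1) w(1), of c n] by (simp add: Dom_T_def c_def)
    then have "K \<le> Re (ip l (SL l q ?f) ?f)" using P w by (intro K) auto
    moreover have "ip l (SL l q (w n)) (\<psi> ?z) = cnj (b n) - 1"
      using green[OF w(1)[of n] P(1)] w(2,3) P(2) by (simp add: b_def ip_cnj[of l "w n"])
    ultimately show ?thesis
      unfolding form_expand[OF P(1) w(1)] s_def a_def b_def by simp
  qed
  have "b \<longlonglongrightarrow> 0" unfolding b_def by (rule w(4)[OF DstarD(3)[OF P(1)]])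
  then have "s \<longlonglongrightarrow> a + cnj c * 0 + c * (cnj 0 - 1) + c * cnj c * 0"
    unfolding s_def by (intro tendsto_intros w(5))
  then have "(\<lambda>n. Re (s n)) \<longlonglongrightarrow> Re (a - c)"
    by (auto dest: tendsto_Re)
  then have "K \<le> Re (a - c)" using pos by (intro LIMSEQ_le_const) auto
  moreover have "Re a \<le> 0"
    using ip_SL_weyl_solution(1)[OF z DstarD(1)[OF P(1)]] t ip_self_nonneg(1)[of l "\<psi> ?z"]
    by (simp add: a_def mult_nonpos_nonneg)
  ultimately show ?thesis by (simp add: c_def)
qed

section \<open>Extremal accretive boundary conditions\<close>

context
  fixes m :: real
  assumes lim: "((\<lambda>t::real. m_inf (of_real t)) \<longlongrightarrow> of_real m) (at_left 0)"
begin

lemma Re_lim: "((\<lambda>t::real. Re (m_inf (of_real t))) \<longlongrightarrow> m) (at_left 0)"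
  using tendsto_Re[OF lim] by simp

lemma form_bound:
  assumes f: "f \<in> Dstar l q"
  shows "Re (dv l f l * cnj (f l)) + m * (cmod (f l))\<^sup>2 \<le> Re (ip l (SL l q f) f)"
proof (rule tendsto_upperbound)
  have "((\<lambda>t. t * Re (ip l f f) + Re (dv l f l * cnj (f l)) + Re (m_inf (of_real t)) * (cmod (f l))\<^sup>2)
     \<longlongrightarrow> 0 * Re (ip l f f) + Re (dv l f l * cnj (f l)) + m * (cmod (f l))\<^sup>2) (at_left 0)"
    by (intro tendsto_intros Re_lim)
  then show "((\<lambda>t. t * Re (ip l f f) + Re (dv l f l * cnj (f l)) + Re (m_inf (of_real t)) * (cmod (f l))\<^sup>2)
     \<longlongrightarrow> Re (dv l f l * cnj (f l)) + m * (cmod (f l))\<^sup>2) (at_left 0)" by simp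
  have "\<forall>\<^sub>F t in at_left (0::real). t < 0" by (simp add: eventually_at_filter)
  then show "\<forall>\<^sub>F t in at_left 0. t * Re (ip l f f) + Re (dv l f l * cnj (f l)) + Re (m_inf (of_real t)) * (cmod (f l))\<^sup>2
      \<le> Re (ip l (SL l q f) f)"
    by eventually_elim (rule form_bound_at[OF f])
qed simp

lemma form_bound_sharp:
  assumes K: "\<And>f. f \<in> Dom_T l q h \<Longrightarrow> f l = -1 \<Longrightarrow> K \<le> Re (ip l (SL l q f) f)"
  shows "K \<le> Re h + m"
proof (rule tendsto_lowerbound)
  show "((\<lambda>t. Re h + Re (m_inf (of_real t))) \<longlongrightarrow> Re h + m) (at_left 0)"
    by (intro tendsto_intros Re_lim)
  have "\<forall>\<^sub>F t in at_left (0::real). t < 0" by (simp add: eventually_at_filter)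
  then show "\<forall>\<^sub>F t in at_left 0. K \<le> Re h + Re (m_inf (of_real t))"
    by eventually_elim (rule form_bound_sharp_at[OF _ K])
qed simp

text \<open>
  The boundary condition turns the boundary terms of the form bound and of Green's formula into
  multiples of \<open>\<bar>f(l)\<bar>\<^sup>2\<close>.
\<close>

lemma Dom_T_form:
  assumes f: "f \<in> Dom_T l q h"
  shows "(Re h + m) * (cmod (f l))\<^sup>2 \<le> Re (ip l (SL l q f) f)"
    "Im (ip l (SL l q f) f) = Im h * (cmod (f l))\<^sup>2"
proof -
  have D: "f \<in> Dstar l q" and d: "dv l f l = h * f l" using f by (auto simp: Dom_T_def)
  have sq: "h * f l * cnj (f l) = h * of_real ((cmod (f l))\<^sup>2)"
    by (simp only: complex_norm_square mult.assoc)
  show "(Re h + m) * (cmod (f l))\<^sup>2 \<le> Re (ip l (SL l q f) f)"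
    using form_bound[OF D] unfolding d sq by (simp add: algebra_simps)
  have "Im (ip l (SL l q f) f) = Im (cnj (ip l (SL l q f) f) + h * f l * cnj (f l) - cnj (h * f l * cnj (f l)))"
    using green[OF D D] unfolding d by (simp add: ip_cnj[of l f "SL l q f"] mult.commute mult.left_commute)
  also have "\<dots> = - Im (ip l (SL l q f) f) + 2 * (Im h * (cmod (f l))\<^sup>2)"
    unfolding sq by simp
  finally show "Im (ip l (SL l q f) f) = Im h * (cmod (f l))\<^sup>2" by simp
qed

text \<open>
  On the domain of \<open>T\<^sub>h\<close> with \<open>\<bar>f(l)\<bar> = 1\<close>, the real part of the form has infimum \<open>Re h + m\<close> and
  the imaginary part is the constant \<open>Im h\<close>. So \<open>T\<^sub>h\<close> is accretive if and only if \<open>Re h + m \<ge> 0\<close>,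
  and sectorial for some angle if and only if \<open>Re h + m > 0\<close>.
\<close>

lemma extremal_accretive_iff:
  assumes h: "0 < Im h"
  shows "extremal_accretive l (Dom_T l q h) (SL l q) \<longleftrightarrow> Re h = - m"
proof
  assume ext: "extremal_accretive l (Dom_T l q h) (SL l q)"
  have "0 \<le> Re h + m"
    by (rule form_bound_sharp) (use ext in \<open>auto simp: extremal_accretive_def accretive_def\<close>)
  moreover have "\<not> 0 < Re h + m"
  proof
    assume p: "0 < Re h + m"
    \<comment> \<open>the largest possible cotangent of a sectorial angle\<close>
    define k where "k = (Re h + m) / Im h"
    have k: "k > 0" using p h by (simp add: k_def)
    define \<alpha> where "\<alpha> = pi / 2 - arctan k"
    have \<alpha>: "0 < \<alpha>" "\<alpha> < pi / 2" using k arctan_ubound[of k] by (auto simp: \<alpha>_def zero_less_arctan_iff)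
    have cot: "cot \<alpha> = k"
    proof -
      have "cot \<alpha> = sin (arctan k) / cos (arctan k)"
        by (simp add: cot_def \<alpha>_def cos_diff sin_diff)
      also have "\<dots> = tan (arctan k)" by (simp only: tan_def)
      finally show ?thesis by (simp only: tan_arctan)
    qed
    have "sectorial \<alpha> l (Dom_T l q h) (SL l q)"
      unfolding sectorial_def
    proof
      fix f assume f: "f \<in> Dom_T l q h"
      have "cot \<alpha> * \<bar>Im (ip l (SL l q f) f)\<bar> = (Re h + m) * (cmod (f l))\<^sup>2"
        unfolding Dom_T_form(2)[OF f] cot using h by (simp add: k_def abs_mult)
      then show "cot \<alpha> * \<bar>Im (ip l (SL l q f) f)\<bar> \<le> Re (ip l (SL l q f) f)"
        using Dom_T_form(1)[OF f] by simp
    qed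
    then show False using ext \<alpha> by (auto simp: extremal_accretive_def)
  qed
  ultimately show "Re h = - m" by simp
next
  assume r: "Re h = - m"
  show "extremal_accretive l (Dom_T l q h) (SL l q)"
    unfolding extremal_accretive_def
  proof (intro conjI allI impI notI)
    show "accretive l (Dom_T l q h) (SL l q)"
      unfolding accretive_def using Dom_T_form(1)[of _ h] r by simp
    fix \<alpha> :: real assume \<alpha>: "0 < \<alpha> \<and> \<alpha> < pi / 2" and sec: "sectorial \<alpha> l (Dom_T l q h) (SL l q)"
    have "cot \<alpha> > 0" using \<alpha> by (simp add: cot_def cos_gt_zero sin_gt_zero)
    moreover have "cot \<alpha> * Im h \<le> Re h + m"
    proof (rule form_bound_sharp)
      fix f assume f: "f \<in> Dom_T l q h" "f l = -1"
      then have "cot \<alpha> * \<bar>Im (ip l (SL l q f) f)\<bar> \<le> Re (ip l (SL l q f) f)"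
        using sec by (auto simp: sectorial_def)
      then show "cot \<alpha> * Im h \<le> Re (ip l (SL l q f) f)"
        unfolding Dom_T_form(2)[OF f(1)] using f(2) h by simp
    qed
    ultimately show False using r h by (simp add: mult_le_0_iff)
  qed
qed

end

end

section \<open>The transfer function at \<open>-\<i>\<close>\<close>

context nonnegative_half_line
begin

text \<open>
  The cases \<open>\<mu> \<in> \<real>\<close> and \<open>\<mu> = \<infinity>\<close> are treated together as \<open>\<alpha> \<delta> + \<beta> \<delta>'\<close> with \<open>(\<alpha>, \<beta>) = (\<mu>, 1)\<close> and \<open>(1, 0)\<close>.
  The value is unique because testing the defining equation against \<open>v = \<psi> \<i>\<close> alone removes, by
  Green's formula, everything but the initial values of \<open>y\<close> and determines \<open>K\<^sup>* y\<close>. A solution exists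
  because a multiple of \<open>\<psi> (- \<i>)\<close> has the required jump in the boundary condition.
\<close>

lemma transfer_function_at_minus_i:
  fixes \<alpha> \<beta> s :: real and h k :: complex and \<Theta> :: L_system
  assumes h: "0 < Im h"
    and k: "k * (of_real \<alpha> - of_real \<beta> * h) = 1"
    and s: "s\<^sup>2 = Im h * (cmod k)\<^sup>2"
    and state: "\<And>y v. state_operator \<Theta> y v =
      ip l (SL l q y) v - k * (dv l y l - h * y l) * (of_real \<alpha> * delta l v + of_real \<beta> * delta' l v)"
    and channel: "\<And>v. channel_operator \<Theta> 1 v = of_real s * (of_real \<alpha> * delta l v + of_real \<beta> * delta' l v)"
  defines "M \<equiv> cnj (m_inf \<i>)" and "d \<equiv> of_real \<alpha> - of_real \<beta> * h"
  shows "transfer_function l q \<Theta> (- \<i>) = d * (M + cnj h) / (cnj d * (M + h))"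
  unfolding transfer_function_def
proof (rule the_equality)
  have i: "\<i> \<notin> \<real>\<^sub>\<ge>\<^sub>0" "- \<i> \<notin> \<real>\<^sub>\<ge>\<^sub>0" by (auto simp: complex_nonneg_Reals_iff)
  note P = weyl_solution[OF i(1)] and P' = weyl_solution[OF i(2)]
  note PI = ip_SL_weyl_solution[OF i(1)] and PI' = ip_SL_weyl_solution[OF i(2)]
  have Mh: "M + h \<noteq> 0"
    using weyl_function_i(1) h by (auto simp: M_def complex_eq_iff)
  have kd: "k * d = 1" using k by (simp add: d_def)
  then have d0: "d \<noteq> 0" by auto
  have kk: "k * cnj k * (d * cnj d) = 1"
  proof -
    have "k * cnj k * (d * cnj d) = (k * d) * cnj (k * d)" by simp
    then show ?thesis unfolding kd by simp
  qed
  have ss: "of_real s * of_real s * (d * cnj d) = complex_of_real (Im h)"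
  proof -
    have "complex_of_real s * of_real s = of_real (s\<^sup>2)" by (simp add: power2_eq_square)
    also have "\<dots> = of_real (Im h) * (k * cnj k)" unfolding s by (simp only: of_real_mult complex_norm_square)
    finally have "of_real s * of_real s * (d * cnj d) = of_real (Im h) * (k * cnj k * (d * cnj d))"
      by (simp only: mult.assoc)
    then show ?thesis unfolding kk by simp
  qed
  have w_eq: "1 - 2 * \<i> * channel_adjoint \<Theta> y = d * (M + cnj h) / (cnj d * (M + h))"
    if y: "y \<in> Dstar l q"
      and eq: "\<forall>v\<in>Dstar l q. state_operator \<Theta> y v - (- \<i>) * ip l y v = channel_operator \<Theta> 1 v" for y
  proof -
    define y0 where "y0 = y l"
    define y1 where "y1 = dv l y l"
    define g where "g = of_real \<alpha> + of_real \<beta> * M"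
    have G: "of_real \<alpha> * delta l (\<psi> \<i>) + of_real \<beta> * delta' l (\<psi> \<i>) = - g"
      using P(2,3) by (simp add: delta_def delta'_def g_def M_def)
    have "ip l (SL l q y) (\<psi> \<i>) = - \<i> * ip l y (\<psi> \<i>) - y1 - y0 * M"
      using green[OF y P(1)] PI(2)[OF DstarD(1)[OF y]] P(2,3) by (simp add: y0_def y1_def M_def)
    moreover have "state_operator \<Theta> y (\<psi> \<i>) - (- \<i>) * ip l y (\<psi> \<i>) = channel_operator \<Theta> 1 (\<psi> \<i>)"
      using eq P(1) by blast
    ultimately have e: "k * (y1 - h * y0) * g - y0 * M - y1 = - (of_real s * g)"
      unfolding state channel G y0_def[symmetric] y1_def[symmetric] by simp
    have "(k * d) * (y1 - h * y0) * g - d * (y1 + y0 * M) = - (of_real s * g * d)"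
      using arg_cong[OF e, of "\<lambda>x. d * x"] by (simp add: algebra_simps)
    then have "(y1 - h * y0) * g - d * (y1 + y0 * M) = - (of_real s * g * d)"
      unfolding kd by simp
    then have key: "(M + h) * (of_real \<alpha> * y0 - of_real \<beta> * y1) = of_real s * g * d"
      unfolding g_def d_def by (simp add: algebra_simps)
    have adj: "channel_adjoint \<Theta> y = of_real s * (of_real \<alpha> * y0 - of_real \<beta> * y1)"
      unfolding channel_adjoint_def channel delta_def delta'_def y0_def y1_def by simp
    have "cnj d * (M + h) * (1 - 2 * \<i> * channel_adjoint \<Theta> y)
        = cnj d * (M + h) - 2 * \<i> * of_real s * cnj d * ((M + h) * (of_real \<alpha> * y0 - of_real \<beta> * y1))"
      unfolding adj by (simp add: algebra_simps)
    also have "\<dots> = cnj d * (M + h) - 2 * \<i> * g * (of_real s * of_real s * (d * cnj d))"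
      unfolding key by (simp add: algebra_simps)
    also have "\<dots> = cnj d * (M + h) - g * (h - cnj h)"
      unfolding ss complex_diff_cnj by (simp add: algebra_simps)
    also have "\<dots> = d * (M + cnj h)"
      unfolding g_def d_def by (simp add: algebra_simps)
    finally have "1 - 2 * \<i> * channel_adjoint \<Theta> y = d * (M + cnj h) / (cnj d * (M + h))"
      using d0 Mh by (simp add: eq_divide_eq mult.commute)
    then show ?thesis .
  qed
  show "w = d * (M + cnj h) / (cnj d * (M + h))"
    if "\<exists>y\<in>Dstar l q. (\<forall>v\<in>Dstar l q. state_operator \<Theta> y v - - \<i> * ip l y v = channel_operator \<Theta> 1 v) \<and>
        w = 1 - 2 * \<i> * channel_adjoint \<Theta> y" for w
    using that w_eq by blast
  \<comment> \<open>\<open>y = c \<psi>(- \<i>)\<close>, with \<open>c\<close> solving \<open>k c (M + h) = - s\<close>\<close>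
  define c where "c = - (of_real s * d / (M + h))"
  define y where "y = (\<lambda>x. \<psi> (- \<i>) x + (c - 1) * \<psi> (- \<i>) x)"
  have y: "y \<in> Dstar l q" unfolding y_def by (rule Dstar_combine[OF P'(1) P'(1)])
  have y0: "y l = - c" using P'(2) by (simp add: y_def)
  have y1: "dv l y l = c * M"
    unfolding y_def dv_combine[OF P'(1) P'(1)] P'(3) weyl_function_i(2) M_def by (simp add: algebra_simps)
  have eq: "state_operator \<Theta> y v - (- \<i>) * ip l y v = channel_operator \<Theta> 1 v" if v: "v \<in> Dstar l q" for v
  proof -
    note L = DstarD(1)[OF P'(1)] DstarD(1)[OF v]
    have "ip l (SL l q y) v = - \<i> * ip l y v"
      unfolding y_def ip_SL_combine_left[OF P'(1) P'(1) L(2)] ip_combine_left[OF L(1) L(1) L(2)] PI'(1)[OF L(2)]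
      by (simp add: algebra_simps)
    moreover have "k * (c * M - h * - c) = - of_real s"
    proof -
      have "k * (c * M - h * - c) = k * (c * (M + h))" by (simp add: algebra_simps)
      also have "c * (M + h) = - (of_real s * d)" using Mh by (simp add: c_def)
      also have "k * - (of_real s * d) = - (of_real s * (k * d))" by (simp add: algebra_simps)
      finally show ?thesis unfolding kd by simp
    qed
    ultimately show ?thesis unfolding state channel y0 y1 by simp
  qed
  show "\<exists>y\<in>Dstar l q. (\<forall>v\<in>Dstar l q. state_operator \<Theta> y v - - \<i> * ip l y v = channel_operator \<Theta> 1 v) \<and>
      d * (M + cnj h) / (cnj d * (M + h)) = 1 - 2 * \<i> * channel_adjoint \<Theta> y"
    using y eq w_eq[OF y] by (intro bexI[of _ y]) auto
qed

lemma norm_transfer_function: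
  assumes h: "0 < Im h"
  shows "cmod (transfer_function l q (Theta l q \<mu> h) (- \<i>))
    = cmod (cnj (m_inf \<i>) + cnj h) / cmod (cnj (m_inf \<i>) + h)"
proof -
  have *: "cmod (d * a / (cnj d * b)) = cmod a / cmod b" if "d \<noteq> 0" for d a b
    using that by (simp add: norm_mult norm_divide)
  show ?thesis
  proof (cases \<mu>)
    case (Fin u)
    have u: "complex_of_real u - h \<noteq> 0" using h by (auto simp: complex_eq_iff)
    have "transfer_function l q (Theta l q \<mu> h) (- \<i>) =
       (of_real u - of_real 1 * h) * (cnj (m_inf \<i>) + cnj h) /
       (cnj (of_real u - of_real 1 * h) * (cnj (m_inf \<i>) + h))"
    proof (rule transfer_function_at_minus_i[OF h,
          where k = "1 / (of_real u - h)" and s = "sqrt (Im h) / cmod (of_real u - h)"])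
      show "(sqrt (Im h) / cmod (complex_of_real u - h))\<^sup>2 = Im h * (cmod (1 / (complex_of_real u - h)))\<^sup>2"
        using h by (simp add: power_divide norm_divide)
    qed (use u in \<open>auto simp: Theta_def Fin\<close>)
    then show ?thesis using *[OF u] by simp
  next
    case Infty
    have "transfer_function l q (Theta l q \<mu> h) (- \<i>) =
       (of_real 1 - of_real 0 * h) * (cnj (m_inf \<i>) + cnj h) /
       (cnj (of_real 1 - of_real 0 * h) * (cnj (m_inf \<i>) + h))"
      by (rule transfer_function_at_minus_i[OF h, where k = 1 and s = "sqrt (Im h)"])
         (use h in \<open>auto simp: Theta_def Infty\<close>)
    then show ?thesis by (simp add: norm_divide)
  qed
qed

lemma c_entropy_eq_iff:
  assumes h: "0 < Im h"
  shows "c_entropy l q (Theta l q \<mu> h) = ereal S \<longleftrightarrow>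
    cmod (cnj (m_inf \<i>) + cnj h) = exp (- S) * cmod (cnj (m_inf \<i>) + h)"
proof -
  define w where "w = transfer_function l q (Theta l q \<mu> h) (- \<i>)"
  have "cnj (m_inf \<i>) + h \<noteq> 0"
    using weyl_function_i(1) h by (auto simp: complex_eq_iff)
  then have pos: "cmod (cnj (m_inf \<i>) + h) > 0" by simp
  have "c_entropy l q (Theta l q \<mu> h) = ereal S \<longleftrightarrow> w \<noteq> 0 \<and> - ln (cmod w) = S"
    by (simp add: c_entropy_def Let_def w_def)
  also have "\<dots> \<longleftrightarrow> cmod w = exp (- S)"
    by (metis exp_ln_iff exp_not_eq_zero ln_exp minus_minus norm_eq_zero zero_less_norm_iff)
  also have "\<dots> \<longleftrightarrow> cmod (cnj (m_inf \<i>) + cnj h) = exp (- S) * cmod (cnj (m_inf \<i>) + h)"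
    unfolding w_def norm_transfer_function[OF h] using pos by (simp add: divide_eq_eq)
  finally show ?thesis .
qed

text \<open>
  Squaring the entropy condition on the line \<open>Re h = - m\<close> leaves an equation for \<open>Im h\<close>.
\<close>

lemma mem_extremal_L_systems_iff:
  assumes "((\<lambda>t::real. m_inf (of_real t)) \<longlongrightarrow> of_real m) (at_left 0)"
  shows "(\<mu>, h) \<in> extremal_L_systems l q S \<longleftrightarrow> 0 < Im h \<and> Re h = - m \<and>
    (Re (m_inf \<i>) - m)\<^sup>2 + (- Im (m_inf \<i>) - Im h)\<^sup>2
      = exp (- S) ^ 2 * ((Re (m_inf \<i>) - m)\<^sup>2 + (- Im (m_inf \<i>) + Im h)\<^sup>2)"
proof -
  have eq: "cmod (cnj (m_inf \<i>) + cnj h) = exp (- S) * cmod (cnj (m_inf \<i>) + h) \<longleftrightarrow>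
    (Re (m_inf \<i>) - m)\<^sup>2 + (- Im (m_inf \<i>) - Im h)\<^sup>2
      = exp (- S) ^ 2 * ((Re (m_inf \<i>) - m)\<^sup>2 + (- Im (m_inf \<i>) + Im h)\<^sup>2)" if "Re h = - m"
  proof -
    have "cmod (cnj (m_inf \<i>) + cnj h) = exp (- S) * cmod (cnj (m_inf \<i>) + h) \<longleftrightarrow>
       (cmod (cnj (m_inf \<i>) + cnj h))\<^sup>2 = (exp (- S) * cmod (cnj (m_inf \<i>) + h))\<^sup>2"
      by (subst power2_eq_iff_nonneg) auto
    then show ?thesis using that by (simp add: power_mult_distrib cmod_power2)
  qed
  show ?thesis
    unfolding extremal_L_systems_def Theta_def[abs_def]
    using extremal_accretive_iff[OF assms] c_entropy_eq_iff eq
    by (auto simp: Theta_def)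
qed

end

section \<open>Minimizing the dissipation\<close>

text \<open>
  With \<open>E = exp (- S)\<close>, the left-hand side is \<open>a\<^sup>2 + B\<^sup>2 + D\<^sup>2 = 2 B D coth S\<close>, because
  \<open>coth S = (1 + E\<^sup>2) / (1 - E\<^sup>2)\<close>; completing the square and \<open>coth\<^sup>2 - 1 = csch\<^sup>2\<close> do the rest.
\<close>

lemma dissipation_quadratic:
  fixes a B D S :: real
  assumes S: "S > 0"
  shows "a\<^sup>2 + (B - D)\<^sup>2 = exp (- S) ^ 2 * (a\<^sup>2 + (B + D)\<^sup>2) \<longleftrightarrow>
    (D - B * coth S)\<^sup>2 = B\<^sup>2 * (csch S)\<^sup>2 - a\<^sup>2"
proof -
  define E where "E = exp (- S)"
  have E: "0 < E" "E < 1" using S by (auto simp: E_def)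
  then have E2: "E\<^sup>2 < 1" by (simp add: power_less_one_iff)
  have eS: "exp S = 1 / E" by (simp add: E_def exp_minus inverse_eq_divide)
  have sh: "sinh S = (1 - E\<^sup>2) / (2 * E)" and ch: "cosh S = (1 + E\<^sup>2) / (2 * E)"
    unfolding sinh_def cosh_def E_def[symmetric] eS using E by (auto simp: field_simps power2_eq_square)
  have sp: "sinh S > 0" using S by simp
  have "a\<^sup>2 + (B - D)\<^sup>2 = E\<^sup>2 * (a\<^sup>2 + (B + D)\<^sup>2) \<longleftrightarrow>
     (1 - E\<^sup>2) * (a\<^sup>2 + B\<^sup>2 + D\<^sup>2) = 2 * B * D * (1 + E\<^sup>2)"
    by (auto simp: power2_eq_square algebra_simps)
  also have "\<dots> \<longleftrightarrow> sinh S * (a\<^sup>2 + B\<^sup>2 + D\<^sup>2) = 2 * B * D * cosh S"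
    unfolding sh ch using E by (simp add: field_simps)
  also have "\<dots> \<longleftrightarrow> a\<^sup>2 + B\<^sup>2 + D\<^sup>2 = 2 * B * D * coth S"
    using sp by (auto simp: coth_def field_simps)
  also have "\<dots> \<longleftrightarrow> (D - B * coth S)\<^sup>2 = B\<^sup>2 * ((coth S)\<^sup>2 - 1) - a\<^sup>2"
    by (auto simp: power2_eq_square algebra_simps)
  also have "(coth S)\<^sup>2 - 1 = (csch S)\<^sup>2"
    using sp cosh_square_eq[of S] by (simp add: coth_def csch_def field_simps)
  finally show ?thesis by (simp add: E_def)
qed

theorem theorem24:
  fixes l :: real and q :: "real \<Rightarrow> real"
    and \<phi>1 \<phi>2 :: "complex \<Rightarrow> cfun" and m_inf :: "complex \<Rightarrow> complex"
    and A B m S Dmin :: real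
  assumes "locally_summable l q"
    and "has_deficiency_indices l q 1 1"
    and "nonnegative_op l (Dom_min l q) (SL l q)"
    and "fundamental_solutions l q \<phi>1 \<phi>2"
    and "weyl_function l \<phi>1 \<phi>2 m_inf"
    and "((\<lambda>t::real. m_inf (of_real t)) \<longlongrightarrow> of_real m) (at_left 0)"
    and "A = Re (m_inf \<i>)"
    and "B = - Im (m_inf \<i>)"
    and "extremal_L_systems l q S \<noteq> {}"
    and "Dmin = - Im (m_inf \<i>) * coth S - sqrt (B\<^sup>2 * (csch S)\<^sup>2 - (A - m)\<^sup>2)"
  shows "(\<exists>(\<mu>, h) \<in> extremal_L_systems l q S. dissipation_coefficient h = Dmin) \<and>
         (\<forall>(\<mu>, h) \<in> extremal_L_systems l q S. Dmin \<le> dissipation_coefficient h) \<and>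
         {(\<mu>, h). (\<mu>, h) \<in> extremal_L_systems l q S \<and> dissipation_coefficient h = Dmin} =
         {(\<mu>, h). h = - of_real m + \<i> * of_real Dmin}"
proof -
  interpret nonnegative_half_line l q \<phi>1 \<phi>2 m_inf
    using assms(3-5) by unfold_locales
  have B: "0 < B" using weyl_function_i(1) assms(8) by simp
  define C where "C = (\<lambda>D. (A - m)\<^sup>2 + (B - D)\<^sup>2 = exp (- S) ^ 2 * ((A - m)\<^sup>2 + (B + D)\<^sup>2))"
  have mem: "(\<mu>, h) \<in> extremal_L_systems l q S \<longleftrightarrow> 0 < Im h \<and> Re h = - m \<and> C (Im h)" for \<mu> h
    using mem_extremal_L_systems_iff[OF assms(6)] by (simp add: C_def assms(7,8))
  obtain \<mu>0 h0 where h0: "0 < Im h0" "C (Im h0)" using assms(9) mem by force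
  \<comment> \<open>For \<open>B, D > 0\<close> the modulus of \<open>B - D\<close> is below \<open>B + D\<close>, so the factor \<open>exp (- S)\<close> is below \<open>1\<close>.\<close>
  have S: "S > 0"
  proof (rule ccontr)
    assume "\<not> S > 0"
    then have "1 \<le> exp (- S) ^ 2" by (simp add: one_le_power)
    then have "1 * ((A - m)\<^sup>2 + (B + Im h0)\<^sup>2) \<le> exp (- S) ^ 2 * ((A - m)\<^sup>2 + (B + Im h0)\<^sup>2)"
      by (intro mult_right_mono) auto
    then have "(B + Im h0)\<^sup>2 \<le> (B - Im h0)\<^sup>2" using h0(2) by (simp add: C_def)
    then have "B * Im h0 \<le> 0" by (simp add: power2_eq_square algebra_simps)
    then show False using B h0(1) by (simp add: mult_le_0_iff)
  qed
  define \<Delta> where "\<Delta> = B\<^sup>2 * (csch S)\<^sup>2 - (A - m)\<^sup>2"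
  have C_iff: "C D \<longleftrightarrow> (D - B * coth S)\<^sup>2 = \<Delta>" for D
    unfolding C_def \<Delta>_def by (rule dissipation_quadratic[OF S])
  have \<Delta>: "\<Delta> \<ge> 0" using h0(2) by (metis C_iff zero_le_power2)
  have Dmin: "Dmin = B * coth S - sqrt \<Delta>" using assms(10) by (simp add: \<Delta>_def assms(8))
  have CD: "C Dmin" unfolding C_iff Dmin using \<Delta> by simp
  have least: "Dmin \<le> D" if "C D" for D
  proof -
    have "sqrt ((D - B * coth S)\<^sup>2) = sqrt \<Delta>" using that C_iff by simp
    then show ?thesis unfolding Dmin by (simp add: abs_if split: if_splits)
  qed
  \<comment> \<open>The other root is positive, and the product of the roots is \<open>B\<^sup>2 + (A - m)\<^sup>2\<close>.\<close>
  have pos: "0 < Dmin"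
  proof -
    have "coth S > 0" using S by (simp add: coth_def cosh_real_pos)
    then have "0 < B * coth S + sqrt \<Delta>" using B \<Delta> by (simp add: add_pos_nonneg)
    moreover have "Dmin * (B * coth S + sqrt \<Delta>) = (B * coth S)\<^sup>2 - \<Delta>"
      unfolding Dmin using \<Delta> by (simp add: algebra_simps power2_eq_square)
    moreover have "(B * coth S)\<^sup>2 - \<Delta> = B\<^sup>2 + (A - m)\<^sup>2"
    proof -
      have "(coth S)\<^sup>2 = 1 + (csch S)\<^sup>2"
        using S cosh_square_eq[of S] by (simp add: coth_def csch_def field_simps)
      then show ?thesis by (simp add: \<Delta>_def power_mult_distrib algebra_simps)
    qed
    ultimately show ?thesis
      using B by (metis add_pos_nonneg zero_le_power2 zero_less_mult_pos2 zero_less_power)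
  qed
  have opt: "(\<mu>, h) \<in> extremal_L_systems l q S \<and> Im h = Dmin \<longleftrightarrow> h = - of_real m + \<i> * of_real Dmin" for \<mu> h
    unfolding mem using CD pos by (auto simp: complex_eq_iff)
  show ?thesis
    unfolding dissipation_coefficient_def
  proof (intro conjI)
    have "(Infty, - of_real m + \<i> * of_real Dmin) \<in> extremal_L_systems l q S \<and>
        Im (- of_real m + \<i> * of_real Dmin) = Dmin"
      using opt[of Infty "- of_real m + \<i> * of_real Dmin"] by simp
    then show "\<exists>(\<mu>, h)\<in>extremal_L_systems l q S. Im h = Dmin" by blast
    show "\<forall>(\<mu>, h)\<in>extremal_L_systems l q S. Dmin \<le> Im h" using mem least by blast
    show "{(\<mu>, h). (\<mu>, h) \<in> extremal_L_systems l q S \<and> Im h = Dmin} = {(\<mu>, h). h = - of_real m + \<i> * of_real Dmin}"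
      using opt by simp
  qed
qed

end
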